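(* Let $(\sigma,\rho)$ be a fixed pair of subsets of $\mathbb{N}$, each finite or co-finite, and let $c$ be a fixed positive integer. Given a colored graph $G$ on $n\ge 2$ vertices together with a linear ordering of $V(G)$ of MIM-width at most $c$, one can enumerate all $1$-minimal $\mathbf{Red}$ $(\sigma,\rho)$-dominating sets of $G$ with linear delay and polynomial space.
   Context: $\mathbb{N}=\{0,1,2,\dots\}$. A colored graph is a graph $G$ with sets $\mathbf{Red},\mathbf{Blue}\subseteq V(G)$, $\mathbf{Red}\cup\mathbf{Blue}=V(G)$. For disjoint $A,B\subseteq V(G)$, $\mathrm{mim}_G(A,B)$ is the maximum size of an induced matching in the bipartite graph $G[A,B]$ with vertex set $A\cup B$ and edges $\{uv\in E(G):u\in A,v\in B\}$. For an ordering $x_1,\dots,x_n$, with $A_i=\{x_1,\dots,x_i\}$ and $\overline{A_i}=V(G)\setminus A_i$, the MIM-width of the ordering is $\max_{1\le i\le n-1}\max\{\mathrm{mim}_G(A_i\cap\mathbf{Red},\overline{A_i}\cap\mathbf{Blue}),\mathrm{mim}_G(A_i\cap\mathbf{Blue},\overline{A_i}\cap\mathbf{Red})\}$. A set $D$ $(\sigma,\rho)$-dominates $u$ if $|N_G(u)\cap D|\in\sigma$ when $u\in D$ and $\in\rho$ when $u\notin D$. A $\mathbf{Red}$ $(\sigma,\rho)$-dominating set is a $D\subseteq\mathbf{Red}$ that $(\sigma,\rho)$-dominates all of $\mathbf{Blue}$; it is $1$-minimal if for each $x\in D$, $D\setminus\{x\}$ is not a $\mathbf{Red}$ $(\sigma,\rho)$-dominating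 set. An enumeration algorithm lists all members without repetition; it has linear delay if the time until the first output is polynomial in $n+m$ ($m=|E(G)|$) and each subsequent delay (including until termination) is bounded by a linear function of $n+m$. *)

theory Defs
  imports "HOL-Computational_Algebra.Polynomial"
begin

section \<open>Colored graphs, domination and MIM-width\<close>

text \<open>Graphs are simple and undirected; an edge is the two-element set of its ends.\<close>

record 'v cgraph =
  verts :: "'v set"
  edges :: "'v set set"
  Red :: "'v set"
  Blue :: "'v set"

definition colored_graph :: "'v cgraph \<Rightarrow> bool" where
  "colored_graph G \<longleftrightarrow> finite (verts G) \<and> (\<forall>e\<in>edges G. e \<subseteq> verts G \<and> card e = 2)
     \<and> Red G \<union> Blue G = verts G"

definition neighbors :: "'v cgraph \<Rightarrow> 'v \<Rightarrow> 'v set" where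
  "neighbors G u = {v. {u, v} \<in> edges G}"

definition dominates :: "nat set \<Rightarrow> nat set \<Rightarrow> 'v cgraph \<Rightarrow> 'v set \<Rightarrow> 'v \<Rightarrow> bool" where
  "dominates \<sigma> \<rho> G D u \<longleftrightarrow>
     (if u \<in> D then card (neighbors G u \<inter> D) \<in> \<sigma> else card (neighbors G u \<inter> D) \<in> \<rho>)"

definition red_dominating :: "nat set \<Rightarrow> nat set \<Rightarrow> 'v cgraph \<Rightarrow> 'v set \<Rightarrow> bool" where
  "red_dominating \<sigma> \<rho> G D \<longleftrightarrow> D \<subseteq> Red G \<and> (\<forall>u\<in>Blue G. dominates \<sigma> \<rho> G D u)"

definition one_minimal :: "nat set \<Rightarrow> nat set \<Rightarrow> 'v cgraph \<Rightarrow> 'v set \<Rightarrow> bool" where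
  "one_minimal \<sigma> \<rho> G D \<longleftrightarrow>
     red_dominating \<sigma> \<rho> G D \<and> (\<forall>x\<in>D. \<not> red_dominating \<sigma> \<rho> G (D - {x}))"

definition bip_edges :: "'v cgraph \<Rightarrow> 'v set \<Rightarrow> 'v set \<Rightarrow> 'v set set" where
  "bip_edges G A B = {{u, v} | u v. u \<in> A \<and> v \<in> B \<and> {u, v} \<in> edges G}"

definition induced_matching :: "'v set set \<Rightarrow> 'v set set \<Rightarrow> bool" where
  "induced_matching F M \<longleftrightarrow> M \<subseteq> F \<and>
     (\<forall>e\<in>M. \<forall>f\<in>M. e \<noteq> f \<longrightarrow> e \<inter> f = {} \<and> \<not> (\<exists>g\<in>F. g \<inter> e \<noteq> {} \<and> g \<inter> f \<noteq> {}))"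

definition mim :: "'v cgraph \<Rightarrow> 'v set \<Rightarrow> 'v set \<Rightarrow> nat" where
  "mim G A B = Max (card ` {M. induced_matching (bip_edges G A B) M})"

definition linear_ordering :: "'v cgraph \<Rightarrow> 'v list \<Rightarrow> bool" where
  "linear_ordering G xs \<longleftrightarrow> distinct xs \<and> set xs = verts G"

text \<open>Only meaningful for orderings of at least two vertices: otherwise the index range is empty.\<close>

definition mim_width :: "'v cgraph \<Rightarrow> 'v list \<Rightarrow> nat" where
  "mim_width G xs = (MAX i\<in>{1..length xs - 1}.
     let A = set (take i xs); A' = verts G - A
     in max (mim G (A \<inter> Red G) (A' \<inter> Blue G)) (mim G (A \<inter> Blue G) (A' \<inter> Red G)))"


section \<open>Random access machines\<close>

text \<open>
  The machine model is a uniform-cost RAM with logarithmic word length, programmed in a structured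
  language. It has a read-only input array, finitely many (per program) zero-initialised arrays of
  natural numbers with indirect addressing, and a write-only output. A scalar register is cell 0 of
  an array.
\<close>

type_synonym store = "nat \<Rightarrow> nat \<Rightarrow> nat"  \<comment> \<open>array name, address\<close>

datatype aexp =
    Const nat
  | Input aexp
  | Cell nat aexp
  | Plus aexp aexp
  | Minus aexp aexp
  | Times aexp aexp
  | Div aexp aexp

fun aval :: "nat list \<Rightarrow> store \<Rightarrow> aexp \<Rightarrow> nat" where
  "aval inp s (Const k) = k"
| "aval inp s (Input e) = (let i = aval inp s e in if i < length inp then inp ! i else 0)"
| "aval inp s (Cell x e) = s x (aval inp s e)"
| "aval inp s (Plus e f) = aval inp s e + aval inp s f"
| "aval inp s (Minus e f) = aval inp s e - aval inp s f"
| "aval inp s (Times e f) = aval inp s e * aval inp s f"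
| "aval inp s (Div e f) = aval inp s e div aval inp s f"

text \<open>
  A solution is output by emitting its elements one at a time and then closing it with
  \<open>Finish\<close>. Conditions are true when nonzero.
\<close>

datatype com =
    Assign nat aexp aexp  \<comment> \<open>array name, address, value\<close>
  | Seq com com
  | If aexp com com
  | While aexp com
  | Emit aexp
  | Finish

text \<open>
  A configuration consists of the commands still to be executed, the store, the elements emitted
  since the last \<open>Finish\<close>, and the solutions output so far in order. The control stack has
  length bounded in terms of the program only.
\<close>

datatype config = Config (todo: "com list") (store: store) (pending: "nat list") (outs: "nat list list")

text \<open>
  Every step costs one time unit: expressions occurring in a fixed program have constant size, and
  the word length is controlled by \<open>word_bounded\<close> below.
\<close>

fun step :: "nat list \<Rightarrow> config \<Rightarrow> config" where
  "step inp (Config [] s ws os) = Config [] s ws os"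
| "step inp (Config (Assign x e f # cs) s ws os) =
     Config cs (s(x := (s x)(aval inp s e := aval inp s f))) ws os"
| "step inp (Config (Seq c d # cs) s ws os) = Config (c # d # cs) s ws os"
| "step inp (Config (If e c d # cs) s ws os) =
     Config ((if aval inp s e \<noteq> 0 then c else d) # cs) s ws os"
| "step inp (Config (While e c # cs) s ws os) =
     Config (if aval inp s e \<noteq> 0 then c # While e c # cs else cs) s ws os"
| "step inp (Config (Emit e # cs) s ws os) = Config cs s (ws @ [aval inp s e]) os"
| "step inp (Config (Finish # cs) s ws os) = Config cs s [] (os @ [ws])"

definition run :: "com \<Rightarrow> nat list \<Rightarrow> nat \<Rightarrow> config" where
  "run P inp t = (step inp ^^ t) (Config [P] (\<lambda>x a. 0) [] [])"

definition halted :: "config \<Rightarrow> bool" where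
  "halted C \<longleftrightarrow> todo C = []"


section \<open>Enumeration with linear delay and polynomial space\<close>

definition enumerates :: "com \<Rightarrow> nat list \<Rightarrow> nat set set \<Rightarrow> bool" where
  "enumerates P inp S \<longleftrightarrow> (\<exists>t. let C = run P inp t in
     halted C \<and> pending C = [] \<and> (\<forall>ws\<in>set (outs C). distinct ws) \<and>
     distinct (map set (outs C)) \<and> set ` set (outs C) = S)"

text \<open>
  The time of the \<open>k\<close>-th output, or the halting time if there are fewer than \<open>k\<close>
  outputs; a well-defined \<open>LEAST\<close> for halting runs.
\<close>

definition out_time :: "com \<Rightarrow> nat list \<Rightarrow> nat \<Rightarrow> nat" where
  "out_time P inp k = (LEAST t. halted (run P inp t) \<or> k \<le> length (outs (run P inp t)))"

text \<open>
  All addresses and contents in use stay at most \<open>B\<close>. For \<open>B\<close> polynomial in the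
  instance size this is logarithmic word length, also for the intermediate values of the expressions
  of a fixed program.
\<close>

definition word_bounded :: "com \<Rightarrow> nat list \<Rightarrow> nat \<Rightarrow> bool" where
  "word_bounded P inp B \<longleftrightarrow>
     (\<forall>t x a. let v = store (run P inp t) x a in v \<noteq> 0 \<longrightarrow> a \<le> B \<and> v \<le> B)"

text \<open>
  The number of working cells that are nonzero at some point of the run; a finite set for halting
  runs.
\<close>

definition space :: "com \<Rightarrow> nat list \<Rightarrow> nat" where
  "space P inp = card {(x, a). \<exists>t. store (run P inp t) x a \<noteq> 0}"

text \<open>
  An enumeration problem is given by its instances, their encodings, their sizes, and the sets of
  solutions to be listed. One program has to serve all instances. Index \<open>k = card (sols i)\<close>
  is the delay between the last output and termination; with no solutions at all, the bound
  \<open>poly p\<close> applies to the halting time.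
\<close>

definition linear_delay_poly_space ::
  "'i set \<Rightarrow> ('i \<Rightarrow> nat list) \<Rightarrow> ('i \<Rightarrow> nat) \<Rightarrow> ('i \<Rightarrow> nat set set) \<Rightarrow> bool" where
  "linear_delay_poly_space I enc sz sols \<longleftrightarrow>
     (\<exists>P (p :: nat poly) (q :: nat poly) (w :: nat poly) a b. \<forall>i\<in>I.
        enumerates P (enc i) (sols i) \<and>
        out_time P (enc i) 1 \<le> poly p (sz i) \<and>
        (\<forall>k\<in>{1..card (sols i)}.
           out_time P (enc i) (Suc k) \<le> out_time P (enc i) k + (a * sz i + b)) \<and>
        word_bounded P (enc i) (poly w (sz i)) \<and>
        space P (enc i) \<le> poly q (sz i))"


section \<open>Input format\<close>

text \<open>
  The input graph has vertices \<open>0, \<dots>, n - 1\<close> and comes as a list of its edges, each listed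
  once, in any order and with either orientation.
\<close>

definition edge_listing :: "nat cgraph \<Rightarrow> (nat \<times> nat) list \<Rightarrow> bool" where
  "edge_listing G es \<longleftrightarrow>
     distinct (map (\<lambda>(u, v). {u, v}) es) \<and> set (map (\<lambda>(u, v). {u, v}) es) = edges G"

definition encode :: "nat cgraph \<Rightarrow> nat list \<Rightarrow> (nat \<times> nat) list \<Rightarrow> nat list" where
  "encode G xs es =
     [card (verts G), card (edges G)]
     @ map (\<lambda>v. of_bool (v \<in> Red G)) [0..<card (verts G)]
     @ map (\<lambda>v. of_bool (v \<in> Blue G)) [0..<card (verts G)]
     @ xs
     @ concat (map (\<lambda>(u, v). [u, v]) es)"

end

theory Submission
  imports Defs
begin

text \<open>
  A solution \<open>D\<close> is read along the ordering by an automaton. At the cut before position \<open>j\<close> its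
  state records, for the blue vertices on either side, the capped number of neighbours in \<open>D\<close> on
  the other side, and the same for the red vertices and the set \<open>W\<close> of blue vertices that lose
  their domination when a neighbour leaves \<open>D\<close>; \<open>D\<close> is 1-minimal if and only if each of its
  elements has a neighbour in \<open>W\<close> or is a blue vertex that would not be dominated outside \<open>D\<close>. What lies ahead is guessed and
  verified later, but \<open>D\<close> determines all guesses, so accepting paths correspond to solutions
  one to one. Bounded MIM-width makes boundedly many vertices represent each of these count vectors, so
  states can be coded by numbers of polynomial size; keeping only the least code of each class
  preserves uniqueness. The program tabulates, for each layer, the next successor from which the last
  layer can be reached, by plain exhaustive search. After that no dead end is ever entered,
  and the lexicographically next path is found in one backward and one forward sweep of constant-time
  table lookups.
\<close>

section \<open>Timed Hoare triples\<close>

text \<open>Whether a blue vertex loses its domination depends on its final number of chosen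
  neighbours, hence on vertices that come after it; so no one-sided count suffices, and a state
  carries profiles in both directions across the cut. The outputs may be exponentially many, so
  repetitions cannot be filtered out afterwards in polynomial space: uniqueness has to be built into
  the paths. Counts are capped at \<open>dd\<close>, where membership in \<sigma> and \<rho> is
  already constant from \<open>dd - 1\<close> on, because minimality asks about counts after the
  loss of one neighbour. A profile is described by \<open>dd * c\<close> vertices, and four of them
  make a code, so the number of codes has a fixed exponent. The time before the first output may be
  any polynomial, which pays for the whole table; its entries are indexed by a lower bound for the
  successor as well, so that finding a larger sibling during the enumeration is a single lookup
  instead of a search through all codes.\<close>

definition bnd :: "nat \<Rightarrow> store \<Rightarrow> bool" where
  "bnd B s \<longleftrightarrow> (\<forall>x a. s x a \<noteq> 0 \<longrightarrow> a \<le> B \<and> s x a \<le> B)"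

lemma bnd_upd: "bnd B s \<Longrightarrow> a \<le> B \<Longrightarrow> v \<le> B \<Longrightarrow> bnd B (s(x := (s x)(a := v)))"
  by (auto simp: bnd_def)

text \<open>\<open>T\<close> only bounds the number of steps, so branches of different cost can
  share it. The store is bounded at every intermediate time because \<open>word_bounded\<close>
  speaks of all times.\<close>

definition reach :: "nat list \<Rightarrow> nat \<Rightarrow> nat \<Rightarrow> config \<Rightarrow> config \<Rightarrow> bool" where
  "reach inp B T C C' \<longleftrightarrow>
     (\<exists>t\<le>T. (step inp ^^ t) C = C' \<and> (\<forall>t'\<le>t. bnd B (store ((step inp ^^ t') C))))"

lemma reach_trans:
  assumes "reach inp B T1 C C'" "reach inp B T2 C' C''" "T1 + T2 \<le> T"
  shows "reach inp B T C C''"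
proof -
  obtain t1 where t1: "t1 \<le> T1" "(step inp ^^ t1) C = C'"
    "\<And>t'. t' \<le> t1 \<Longrightarrow> bnd B (store ((step inp ^^ t') C))" using assms(1) by (auto simp: reach_def)
  obtain t2 where t2: "t2 \<le> T2" "(step inp ^^ t2) C' = C''"
    "\<And>t'. t' \<le> t2 \<Longrightarrow> bnd B (store ((step inp ^^ t') C'))" using assms(2) by (auto simp: reach_def)
  have sh: "(step inp ^^ (t1 + k)) C = (step inp ^^ k) C'" for k
    by (metis add.commute comp_apply funpow_add t1(2))
  show ?thesis unfolding reach_def
  proof (intro exI conjI allI impI)
    show "t1 + t2 \<le> T" using t1 t2 assms by simp
    show "(step inp ^^ (t1 + t2)) C = C''" using sh t2 by simp
    fix t' assume "t' \<le> t1 + t2"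
    show "bnd B (store ((step inp ^^ t') C))"
    proof (cases "t' \<le> t1")
      case False
      then have "t' = t1 + (t' - t1)" "t' - t1 \<le> t2" using \<open>t' \<le> t1 + t2\<close> by auto
      then show ?thesis using sh t2(3) by metis
    qed (use t1 in auto)
  qed
qed

lemma reach_step:
  assumes "bnd B (store C)" "bnd B (store (step inp C))" "step inp C = C'" "T \<ge> 1"
  shows "reach inp B T C C'"
  unfolding reach_def
  by (rule exI[of _ 1]) (use assms in \<open>auto simp: le_Suc_eq\<close>)

lemma reach_bnd: "reach inp B T C C' \<Longrightarrow> bnd B (store C')"
  unfolding reach_def by auto

lemma reach_mono: "reach inp B T C C' \<Longrightarrow> T \<le> T' \<Longrightarrow> reach inp B T' C C'"
  unfolding reach_def using le_trans by blast

text \<open>\<open>s'\<close> and \<open>w'\<close> are chosen before the continuation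
  \<open>cs\<close> and the earlier outputs \<open>os\<close>, so triples compose under any control
  stack. As \<open>os\<close> stays unchanged, \<open>Finish\<close> has no triple.\<close>

definition tr :: "nat list \<Rightarrow> nat \<Rightarrow> (store \<Rightarrow> nat list \<Rightarrow> bool) \<Rightarrow> com \<Rightarrow> nat \<Rightarrow>
    (store \<Rightarrow> nat list \<Rightarrow> bool) \<Rightarrow> bool" where
  "tr inp B P c T Q \<longleftrightarrow> (\<forall>s w. P s w \<longrightarrow> bnd B s \<longrightarrow> (\<exists>s' w'. Q s' w' \<and>
     (\<forall>cs os. reach inp B T (Config (c # cs) s w os) (Config cs s' w' os))))"

lemma trD:
  assumes "tr inp B P c T Q" "P s w" "bnd B s"
  obtains s' w' where "Q s' w'" "bnd B s'"
    "\<And>cs os. reach inp B T (Config (c # cs) s w os) (Config cs s' w' os)"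
proof -
  obtain s' w' where *: "Q s' w'" "\<And>cs os. reach inp B T (Config (c # cs) s w os) (Config cs s' w' os)"
    using assms unfolding tr_def by blast
  from reach_bnd[OF *(2)[of "[]" "[]"]] have "bnd B s'" by simp
  with * that show ?thesis by blast
qed

lemma tr_conseq:
  assumes "tr inp B P c T Q" "\<And>s w. P' s w \<Longrightarrow> P s w" "\<And>s w. Q s w \<Longrightarrow> Q' s w" "T \<le> T'"
  shows "tr inp B P' c T' Q'"
  unfolding tr_def
proof (intro allI impI)
  fix s w assume "P' s w" "bnd B s"
  then obtain s' w' where "Q s' w'" "bnd B s'"
    "\<And>cs os. reach inp B T (Config (c # cs) s w os) (Config cs s' w' os)"
    using trD[OF assms(1)] assms(2) by metis
  then show "\<exists>s' w'. Q' s' w' \<and> (\<forall>cs os. reach inp B T' (Config (c # cs) s w os) (Config cs s' w' os))"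
    using assms(3,4) reach_mono by blast
qed

lemma tr_Assign:
  assumes "\<And>s w. P s w \<Longrightarrow> aval inp s e \<le> B \<and> aval inp s f \<le> B \<and>
     Q (s(x := (s x)(aval inp s e := aval inp s f))) w"
  shows "tr inp B P (Assign x e f) 1 Q"
  unfolding tr_def
proof (intro allI impI)
  fix s w assume P: "P s w" "bnd B s"
  show "\<exists>s' w'. Q s' w' \<and> (\<forall>cs os. reach inp B 1 (Config (Assign x e f # cs) s w os) (Config cs s' w' os))"
    using assms[OF P(1)] P
    by (intro exI[of _ "s(x := (s x)(aval inp s e := aval inp s f))"] exI[of _ w])
      (auto intro!: reach_step bnd_upd)
qed

lemma tr_Emit:
  assumes "\<And>s w. P s w \<Longrightarrow> Q s (w @ [aval inp s e])"
  shows "tr inp B P (Emit e) 1 Q"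
  unfolding tr_def
proof (intro allI impI)
  fix s w assume P: "P s w" "bnd B s"
  show "\<exists>s' w'. Q s' w' \<and> (\<forall>cs os. reach inp B 1 (Config (Emit e # cs) s w os) (Config cs s' w' os))"
    using assms[OF P(1)] P
    by (intro exI[of _ s] exI[of _ "w @ [aval inp s e]"]) (auto intro!: reach_step)
qed

lemma tr_Seq:
  assumes "tr inp B P c T1 R" "tr inp B R d T2 Q"
  shows "tr inp B P (Seq c d) (1 + T1 + T2) Q"
  unfolding tr_def
proof (intro allI impI)
  fix s w assume P: "P s w" "bnd B s"
  obtain s1 w1 where 1: "R s1 w1" "bnd B s1"
    "\<And>cs os. reach inp B T1 (Config (c # cs) s w os) (Config cs s1 w1 os)"
    using trD[OF assms(1) P] by metis
  obtain s2 w2 where 2: "Q s2 w2" "bnd B s2"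
    "\<And>cs os. reach inp B T2 (Config (d # cs) s1 w1 os) (Config cs s2 w2 os)"
    using trD[OF assms(2) 1(1,2)] by metis
  have "reach inp B (1 + T1 + T2) (Config (Seq c d # cs) s w os) (Config cs s2 w2 os)" for cs os
  proof (rule reach_trans[OF reach_step reach_trans[OF 1(3) 2(3)]])
    show "step inp (Config (Seq c d # cs) s w os) = Config (c # d # cs) s w os" by simp
  qed (use P in auto)
  with 2 show "\<exists>s' w'. Q s' w' \<and>
      (\<forall>cs os. reach inp B (1 + T1 + T2) (Config (Seq c d # cs) s w os) (Config cs s' w' os))" by blast
qed

lemma tr_If:
  assumes "tr inp B (\<lambda>s w. P s w \<and> aval inp s e \<noteq> 0) c T1 Q"
    "tr inp B (\<lambda>s w. P s w \<and> aval inp s e = 0) d T2 Q" "T1 \<le> T" "T2 \<le> T"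
  shows "tr inp B P (If e c d) (1 + T) Q"
  unfolding tr_def
proof (intro allI impI)
  fix s w assume P: "P s w" "bnd B s"
  let ?c = "if aval inp s e \<noteq> 0 then c else d"
  \<comment> \<open>For one fixed initial configuration the branch taken is known, so a single
    triple for \<open>?c\<close> covers both cases.\<close>
  have "tr inp B (\<lambda>s' w'. s' = s \<and> w' = w) ?c T Q"
  proof (cases "aval inp s e \<noteq> 0")
    case True
    then have "?c = c" by simp
    then show ?thesis using P True by (auto intro!: tr_conseq[OF assms(1)] assms)
  next
    case False
    then have "?c = d" by simp
    then show ?thesis using P False by (auto intro!: tr_conseq[OF assms(2)] assms)
  qed
  from trD[OF this _ P(2), of w] obtain s1 w1 where 1: "Q s1 w1" "bnd B s1"
    "\<And>cs os. reach inp B T (Config (?c # cs) s w os) (Config cs s1 w1 os)" by auto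
  have "reach inp B (1 + T) (Config (If e c d # cs) s w os) (Config cs s1 w1 os)" for cs os
  proof (rule reach_trans[OF reach_step 1(3)])
    show "step inp (Config (If e c d # cs) s w os) = Config (?c # cs) s w os" by simp
  qed (use P in auto)
  with 1 show "\<exists>s' w'. Q s' w' \<and>
      (\<forall>cs os. reach inp B (1 + T) (Config (If e c d # cs) s w os) (Config cs s' w' os))" by blast
qed

text \<open>Subtraction on natural numbers is truncated, so \<open>1 - (a - b)\<close> is the truth
  value of \<open>a \<le> b\<close> as 0 or 1; products of such values are conjunctions.\<close>

definition leE :: "aexp \<Rightarrow> aexp \<Rightarrow> aexp" where "leE a b = Minus (Const 1) (Minus a b)"
definition notE :: "aexp \<Rightarrow> aexp" where "notE a = Minus (Const 1) a"
definition ltE :: "aexp \<Rightarrow> aexp \<Rightarrow> aexp" where "ltE a b = notE (leE b a)"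
definition eqE :: "aexp \<Rightarrow> aexp \<Rightarrow> aexp" where "eqE a b = Times (leE a b) (leE b a)"

lemma aval_boolE [simp]:
  "aval inp s (leE a b) = of_bool (aval inp s a \<le> aval inp s b)"
  "aval inp s (notE a) = of_bool (aval inp s a = 0)"
  "aval inp s (ltE a b) = of_bool (aval inp s a < aval inp s b)"
  "aval inp s (eqE a b) = of_bool (aval inp s a = aval inp s b)"
  by (auto simp: leE_def notE_def ltE_def eqE_def)

definition For :: "nat \<Rightarrow> aexp \<Rightarrow> com \<Rightarrow> com" where
  "For x e c = Seq (Assign x (Const 0) (Const 0))
     (While (ltE (Cell x (Const 0)) e) (Seq c (Assign x (Const 0) (Plus (Cell x (Const 0)) (Const 1)))))"

definition cell :: "nat \<Rightarrow> nat \<Rightarrow> store \<Rightarrow> store" where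
  "cell x v s = s(x := (s x)(0 := v))"

lemma cell_simps [simp]:
  "cell x v s x 0 = v" "y \<noteq> x \<Longrightarrow> cell x v s y = s y" "a \<noteq> 0 \<Longrightarrow> cell x v s x a = s x a"
  by (auto simp: cell_def)

text \<open>The invariant at count \<open>k\<close> is stated with the counter already set to \<open>k\<close>.\<close>

lemma tr_For:
  assumes init: "\<And>s w. P s w \<Longrightarrow> I 0 (cell x 0 s) w"
    and inv: "\<And>k s w. k \<le> N \<Longrightarrow> I k s w \<Longrightarrow> s x 0 = k \<and> aval inp s e = N"
    and body: "\<And>k. k < N \<Longrightarrow> tr inp B (I k) c T (\<lambda>s w. s x 0 = k \<and> I (Suc k) (cell x (Suc k) s) w)"
    and NB: "N \<le> B"
  shows "tr inp B P (For x e c) (N * (T + 3) + 3) (I N)"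
proof -
  define inc where "inc = Assign x (Const 0) (Plus (Cell x (Const 0)) (Const 1))"
  define W where "W = While (ltE (Cell x (Const 0)) e) (Seq c inc)"
  \<comment> \<open>The body, the increment and the unfolding of \<open>Seq\<close> make
    \<open>T + 2\<close>; the loop test raises a round to \<open>T + 3\<close>.\<close>
  have b1: "tr inp B (I k) (Seq c inc) (T + 2) (I (Suc k))" if "k < N" for k
  proof -
    have "tr inp B (\<lambda>s w. s x 0 = k \<and> I (Suc k) (cell x (Suc k) s) w) inc 1 (I (Suc k))"
      unfolding inc_def using NB that by (intro tr_Assign) (auto simp: cell_def)
    from tr_Seq[OF body[OF that] this] show ?thesis by (rule tr_conseq) auto
  qed
  have lp: "\<exists>s' w'. I N s' w' \<and> bnd B s' \<and>
     (\<forall>cs os. reach inp B ((N - k) * (T + 3) + 1) (Config (W # cs) s w os) (Config cs s' w' os))"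
    if "I k s w" "bnd B s" "k \<le> N" for k s w
    using that
  proof (induction "N - k" arbitrary: k s w)
    case 0
    then have [simp]: "k = N" by simp
    have "reach inp B 1 (Config (W # cs) s w os) (Config cs s w os)" for cs os
      using 0 inv[of k s w] unfolding W_def by (intro reach_step) auto
    then show ?case using 0 by auto
  next
    case (Suc j)
    then have k: "k < N" "j = N - Suc k" by auto
    obtain s1 w1 where 1: "I (Suc k) s1 w1" "bnd B s1"
      "\<And>cs os. reach inp B (T + 2) (Config (Seq c inc # cs) s w os) (Config cs s1 w1 os)"
      using trD[OF b1[OF k(1)] Suc.prems(1,2)] by metis
    obtain s2 w2 where 2: "I N s2 w2" "bnd B s2"
      "\<And>cs os. reach inp B ((N - Suc k) * (T + 3) + 1) (Config (W # cs) s1 w1 os) (Config cs s2 w2 os)"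
      using Suc.hyps(1)[OF k(2) 1(1,2)] k by auto
    have e: "(N - k) * (T + 3) + 1 = 1 + ((T + 2) + ((N - Suc k) * (T + 3) + 1))"
      unfolding Suc_diff_Suc[OF k(1), symmetric] by simp
    have "reach inp B ((N - k) * (T + 3) + 1) (Config (W # cs) s w os) (Config cs s2 w2 os)" for cs os
      unfolding e
    proof (rule reach_trans[OF reach_step reach_trans[OF 1(3) 2(3)]])
      show "step inp (Config (W # cs) s w os) = Config (Seq c inc # W # cs) s w os"
        using inv[of k s w] Suc.prems k unfolding W_def by simp
    qed (use Suc.prems inv[of k s w] k in \<open>auto simp: W_def\<close>)
    then show ?case using 2 by blast
  qed
  have "tr inp B (I 0) W (N * (T + 3) + 1) (I N)"
    unfolding tr_def using lp[of 0] by fastforce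
  moreover have "tr inp B P (Assign x (Const 0) (Const 0)) 1 (I 0)"
    using init by (intro tr_Assign) (auto simp: cell_def)
  ultimately have "tr inp B P (Seq (Assign x (Const 0) (Const 0)) W) (1 + 1 + (N * (T + 3) + 1)) (I N)"
    by (rule tr_Seq[rotated])
  then show ?thesis unfolding For_def W_def inc_def by (rule tr_conseq) auto
qed

section \<open>Space is bounded by the word length\<close>

fun arrs :: "com \<Rightarrow> nat set" where
  "arrs (Assign x e f) = {x}"
| "arrs (Seq c d) = arrs c \<union> arrs d"
| "arrs (If e c d) = arrs c \<union> arrs d"
| "arrs (While e c) = arrs c"
| "arrs (Emit e) = {}"
| "arrs Finish = {}"

lemma finite_arrs: "finite (arrs c)"
  by (induction c) auto

lemma step_arrs:
  assumes "\<Union>(arrs ` set (todo C)) \<subseteq> X" "\<And>x a. x \<notin> X \<Longrightarrow> store C x a = 0"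
  shows "\<Union>(arrs ` set (todo (step inp C))) \<subseteq> X \<and> (\<forall>x a. x \<notin> X \<longrightarrow> store (step inp C) x a = 0)"
  using assms by (cases "(inp, C)" rule: step.cases) (auto split: if_splits)

lemma run_arrs:
  "\<Union>(arrs ` set (todo (run P inp t))) \<subseteq> arrs P \<and> (\<forall>x a. x \<notin> arrs P \<longrightarrow> store (run P inp t) x a = 0)"
proof (induction t)
  case (Suc t)
  have "run P inp (Suc t) = step inp (run P inp t)" by (simp add: run_def)
  then show ?case using step_arrs[of "run P inp t" "arrs P" inp] Suc by metis
qed (simp add: run_def)

text \<open>Only the finitely many arrays assigned by the program ever become nonzero, and the word
  bound limits their addresses.\<close>

lemma space_le:
  assumes "word_bounded P inp B"
  shows "space P inp \<le> card (arrs P) * (B + 1)"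
proof -
  have "x \<in> arrs P \<and> a \<le> B" if nz: "store (run P inp t) x a \<noteq> 0" for x a t
  proof
    show "x \<in> arrs P" using run_arrs[of P inp t] nz by metis
    show "a \<le> B" using assms nz unfolding word_bounded_def Let_def by metis
  qed
  then have "{(x, a). \<exists>t. store (run P inp t) x a \<noteq> 0} \<subseteq> arrs P \<times> {..B}" by blast
  then have "space P inp \<le> card (arrs P \<times> {..B})"
    unfolding space_def by (intro card_mono) (auto simp: finite_arrs)
  then show ?thesis by (simp add: card_cartesian_product)
qed

section \<open>Delay of an output loop\<close>

lemma run_add: "run P inp (t + k) = (step inp ^^ k) (run P inp t)"
  unfolding run_def by (metis add.commute comp_apply funpow_add)

lemma step_outs: "length (outs C) \<le> length (outs (step inp C))"
  by (cases "(inp, C)" rule: step.cases) auto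

lemma outs_mono: "t \<le> t' \<Longrightarrow> length (outs (run P inp t)) \<le> length (outs (run P inp t'))"
  by (induction t' rule: dec_induct) (auto simp: run_def intro: order_trans step_outs)

lemma halted_stays:
  assumes "halted (run P inp t)" "t \<le> t'"
  shows "run P inp t' = run P inp t"
  using assms(2)
proof (induction t' rule: dec_induct)
  case (step k)
  have "step inp (run P inp t) = run P inp t"
    using assms(1) by (cases "run P inp t") (auto simp: halted_def)
  then show ?case using step by (simp add: run_def)
qed simp

text \<open>
  An output occurs at most one iteration before the loop head at which it is first visible, so the
  loop heads alone determine the delay up to a factor of two.
\<close>

lemma output_loop:
  assumes pre: "reach inp B T0 (Config [P] (\<lambda>x a. 0) [] []) (Config [While e c] s0 [] [])"
    and J0: "J 0 s0"
    and cont: "\<And>k s. k < K \<Longrightarrow> J k s \<Longrightarrow> bnd B s \<Longrightarrow> aval inp s e \<noteq> 0 \<and> (\<exists>s'. J (Suc k) s' \<and>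
        (\<forall>os. reach inp B T1 (Config [c, While e c] s [] os) (Config [While e c] s' [] (os @ [out k]))))"
    and stop: "\<And>s. J K s \<Longrightarrow> aval inp s e = 0"
  shows "\<exists>t. halted (run P inp t) \<and> pending (run P inp t) = [] \<and> outs (run P inp t) = map out [0..<K]"
    and "out_time P inp 1 \<le> T0 + T1 + 1"
    and "k \<in> {1..K} \<Longrightarrow> out_time P inp (Suc k) \<le> out_time P inp k + (2 * T1 + 3)"
    and "word_bounded P inp B"
proof -
  define W where "W = While e c"
  \<comment> \<open>A loop head is recorded as a pair of store and time. Beyond \<open>K\<close> the
    predicate is vacuous, so that dependent choice can run over all indices.\<close>
  define R where "R = (\<lambda>k (s, u). k \<le> K \<longrightarrow> J k s \<and> bnd B s \<and> run P inp u = Config [W] s [] (map out [0..<k])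
     \<and> (\<forall>t\<le>u. bnd B (store (run P inp t))))"
  have "\<exists>f. (\<forall>k. R k (f k) \<and> (k < K \<longrightarrow> snd (f (Suc k)) \<le> snd (f k) + T1 + 1)) \<and> snd (f 0) \<le> T0"
  proof -
    obtain u0 where u0: "u0 \<le> T0" "run P inp u0 = Config [W] s0 [] []"
      "\<forall>t\<le>u0. bnd B (store (run P inp t))"
      using pre unfolding reach_def run_def W_def by auto
    have "bnd B s0" using reach_bnd[OF pre] by simp
    then have R0: "R 0 (s0, u0)" using u0 J0 by (auto simp: R_def)
    have ex: "\<exists>y. R (Suc k) y \<and> (k < K \<longrightarrow> snd y \<le> snd x + T1 + 1)" if "R k x" for k x
    proof (cases "k < K")
      case False
      then show ?thesis by (intro exI[of _ x]) (auto simp: R_def)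
    next
      case True
      obtain s u where x: "x = (s, u)" by fastforce
      have r: "J k s" "bnd B s" "run P inp u = Config [W] s [] (map out [0..<k])"
        "\<And>t. t \<le> u \<Longrightarrow> bnd B (store (run P inp t))"
        using that True by (auto simp: R_def x)
      obtain s' where s': "aval inp s e \<noteq> 0" "J (Suc k) s'"
        "\<And>os. reach inp B T1 (Config [c, W] s [] os) (Config [W] s' [] (os @ [out k]))"
        using cont[OF True r(1,2)] unfolding W_def by auto
      have "reach inp B (1 + T1) (run P inp u) (Config [W] s' [] (map out [0..<k] @ [out k]))"
        unfolding r(3) by (rule reach_trans[OF reach_step s'(3)]) (use s'(1) r(2) in \<open>auto simp: W_def\<close>)
      then obtain t where t: "t \<le> 1 + T1" "run P inp (u + t) = Config [W] s' [] (map out [0..<Suc k])"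
        "\<And>t'. t' \<le> t \<Longrightarrow> bnd B (store (run P inp (u + t')))"
        unfolding reach_def run_add by auto
      have "bnd B (store (run P inp t'))" if "t' \<le> u + t" for t'
      proof (cases "t' \<le> u")
        case False
        then have "t' = u + (t' - u)" "t' - u \<le> t" using that by auto
        then show ?thesis using t(3) by metis
      qed (use r in auto)
      moreover have "bnd B s'" using t(2) t(3)[of t] by simp
      ultimately show ?thesis using t s' by (intro exI[of _ "(s', u + t)"]) (auto simp: R_def x)
    qed
    have "\<exists>f. \<forall>k. (R k (f k) \<and> (k = 0 \<longrightarrow> f k = (s0, u0))) \<and> (k < K \<longrightarrow> snd (f (Suc k)) \<le> snd (f k) + T1 + 1)"
      by (rule dependent_nat_choice) (use R0 ex in auto)
    then obtain f where "\<forall>k. (R k (f k) \<and> (k = 0 \<longrightarrow> f k = (s0, u0))) \<and> (k < K \<longrightarrow> snd (f (Suc k)) \<le> snd (f k) + T1 + 1)"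
      by blast
    then show ?thesis using u0 by (intro exI[of _ f]) auto
  qed
  then obtain f where f: "\<And>k. R k (f k)" "\<And>k. k < K \<Longrightarrow> snd (f (Suc k)) \<le> snd (f k) + T1 + 1"
    "snd (f 0) \<le> T0" by blast
  define u where "u = (\<lambda>k. snd (f k))"
  define S where "S = (\<lambda>k. fst (f k))"
  have r: "J k (S k)" "bnd B (S k)" "run P inp (u k) = Config [W] (S k) [] (map out [0..<k])" 
    "\<And>t. t \<le> u k \<Longrightarrow> bnd B (store (run P inp t))" if "k \<le> K" for k
    using f(1)[of k] that by (auto simp: R_def u_def S_def split: prod.splits)
  have u: "\<And>k. k < K \<Longrightarrow> u (Suc k) \<le> u k + T1 + 1" "u 0 \<le> T0" using f by (auto simp: u_def)
  have fin: "run P inp (Suc (u K)) = Config [] (S K) [] (map out [0..<K])"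
    using r(3)[of K] stop[OF r(1)[of K]] by (simp add: run_def W_def)
  have hf: "halted (run P inp (Suc (u K)))" using fin by (simp add: halted_def)
  show "\<exists>t. halted (run P inp t) \<and> pending (run P inp t) = [] \<and> outs (run P inp t) = map out [0..<K]"
    using fin hf by (intro exI[of _ "Suc (u K)"]) auto
  have up: "out_time P inp k \<le> u k" if "k \<le> K" for k
    unfolding out_time_def by (rule Least_le) (use r(3)[OF that] in auto)
  have up': "out_time P inp (Suc k) \<le> u k + T1 + 1" if "k \<le> K" for k
  proof (cases "k < K")
    case True
    then show ?thesis using up[of "Suc k"] u(1)[of k] by simp
  next
    case False
    then have "k = K" using that by simp
    have "out_time P inp (Suc k) \<le> Suc (u K)"
      unfolding out_time_def by (rule Least_le) (use hf in auto)
    then show ?thesis using \<open>k = K\<close> by simp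
  qed
  show "out_time P inp 1 \<le> T0 + T1 + 1" using up'[of 0] u(2) by simp
  \<comment> \<open>At head \<open>k\<close> exactly \<open>k\<close> outputs exist and the loop is
    still on the control stack, so neither output \<open>k + 1\<close> nor termination comes
    earlier.\<close>
  have lo: "u k \<le> out_time P inp (Suc k)" if "k \<le> K" for k
  proof (rule ccontr)
    assume "\<not> u k \<le> out_time P inp (Suc k)"
    then have lt: "out_time P inp (Suc k) < u k" by simp
    have "halted (run P inp (Suc (u K))) \<or> Suc k \<le> length (outs (run P inp (Suc (u K))))"
      using hf by simp
    then have "halted (run P inp (out_time P inp (Suc k))) \<or>
       Suc k \<le> length (outs (run P inp (out_time P inp (Suc k))))"
      unfolding out_time_def by (rule LeastI)
    then show False
    proof
      assume "halted (run P inp (out_time P inp (Suc k)))"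
      from halted_stays[OF this less_imp_le[OF lt]] this show False
        unfolding r(3)[OF that] by (metis config.sel(1) halted_def list.discI)
    next
      assume "Suc k \<le> length (outs (run P inp (out_time P inp (Suc k))))"
      also have "\<dots> \<le> length (outs (run P inp (u k)))" using lt by (intro outs_mono) simp
      finally show False using r(3)[OF that] by simp
    qed
  qed
  show "out_time P inp (Suc k) \<le> out_time P inp k + (2 * T1 + 3)" if "k \<in> {1..K}"
  proof -
    \<comment> \<open>Two iterations suffice: from head \<open>k - 1\<close>, before which output
      \<open>k\<close> cannot occur, to head \<open>k\<close>, and from there to output
      \<open>k + 1\<close>.\<close>
    obtain j where j: "k = Suc j" "j < K" using \<open>k \<in> {1..K}\<close> by (cases k) auto
    have "out_time P inp (Suc k) \<le> u k + T1 + 1" using up'[of k] j by simp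
    also have "u k \<le> u j + T1 + 1" using u(1)[of j] j by simp
    also have "u j \<le> out_time P inp k" using lo[of j] j by simp
    finally show ?thesis by simp
  qed
  have "bnd B (store (run P inp t))" for t
  proof (cases "t \<le> u K")
    case False
    then have "run P inp t = run P inp (Suc (u K))" using halted_stays[OF hf, of t] by simp
    then show ?thesis using fin r(2)[of K] by simp
  qed (use r(4)[of K] in auto)
  then show "word_bounded P inp B" unfolding word_bounded_def bnd_def Let_def by blast
qed

section \<open>Lexicographic enumeration of the paths of a layered graph\<close>

definition lex_less :: "(nat \<Rightarrow> nat) \<Rightarrow> (nat \<Rightarrow> nat) \<Rightarrow> bool" where
  "lex_less u v \<longleftrightarrow> (\<exists>l. (\<forall>j<l. u j = v j) \<and> u l < v l)"

lemma lex_less_irrefl: "\<not> lex_less u u"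
  by (auto simp: lex_less_def)

lemma lex_less_trans:
  assumes "lex_less u v" "lex_less v w" shows "lex_less u w"
proof -
  obtain l where l: "\<And>j. j < l \<Longrightarrow> u j = v j" "u l < v l" using assms by (auto simp: lex_less_def)
  obtain m where m: "\<And>j. j < m \<Longrightarrow> v j = w j" "v m < w m" using assms by (auto simp: lex_less_def)
  have "u (min l m) < w (min l m)"
    using l m by (cases l m rule: linorder_cases) (auto simp: min_def)
  then show ?thesis unfolding lex_less_def using l m by (intro exI[of _ "min l m"]) auto
qed

lemma lex_less_total: "u = v \<or> lex_less u v \<or> lex_less v u"
proof (cases "u = v")
  case False
  then obtain i where "u i \<noteq> v i" by blast
  define l where "l = (LEAST i. u i \<noteq> v i)"
  have "u l \<noteq> v l" unfolding l_def by (rule LeastI) fact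
  moreover have "u j = v j" if "j < l" for j using not_less_Least[of j "\<lambda>i. u i \<noteq> v i"] that l_def by auto
  ultimately show ?thesis unfolding lex_less_def by (metis linorder_neqE_nat)
qed simp

lemma ex_sorted_wrt:
  assumes "finite S" "\<And>u v. u = v \<or> R u v \<or> R v u" "\<And>u v w. R u v \<Longrightarrow> R v w \<Longrightarrow> R u w"
  shows "\<exists>L. sorted_wrt R L \<and> set L = S"
  using assms(1)
proof (induction S rule: finite_induct)
  case (insert x S)
  then obtain L where L: "sorted_wrt R L" "set L = S" by blast
  let ?L = "filter (\<lambda>y. R y x) L @ [x] @ filter (\<lambda>y. \<not> R y x) L"
  have "R x y" if "y \<in> S" "\<not> R y x" for y using assms(2)[of x y] that insert by auto
  then have "sorted_wrt R ?L"
    using L assms(3) by (auto simp: sorted_wrt_append sorted_wrt_filter)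
  moreover have "set ?L = insert x S" using L by auto
  ultimately show ?case by blast
qed simp

lemma sorted_wrt_first:
  assumes "sorted_wrt R L" "v \<in> set L" "\<And>u. \<not> R u u" "\<And>u v w. R u v \<Longrightarrow> R v w \<Longrightarrow> R u w"
    "\<And>w. w \<in> set L \<Longrightarrow> v = w \<or> R v w"
  shows "0 < length L" "L ! 0 = v"
proof -
  show "0 < length L" using assms(2) by (cases L) auto
  obtain i where i: "i < length L" "L ! i = v" using assms(2) by (auto simp: in_set_conv_nth)
  show "L ! 0 = v"
  proof (cases "i = 0")
    case False
    then have "R (L ! 0) v" using sorted_wrt_nth_less[OF assms(1), of 0 i] i by auto
    then show ?thesis using assms(3,4,5) \<open>0 < length L\<close> nth_mem by metis
  qed (use i in simp)
qed

text \<open>The next entry is recognised by its order property alone; thus the enumeration never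
  needs an explicit description of the sorted list.\<close>

lemma sorted_wrt_next:
  assumes "sorted_wrt R L" "k < length L" "v \<in> set L" "\<And>u. \<not> R u u" "\<And>u v w. R u v \<Longrightarrow> R v w \<Longrightarrow> R u w"
    "R (L ! k) v" "\<And>w. w \<in> set L \<Longrightarrow> R (L ! k) w \<Longrightarrow> v = w \<or> R v w"
  shows "Suc k < length L" "L ! Suc k = v"
proof -
  obtain i where i: "i < length L" "L ! i = v" using assms(3) by (auto simp: in_set_conv_nth)
  have "k < i"
  proof (rule ccontr)
    assume "\<not> k < i"
    then have "i = k \<or> R v (L ! k)" using sorted_wrt_nth_less[OF assms(1), of i k] i assms(2) by fastforce
    then show False using assms(4,5,6) i by metis
  qed
  then show *: "Suc k < length L" using i by simp
  show "L ! Suc k = v"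
  proof (cases "i = Suc k")
    case False
    then have "R (L ! Suc k) v" using sorted_wrt_nth_less[OF assms(1), of "Suc k" i] i \<open>k < i\<close> by auto
    moreover have "R (L ! k) (L ! Suc k)" using sorted_wrt_nth_less[OF assms(1), of k "Suc k"] * by auto
    ultimately show ?thesis using assms(4,5,7) * nth_mem by metis
  qed (use i in simp)
qed

locale layered =
  fixes n M :: nat and E :: "nat \<Rightarrow> nat \<Rightarrow> nat \<Rightarrow> bool"
  assumes M_pos: "M > 0"
begin

definition good :: "nat \<Rightarrow> nat \<Rightarrow> bool" where
  "good j q \<longleftrightarrow> (\<exists>st. st j = q \<and> (\<forall>i. j \<le> i \<and> i < n \<longrightarrow> st (Suc i) < M \<and> E i (st i) (st (Suc i))))"

definition Eg :: "nat \<Rightarrow> nat \<Rightarrow> nat \<Rightarrow> bool" where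
  "Eg j q q' \<longleftrightarrow> q' < M \<and> E j q q' \<and> good (Suc j) q'"

text \<open>Layer \<open>n\<close> gets the junk value \<open>0\<close>, which is also how an unwritten cell looks; it makes all
  states of the last layer good.\<close>

definition nx :: "nat \<Rightarrow> nat \<Rightarrow> nat \<Rightarrow> nat" where
  "nx j q b = (if n \<le> j then 0 else if \<exists>q'\<ge>b. Eg j q q' then LEAST q'. b \<le> q' \<and> Eg j q q' else M)"

text \<open>The value 0 beyond \<open>n\<close> makes paths equal as functions as soon as their
  states agree.\<close>

definition paths :: "(nat \<Rightarrow> nat) set" where
  "paths = {st. st 0 = 0 \<and> (\<forall>i<n. st (Suc i) < M \<and> E i (st i) (st (Suc i))) \<and> (\<forall>i>n. st i = 0)}"

lemma good_last: "n \<le> j \<Longrightarrow> good j q"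
  unfolding good_def by auto

lemma good_unfold:
  assumes "j < n" shows "good j q \<longleftrightarrow> (\<exists>q'. Eg j q q')"
proof
  assume "good j q"
  then obtain st where "st j = q" "\<And>i. j \<le> i \<Longrightarrow> i < n \<Longrightarrow> st (Suc i) < M \<and> E i (st i) (st (Suc i))"
    unfolding good_def by auto
  then have "Eg j q (st (Suc j))" unfolding Eg_def good_def using assms by (auto intro!: exI[of _ st])
  then show "\<exists>q'. Eg j q q'" ..
next
  assume "\<exists>q'. Eg j q q'"
  then obtain q' st where st: "q' < M" "E j q q'" "st (Suc j) = q'"
    "\<And>i. Suc j \<le> i \<Longrightarrow> i < n \<Longrightarrow> st (Suc i) < M \<and> E i (st i) (st (Suc i))"
    unfolding Eg_def good_def by auto
  have "(st(j := q)) (Suc i) < M \<and> E i ((st(j := q)) i) ((st(j := q)) (Suc i))" if "j \<le> i" "i < n" for i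
    using st(1-3) st(4)[of i] that by (cases "i = j") auto
  then show "good j q" unfolding good_def by (intro exI[of _ "st(j := q)"]) auto
qed

lemma nx_le: "nx j q b \<le> M"
proof (cases "\<exists>q'\<ge>b. Eg j q q'")
  case True
  then obtain q' where "b \<le> q' \<and> Eg j q q'" by blast
  then have "Eg j q (LEAST q'. b \<le> q' \<and> Eg j q q')" by (metis (mono_tags, lifting) LeastI)
  then show ?thesis by (auto simp: nx_def Eg_def)
next
  case False
  then have "nx j q b = (if n \<le> j then 0 else M)" unfolding nx_def by argo
  then show ?thesis by simp
qed

lemma nx_Eg:
  assumes "j < n" "nx j q b < M" shows "b \<le> nx j q b" "Eg j q (nx j q b)"
proof -
  have "\<exists>q'\<ge>b. Eg j q q'" using assms unfolding nx_def by (auto split: if_splits)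
  then obtain q' where q': "b \<le> q' \<and> Eg j q q'" by blast
  have "nx j q b = (LEAST q'. b \<le> q' \<and> Eg j q q')" using q' assms unfolding nx_def by auto
  moreover have "b \<le> (LEAST q'. b \<le> q' \<and> Eg j q q') \<and> Eg j q (LEAST q'. b \<le> q' \<and> Eg j q q')"
    using LeastI[of "\<lambda>q'. b \<le> q' \<and> Eg j q q'", OF q'] .
  ultimately show "b \<le> nx j q b" "Eg j q (nx j q b)" by auto
qed

lemma nx_least:
  assumes "Eg j q q'" "b \<le> q'" shows "nx j q b \<le> q'"
  using assms Least_le[of "\<lambda>q'. b \<le> q' \<and> Eg j q q'" q'] unfolding nx_def by auto

lemma nx_less: "Eg j q q' \<Longrightarrow> b \<le> q' \<Longrightarrow> nx j q b < M"
  using nx_least[of j q q' b] by (auto simp: Eg_def)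

lemma nx_M: "j < n \<Longrightarrow> nx j q M = M"
  using nx_Eg[of j q M] nx_le[of j q M] by fastforce

lemma nx_last: "nx n q b = 0" by (simp add: nx_def)

text \<open>The recurrence by which the program fills a row from its last entry down;
  \<open>nx_M\<close> is its base.\<close>

lemma nx_rec:
  assumes "j < n" "b < M"
  shows "nx j q b = (if Eg j q b then b else nx j q (Suc b))"
proof (cases "Eg j q b")
  case True
  then show ?thesis using nx_least[OF True, of b] nx_Eg[of j q b] nx_less[OF True, of b] assms by auto
next
  case False
  have "nx j q b = nx j q (Suc b)"
  proof (rule antisym)
    show "nx j q b \<le> nx j q (Suc b)"
    proof (cases "nx j q (Suc b) < M")
      case True
      from nx_Eg[OF assms(1) True] show ?thesis by (intro nx_least) auto
    qed (use nx_le[of j q b] in auto)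
    show "nx j q (Suc b) \<le> nx j q b"
    proof (cases "nx j q b < M")
      case True
      from nx_Eg[OF assms(1) True] False have "Suc b \<le> nx j q b" by (metis Suc_leI le_neq_implies_less)
      then show ?thesis using nx_Eg[OF assms(1) True] by (intro nx_least) auto
    qed (use nx_le[of j q "Suc b"] in auto)
  qed
  with False show ?thesis by simp
qed

text \<open>Goodness is itself an entry of the table, so deciding \<open>Eg\<close> in one layer
  needs only entries of the next. In layer \<open>n\<close> the junk value 0 gives the right answer
  since \<open>M > 0\<close>.\<close>

lemma good_nx: "j \<le> n \<Longrightarrow> good j q \<longleftrightarrow> nx j q 0 < M"
  using good_unfold[of j q] nx_Eg[of j q 0] nx_less[of j q _ 0] good_last[of j q] M_pos
  by (cases "j < n") (auto simp: nx_last)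

lemma finite_paths: "finite paths"
proof (rule finite_subset)
  show "paths \<subseteq> {f. \<forall>i. (i \<in> {..n} \<longrightarrow> f i \<in> {..M}) \<and> (i \<notin> {..n} \<longrightarrow> f i = 0)}"
  proof (intro subsetI CollectI allI conjI impI)
    fix st i assume st: "st \<in> paths" "i \<in> {..n}"
    show "st i \<in> {..M}" using st by (cases i) (auto simp: paths_def less_imp_le)
  next
    fix st i assume st: "st \<in> paths" "i \<notin> {..n}"
    then show "st i = 0" by (auto simp: paths_def)
  qed
  show "finite {f. \<forall>i. (i \<in> {..n} \<longrightarrow> f i \<in> {..M}) \<and> (i \<notin> {..n} \<longrightarrow> f i = (0 :: nat))}"
    by (rule finite_set_of_finite_funs) auto
qed

lemma path_Eg:
  assumes "st \<in> paths" "i < n" shows "Eg i (st i) (st (Suc i))"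
  using assms unfolding Eg_def good_def paths_def by (auto intro!: exI[of _ st])

text \<open>Only the branching level and the new state of a coming path are stored; the rest is
  regenerated greedily. Least good successors yield the least path with the given beginning and
  never run into a dead end.\<close>

fun fillp :: "(nat \<Rightarrow> nat) \<Rightarrow> nat \<Rightarrow> nat \<Rightarrow> nat \<Rightarrow> nat" where
  "fillp st lev c 0 = st 0"
| "fillp st lev c (Suc i) = (if n \<le> i then 0 else if i < lev then st (Suc i) else if i = lev then c
     else nx i (fillp st lev c i) 0)"

lemma fillp_le: "lev < n \<Longrightarrow> i \<le> lev \<Longrightarrow> fillp st lev c i = st i"
  by (cases i) auto

lemma fillp_path:
  assumes "lev < n" "st 0 = 0" "\<And>i. i < lev \<Longrightarrow> st (Suc i) < M \<and> E i (st i) (st (Suc i))" "Eg lev (st lev) c"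
  shows "fillp st lev c \<in> paths"
proof -
  let ?f = "fillp st lev c"
  \<comment> \<open>Goodness travels along the greedy part: each state entered by \<open>Eg\<close>
    is good, so by \<open>good_nx\<close> its own entry is below \<open>M\<close> and names another
    \<open>Eg\<close> step.\<close>
  have Eg: "lev \<le> i \<longrightarrow> i < n \<longrightarrow> Eg i (?f i) (?f (Suc i))" for i
  proof (induction i)
    case 0
    then show ?case using assms by auto
  next
    case (Suc i)
    show ?case
    proof (cases "Suc i \<le> lev")
      case True
      then show ?thesis using assms fillp_le[of lev "Suc i" st c] by auto
    next
      case False
      show ?thesis
      proof (intro impI)
        assume "Suc i < n"
        then have "Eg i (?f i) (?f (Suc i))" using False Suc by simp
        then have "good (Suc i) (?f (Suc i))" by (simp add: Eg_def)
        then have "nx (Suc i) (?f (Suc i)) 0 < M" using good_nx[of "Suc i" "?f (Suc i)"] \<open>Suc i < n\<close> by simp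
        from nx_Eg(2)[OF \<open>Suc i < n\<close> this] show "Eg (Suc i) (?f (Suc i)) (?f (Suc (Suc i)))"
          using \<open>Suc i < n\<close> False by simp
      qed
    qed
  qed
  have "?f (Suc i) < M \<and> E i (?f i) (?f (Suc i))" if "i < n" for i
  proof (cases "i < lev")
    case True
    then show ?thesis using assms(1) assms(3)[of i] fillp_le[of lev i st c] by simp
  next
    case False
    then show ?thesis using Eg[of i] that unfolding Eg_def by simp
  qed
  moreover have "?f i = 0" if "i > n" for i using that by (cases i) auto
  ultimately show ?thesis using assms unfolding paths_def by auto
qed

text \<open>At the first difference the step taken by \<open>w\<close> was itself a candidate for
  the greedy choice, which therefore is smaller.\<close>

lemma fillp_least:
  assumes "lev < n" "w \<in> paths" "\<And>i. i \<le> lev \<Longrightarrow> w i = st i" "b \<le> w (Suc lev)"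
  shows "fillp st lev (nx lev (st lev) b) = w \<or> lex_less (fillp st lev (nx lev (st lev) b)) w"
proof (cases "fillp st lev (nx lev (st lev) b) = w")
  case False
  let ?f = "fillp st lev (nx lev (st lev) b)"
  define l where "l = (LEAST i. ?f i \<noteq> w i)"
  obtain i where "?f i \<noteq> w i" using False by blast
  then have l: "?f l \<noteq> w l" unfolding l_def by (rule LeastI)
  have below: "?f j = w j" if "j < l" for j
    using not_less_Least[of j "\<lambda>i. ?f i \<noteq> w i"] that l_def by auto
  have "lev < l" using l fillp_le[OF assms(1), of l st] assms(3)[of l] by (metis not_less)
  then obtain k where k: "l = Suc k" "lev \<le> k" by (cases l) auto
  have "k < n" using l assms(2) unfolding k paths_def by (cases "k < n") auto
  have "Eg k (?f k) (w (Suc k))" using path_Eg[OF assms(2) \<open>k < n\<close>] below[of k] k by simp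
  then have "?f (Suc k) \<le> w (Suc k)"
  proof (cases "k = lev")
    case True
    then show ?thesis using \<open>Eg k _ _\<close> assms(1,4) nx_least[of lev "st lev" "w (Suc lev)" b]
        fillp_le[of lev lev st "nx lev (st lev) b"] by simp
  next
    case False
    then show ?thesis using k \<open>k < n\<close> \<open>Eg k _ _\<close> nx_least[of k "?f k" "w (Suc k)" 0] by simp
  qed
  then have "lex_less ?f w" unfolding lex_less_def using below l k by (intro exI[of _ l]) auto
  then show ?thesis ..
qed simp

section \<open>The sorted list of paths and the step to the next one\<close>

definition path_list :: "(nat \<Rightarrow> nat) list" where
  "path_list = (SOME L. sorted_wrt lex_less L \<and> set L = paths)"

lemma path_list: "sorted_wrt lex_less path_list" "set path_list = paths"
proof -
  have "\<exists>L. sorted_wrt lex_less L \<and> set L = paths"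
    using finite_paths lex_less_total lex_less_trans by (rule ex_sorted_wrt) 
  then have "sorted_wrt lex_less path_list \<and> set path_list = paths"
    unfolding path_list_def by (rule someI_ex)
  then show "sorted_wrt lex_less path_list" "set path_list = paths" by auto
qed

lemma distinct_path_list: "distinct path_list"
  unfolding distinct_conv_nth
  by (metis lex_less_irrefl linorder_neqE_nat path_list(1) sorted_wrt_nth_less)

text \<open>The invariant between two outputs: the path to be output next is announced by
  \<open>lev\<close> and \<open>c\<close> but not yet written. The value \<open>M\<close> in
  \<open>c\<close> announces the end of the list.\<close>

definition pending_path :: "nat \<Rightarrow> (nat \<Rightarrow> nat) \<Rightarrow> nat \<Rightarrow> nat \<Rightarrow> bool" where
  "pending_path k st lev c \<longleftrightarrow> (if c < M then k < length path_list \<and> lev < n \<and> fillp st lev c = path_list ! k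
     else c = M \<and> k = length path_list)"

lemma pending_path_0:
  assumes "n > 0"
  shows "pending_path 0 (\<lambda>_. 0) 0 (nx 0 0 0)"
proof (cases "nx 0 0 0 < M")
  case True
  let ?f = "fillp (\<lambda>_. 0) 0 (nx 0 0 0)"
  have p: "?f \<in> paths" using nx_Eg[OF assms True] by (intro fillp_path[OF assms]) auto
  have "?f = w \<or> lex_less ?f w" if "w \<in> paths" for w
    using fillp_least[OF assms that, of "\<lambda>_. 0" 0] that by (auto simp: paths_def)
  then have "0 < length path_list" "path_list ! 0 = ?f"
    using sorted_wrt_first[OF path_list(1), of ?f] path_list(2) p lex_less_irrefl lex_less_trans by auto
  then show ?thesis using True assms by (simp add: pending_path_def)
next
  case False
  have "paths = {}"
  proof safe
    fix st assume "st \<in> paths"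
    then show "st \<in> {}" using path_Eg[of st 0] nx_less[of 0 "st 0" "st (Suc 0)" 0] assms False by (auto simp: paths_def)
  qed
  then have "path_list = []" using path_list(2) by simp
  then show ?thesis using False nx_le[of 0 0 0] by (simp add: pending_path_def)
qed

text \<open>The next path leaves the current one as late as possible, at the deepest level that
  still has a larger good successor, and takes the least such successor; \<open>top\<close> excludes
  deeper levels.\<close>

lemma pending_path_Suc:
  assumes k: "k < length path_list" "st = path_list ! k"
    and bt: "if c < M then lev < n \<and> c = nx lev (st lev) (Suc (st (Suc lev))) else c = M"
    and top: "\<And>i. i < n \<Longrightarrow> c < M \<longrightarrow> lev < i \<Longrightarrow> M \<le> nx i (st i) (Suc (st (Suc i)))"
  shows "pending_path (Suc k) st lev c"
proof -
  have st: "st \<in> paths" using k path_list(2) nth_mem by metis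
  \<comment> \<open>Every later path certifies a level with a larger good successor, namely the one
    where it leaves \<open>st\<close>.\<close>
  have gt: "\<exists>i<n. (\<forall>j\<le>i. w j = st j) \<and> Suc (st (Suc i)) \<le> w (Suc i) \<and> nx i (st i) (Suc (st (Suc i))) < M"
    if w: "w \<in> paths" "lex_less st w" for w
  proof -
    obtain l where l: "\<And>j. j < l \<Longrightarrow> st j = w j" "st l < w l" using w(2) by (auto simp: lex_less_def)
    \<comment> \<open>All paths agree at index 0 and beyond \<open>n\<close>, so the first
      difference is the target of a transition.\<close>
    have "l \<noteq> 0" using l st w(1) by (metis (mono_tags, lifting) mem_Collect_eq nat_neq_iff paths_def)
    moreover have "l \<le> n" using l st w(1) by (auto simp: paths_def intro: ccontr)
    ultimately obtain i where i: "l = Suc i" "i < n" by (cases l) auto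
    have "Eg i (st i) (w (Suc i))" using path_Eg[OF w(1) i(2)] l i by simp
    from nx_less[OF this, of "Suc (st (Suc i))"] show ?thesis
      using l i by (intro exI[of _ i]) (auto simp: less_Suc_eq_le)
  qed
  show ?thesis
  proof (cases "c < M")
    case True
    then have c: "lev < n" "c = nx lev (st lev) (Suc (st (Suc lev)))" using bt by auto
    let ?f = "fillp st lev c"
    have "st 0 = 0" and s: "\<And>i. i < lev \<Longrightarrow> st (Suc i) < M \<and> E i (st i) (st (Suc i))"
      using st c(1) by (auto simp: paths_def)
    have Eg: "Suc (st (Suc lev)) \<le> c" "Eg lev (st lev) c" using nx_Eg[OF c(1)] True c(2) by auto
    have p: "?f \<in> paths" using fillp_path[OF c(1) \<open>st 0 = 0\<close> s Eg(2)] .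
    have "st i = ?f i" if "i \<le> lev" for i using fillp_le[OF c(1) that] by simp
    moreover have "st (Suc lev) < ?f (Suc lev)" using Eg c(1) by simp
    ultimately have less: "lex_less st ?f" unfolding lex_less_def by (intro exI[of _ "Suc lev"]) auto
    have "?f = w \<or> lex_less ?f w" if w: "w \<in> paths" "lex_less st w" for w
    proof -
      obtain i where i: "i < n" "\<And>j. j \<le> i \<Longrightarrow> w j = st j" "Suc (st (Suc i)) \<le> w (Suc i)"
          "nx i (st i) (Suc (st (Suc i))) < M" using gt[OF w] by auto
      have "i \<le> lev" using top[OF i(1)] i(4) by (meson not_le)
      show ?thesis
      proof (cases "i = lev")
        case True
        then show ?thesis using fillp_least[OF c(1) w(1), of st "Suc (st (Suc lev))"] i c by simp
      next
        \<comment> \<open>If \<open>w\<close> leaves \<open>st\<close> before level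
          \<open>lev\<close>, it is already larger there, since \<open>?f\<close> still follows
          \<open>st\<close>.\<close>
        case False
        then have "Suc i \<le> lev" using \<open>i \<le> lev\<close> by simp
        then have "?f (Suc i) < w (Suc i)" using i(3) fillp_le[OF c(1), of "Suc i" st c] by simp
        moreover have "?f j = w j" if "j < Suc i" for j
          using that i(2)[of j] fillp_le[OF c(1), of j st c] \<open>i \<le> lev\<close> by simp
        ultimately show ?thesis unfolding lex_less_def by blast
      qed
    qed
    then have "Suc k < length path_list" "path_list ! Suc k = ?f"
      using sorted_wrt_next[OF path_list(1) k(1), of ?f] path_list(2) p less lex_less_irrefl lex_less_trans
      unfolding k(2)[symmetric] by auto
    then show ?thesis using True c by (simp add: pending_path_def)
  next
    case False
    have "\<not> Suc k < length path_list"
    proof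
      assume *: "Suc k < length path_list"
      then have "lex_less st (path_list ! Suc k)" unfolding k(2) using sorted_wrt_nth_less[OF path_list(1), of k "Suc k"] by auto
      moreover have "path_list ! Suc k \<in> paths" using * path_list(2) nth_mem by metis
      ultimately obtain i where "i < n" "nx i (st i) (Suc (st (Suc i))) < M" using gt by blast
      then show False using top[of i] False by auto
    qed
    then show ?thesis using False bt k(1) by (simp add: pending_path_def)
  qed
qed

end

section \<open>The automaton of solutions\<close>

locale neighbor_counts =
  fixes n dd :: nat and adj :: "nat \<Rightarrow> nat \<Rightarrow> bool"
  assumes adj_irrefl: "\<not> adj p p"
begin

text \<open>
  The equivalence \<open>k < j \<longleftrightarrow> j \<le> p\<close> says that \<open>k\<close> and \<open>p\<close> lie on different sides of the cut before
  position \<open>j\<close>, so one function serves both sides.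
\<close>

definition prof :: "(nat \<Rightarrow> bool) \<Rightarrow> nat set \<Rightarrow> nat \<Rightarrow> nat \<Rightarrow> nat" where
  "prof T Z j p = (if T p then min dd (card {k\<in>Z. adj p k \<and> (k < j \<longleftrightarrow> j \<le> p)}) else 0)"

definition deg :: "nat \<Rightarrow> nat set \<Rightarrow> nat" where
  "deg p Z = card {k\<in>Z. adj p k}"

text \<open>While \<open>p\<close> is ahead of the cut, vertices can only join the opposite side, so
  the count obeys a forward recurrence. Behind the cut they only leave it, and
  \<open>prof_down\<close> is the same recurrence read backwards.\<close>

lemma prof_up:
  assumes "finite Z" "i < p"
  shows "prof T Z (Suc i) p = min dd (prof T Z i p + of_bool (i \<in> Z \<and> T p \<and> adj p i))"
proof -
  let ?A = "{k\<in>Z. adj p k \<and> (k < i \<longleftrightarrow> i \<le> p)}"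
  have "{k\<in>Z. adj p k \<and> (k < Suc i \<longleftrightarrow> Suc i \<le> p)} = (if i \<in> Z \<and> adj p i then insert i ?A else ?A)"
    using assms by (auto simp: less_Suc_eq)
  then have "card {k\<in>Z. adj p k \<and> (k < Suc i \<longleftrightarrow> Suc i \<le> p)} = card ?A + of_bool (i \<in> Z \<and> adj p i)"
    using assms by auto
  then show ?thesis by (auto simp: prof_def)
qed

lemma prof_down:
  assumes "finite Z" "p < i"
  shows "prof T Z i p = min dd (prof T Z (Suc i) p + of_bool (i \<in> Z \<and> T p \<and> adj p i))"
proof -
  let ?A = "{k\<in>Z. adj p k \<and> (k < Suc i \<longleftrightarrow> Suc i \<le> p)}"
  have "{k\<in>Z. adj p k \<and> (k < i \<longleftrightarrow> i \<le> p)} = (if i \<in> Z \<and> adj p i then insert i ?A else ?A)"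
    using assms by (auto simp: less_Suc_eq)
  then have "card {k\<in>Z. adj p k \<and> (k < i \<longleftrightarrow> i \<le> p)} = card ?A + of_bool (i \<in> Z \<and> adj p i)"
    using assms by auto
  then show ?thesis by (auto simp: prof_def)
qed

text \<open>The cut just before \<open>i\<close> sees its earlier neighbours and the cut just after
  \<open>i\<close> its later ones; without loops these are all.\<close>

lemma prof_mid:
  assumes "finite Z" "T i"
  shows "min dd (prof T Z i i + prof T Z (Suc i) i) = min dd (deg i Z)"
proof -
  let ?A = "{k\<in>Z. adj i k \<and> (k < i \<longleftrightarrow> i \<le> i)}"
  let ?B = "{k\<in>Z. adj i k \<and> (k < Suc i \<longleftrightarrow> Suc i \<le> i)}"
  have "{k\<in>Z. adj i k} = ?A \<union> ?B" using adj_irrefl by (auto simp: less_Suc_eq)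
  moreover have "card (?A \<union> ?B) = card ?A + card ?B"
    using assms(1) by (intro card_Un_disjoint) auto
  ultimately have d: "deg i Z = card ?A + card ?B" by (simp only: deg_def)
  have "min dd (min dd a + min dd b) = min dd (a + b)" for a b by simp
  then show ?thesis unfolding d prof_def using assms(2) by (simp only: if_True)
qed

lemma prof_0: "prof T Z 0 p = 0"
proof -
  have *: "{k\<in>Z. adj p k \<and> (k < 0 \<longleftrightarrow> 0 \<le> p)} = {}" by auto
  show ?thesis unfolding prof_def * by simp
qed

lemma prof_n:
  assumes "Z \<subseteq> {..<n}" "p < n" shows "prof T Z n p = 0"
proof -
  have *: "{k\<in>Z. adj p k \<and> (k < n \<longleftrightarrow> n \<le> p)} = {}" using assms by auto
  show ?thesis unfolding prof_def * by simp
qed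

text \<open>This is why guesses that are only checked locally are right: ahead of the cut induction
  runs forward from the empty prefix, behind the cut it runs backward from the empty suffix.\<close>

lemma prof_unique:
  assumes Z: "Z \<subseteq> {..<n}"
    and "\<And>p. p < n \<Longrightarrow> V 0 p = 0" "\<And>p. p < n \<Longrightarrow> V n p = 0"
    and up: "\<And>i p. i < p \<Longrightarrow> p < n \<Longrightarrow> V (Suc i) p = min dd (V i p + of_bool (i \<in> Z \<and> T p \<and> adj p i))"
    and down: "\<And>i p. p < i \<Longrightarrow> i < n \<Longrightarrow> V i p = min dd (V (Suc i) p + of_bool (i \<in> Z \<and> T p \<and> adj p i))"
    and "j \<le> n" "p < n"
  shows "V j p = prof T Z j p"
proof (cases "j \<le> p")
  case True
  then show ?thesis
  proof (induction j)
    case (Suc j)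
    then show ?case using up[of j p] prof_up[of Z j p T] Z finite_subset assms(7) by fastforce
  qed (use assms prof_0 in auto)
next
  case False
  then have "p < j" by simp
  from \<open>j \<le> n\<close> this show ?thesis
  proof (induction j rule: inc_induct)
    case (step j)
    then show ?case using down[of p j] prof_down[of Z p j T] Z finite_subset by fastforce
  qed (use assms prof_n in auto)
qed

end

text \<open>\<open>t\<close> is the number of chosen neighbours before one of them leaves. A witness
  for a chosen vertex is adjacent to it, so \<open>t\<close> is positive where it matters and the
  truncation at 0 does no harm.\<close>

definition critical :: "nat set \<Rightarrow> nat set \<Rightarrow> bool \<Rightarrow> nat \<Rightarrow> bool" where
  "critical \<sigma> \<rho> b t \<longleftrightarrow> (if b then t - 1 \<notin> \<sigma> else t - 1 \<notin> \<rho>)"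

text \<open>States are opaque codes, seen only through \<open>bit\<close> and the decoded profiles
  \<open>VD\<close> and \<open>VW\<close>. The bit tells whether the vertex just passed is chosen;
  by \<open>rep\<close> every pair of true profiles has a code with either bit.\<close>

locale automaton = neighbor_counts +
  fixes M :: nat and red blue :: "nat \<Rightarrow> bool" and \<sigma> \<rho> :: "nat set" and bit :: "nat \<Rightarrow> bool"
    and VD VW :: "nat \<Rightarrow> nat \<Rightarrow> nat \<Rightarrow> nat"
  assumes M: "M > 0" and n: "n > 0"
    and cap_in: "min dd k \<in> \<sigma> \<longleftrightarrow> k \<in> \<sigma>" "min dd k \<in> \<rho> \<longleftrightarrow> k \<in> \<rho>"
    and cap_crit: "min dd k - 1 \<in> \<sigma> \<longleftrightarrow> k - 1 \<in> \<sigma>" "min dd k - 1 \<in> \<rho> \<longleftrightarrow> k - 1 \<in> \<rho>"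
    and dd: "dd > 0"
    and rep: "\<lbrakk>Z \<subseteq> {p. p < n \<and> red p}; W \<subseteq> {p. p < n \<and> blue p}; j \<le> n\<rbrakk> \<Longrightarrow>
       \<exists>q<M. bit q = b \<and> (\<forall>p<n. VD j q p = prof blue Z j p \<and> VW j q p = prof red W j p)"
    and start: "p < n \<Longrightarrow> VD 0 0 p = 0 \<and> VW 0 0 p = 0"
begin

definition count :: "nat \<Rightarrow> nat \<Rightarrow> nat \<Rightarrow> nat" where
  "count i q q' = min dd (VD i q i + VD (Suc i) q' i)"

definition crit :: "nat \<Rightarrow> nat \<Rightarrow> nat \<Rightarrow> bool" where
  "crit i q q' \<longleftrightarrow> blue i \<and> critical \<sigma> \<rho> (bit q') (count i q q')"

text \<open>The conditions without \<open>p\<close> are repeated for every \<open>p\<close>, so that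
  a single loop over the vertices checks a transition. The two-sided clauses are the recurrences
  \<open>prof_up\<close> and \<open>prof_down\<close>; the last one is the boundary condition that
  settles all guesses.\<close>

definition local_ok :: "nat \<Rightarrow> nat \<Rightarrow> nat \<Rightarrow> nat \<Rightarrow> bool" where
  "local_ok i q q' p \<longleftrightarrow>
     (bit q' \<longrightarrow> red i) \<and> (blue i \<longrightarrow> (if bit q' then count i q q' \<in> \<sigma> else count i q q' \<in> \<rho>)) \<and>
     (bit q' \<longrightarrow> blue i \<and> count i q q' \<notin> \<rho> \<or> VW i q i + VW (Suc i) q' i \<noteq> 0) \<and>
     (i < p \<longrightarrow> VD (Suc i) q' p = min dd (VD i q p + of_bool (bit q' \<and> blue p \<and> adj p i)) \<and>
        VW (Suc i) q' p = min dd (VW i q p + of_bool (crit i q q' \<and> red p \<and> adj p i))) \<and>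
     (p < i \<longrightarrow> VD i q p = min dd (VD (Suc i) q' p + of_bool (bit q' \<and> blue p \<and> adj p i)) \<and>
        VW i q p = min dd (VW (Suc i) q' p + of_bool (crit i q q' \<and> red p \<and> adj p i))) \<and>
     (Suc i = n \<longrightarrow> VD n q' p = 0 \<and> VW n q' p = 0)"

text \<open>Equivalent states would give a solution several paths, so only the least one is kept.\<close>

definition trans :: "nat \<Rightarrow> nat \<Rightarrow> nat \<Rightarrow> bool" where
  "trans i q q' \<longleftrightarrow>
     (\<forall>r<q'. \<not> (bit r = bit q' \<and> (\<forall>p<n. VD (Suc i) r p = VD (Suc i) q' p \<and> VW (Suc i) r p = VW (Suc i) q' p))) \<and>
     (\<forall>p<n. local_ok i q q' p)"

definition sol :: "nat set \<Rightarrow> bool" where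
  "sol Z \<longleftrightarrow> Z \<subseteq> {p. p < n \<and> red p} \<and>
     (\<forall>p<n. blue p \<longrightarrow> (if p \<in> Z then deg p Z \<in> \<sigma> else deg p Z \<in> \<rho>)) \<and>
     (\<forall>p\<in>Z. blue p \<and> deg p Z \<notin> \<rho> \<or> (\<exists>u<n. blue u \<and> adj p u \<and> critical \<sigma> \<rho> (u \<in> Z) (deg u Z)))"

definition witnesses :: "nat set \<Rightarrow> nat set" where
  "witnesses Z = {u. u < n \<and> blue u \<and> critical \<sigma> \<rho> (u \<in> Z) (deg u Z)}"

sublocale layered n M trans
  using M by unfold_locales

section \<open>Correspondence between paths and solutions\<close>

definition chosen :: "(nat \<Rightarrow> nat) \<Rightarrow> nat set" where
  "chosen st = {i. i < n \<and> bit (st (Suc i))}"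

lemma chosen_sub: "chosen st \<subseteq> {..<n}"
  by (auto simp: chosen_def)

lemma witnesses_sub: "witnesses Z \<subseteq> {..<n}"
  by (auto simp: witnesses_def)

lemma path_ok: "st \<in> paths \<Longrightarrow> i < n \<Longrightarrow> p < n \<Longrightarrow> local_ok i (st i) (st (Suc i)) p"
  by (auto simp: paths_def trans_def)

lemma path_last:
  assumes "st \<in> paths" "p < n" shows "VD n (st n) p = 0 \<and> VW n (st n) p = 0"
  using path_ok[of st "n - 1" p] assms n by (auto simp: local_ok_def)

lemma path_VD:
  assumes st: "st \<in> paths" and "j \<le> n" "p < n"
  shows "VD j (st j) p = prof blue (chosen st) j p"
proof (rule prof_unique[OF chosen_sub _ _ _ _ assms(2,3)])
  fix i p assume "i < p" "p < n"
  then show "VD (Suc i) (st (Suc i)) p = min dd (VD i (st i) p + of_bool (i \<in> chosen st \<and> blue p \<and> adj p i))"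
    using path_ok[OF st, of i p] by (simp add: local_ok_def chosen_def)
next
  fix i p assume "p < i" "i < n"
  then show "VD i (st i) p = min dd (VD (Suc i) (st (Suc i)) p + of_bool (i \<in> chosen st \<and> blue p \<and> adj p i))"
    using path_ok[OF st, of i p] by (simp add: local_ok_def chosen_def)
qed (use path_last[OF st] start st in \<open>auto simp: paths_def\<close>)

lemma count_deg:
  assumes "VD i q i = prof blue Z i i" "VD (Suc i) q' i = prof blue Z (Suc i) i" "blue i" "finite Z"
  shows "count i q q' = min dd (deg i Z)"
  using prof_mid[of Z blue i] assms by (simp add: count_def)

lemma critical_cap: "critical \<sigma> \<rho> b (min dd k) = critical \<sigma> \<rho> b k"
  using cap_crit by (auto simp: critical_def)

lemma finite_chosen: "finite (chosen st)" and finite_witnesses: "finite (witnesses Z)"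
  using finite_subset[OF chosen_sub] finite_subset[OF witnesses_sub] by auto

lemma path_count:
  assumes "st \<in> paths" "i < n" "blue i"
  shows "count i (st i) (st (Suc i)) = min dd (deg i (chosen st))"
  using assms by (intro count_deg path_VD finite_chosen) auto

text \<open>Criticality is computed from guessed counts, which \<open>path_VD\<close> has already
  shown to be true. Only this order of the arguments lets the second pair of profiles be compared
  with a well-defined set.\<close>

lemma path_crit:
  assumes "st \<in> paths" "i < n"
  shows "crit i (st i) (st (Suc i)) \<longleftrightarrow> i \<in> witnesses (chosen st)"
  using assms path_count[OF assms]
  by (auto simp: crit_def witnesses_def critical_cap chosen_def)

lemma path_VW:
  assumes st: "st \<in> paths" and "j \<le> n" "p < n"
  shows "VW j (st j) p = prof red (witnesses (chosen st)) j p"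
proof (rule prof_unique[OF witnesses_sub _ _ _ _ assms(2,3)])
  fix i p assume "i < p" "p < n"
  then show "VW (Suc i) (st (Suc i)) p =
      min dd (VW i (st i) p + of_bool (i \<in> witnesses (chosen st) \<and> red p \<and> adj p i))"
    using path_ok[OF st, of i p] path_crit[OF st, of i] by (simp add: local_ok_def)
next
  fix i p assume "p < i" "i < n"
  then show "VW i (st i) p =
      min dd (VW (Suc i) (st (Suc i)) p + of_bool (i \<in> witnesses (chosen st) \<and> red p \<and> adj p i))"
    using path_ok[OF st, of i p] path_crit[OF st, of i] by (simp add: local_ok_def)
qed (use path_last[OF st] start st in \<open>auto simp: paths_def\<close>)

text \<open>A cap \<open>dd > 0\<close> does not affect whether a count is zero, and existence of a
  witness is all that minimality asks for.\<close>

lemma witnessed: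
  assumes "VW i q i = prof red (witnesses Z) i i" "VW (Suc i) q' i = prof red (witnesses Z) (Suc i) i" "red i"
  shows "VW i q i + VW (Suc i) q' i \<noteq> 0 \<longleftrightarrow> (\<exists>u<n. blue u \<and> adj i u \<and> critical \<sigma> \<rho> (u \<in> Z) (deg u Z))"
proof -
  have "VW i q i + VW (Suc i) q' i \<noteq> 0 \<longleftrightarrow> min dd (VW i q i + VW (Suc i) q' i) \<noteq> 0" using dd by auto
  also have "\<dots> \<longleftrightarrow> min dd (deg i (witnesses Z)) \<noteq> 0"
    using prof_mid[of "witnesses Z" red i] assms finite_witnesses by simp
  also have "\<dots> \<longleftrightarrow> deg i (witnesses Z) \<noteq> 0" using dd by auto
  also have "\<dots> \<longleftrightarrow> (\<exists>u\<in>witnesses Z. adj i u)" using finite_witnesses by (auto simp: deg_def)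
  finally show ?thesis by (auto simp: witnesses_def)
qed

lemma path_sol:
  assumes st: "st \<in> paths" shows "sol (chosen st)"
proof -
  let ?Z = "chosen st"
  have ok: "local_ok i (st i) (st (Suc i)) i" if "i < n" for i using path_ok[OF st that that] .
  have "?Z \<subseteq> {p. p < n \<and> red p}" using ok by (auto simp: local_ok_def chosen_def)
  moreover have "if p \<in> ?Z then deg p ?Z \<in> \<sigma> else deg p ?Z \<in> \<rho>" if "p < n" "blue p" for p
    using ok[OF that(1)] path_count[OF st that] that cap_in by (auto simp: local_ok_def chosen_def)
  moreover have "blue p \<and> deg p ?Z \<notin> \<rho> \<or> (\<exists>u<n. blue u \<and> adj p u \<and> critical \<sigma> \<rho> (u \<in> ?Z) (deg u ?Z))"
    if "p \<in> ?Z" for p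
  proof -
    have p: "p < n" "bit (st (Suc p))" using that by (auto simp: chosen_def)
    then have "red p" using ok[of p] by (auto simp: local_ok_def)
    have "(blue p \<and> count p (st p) (st (Suc p)) \<notin> \<rho>) \<or> VW p (st p) p + VW (Suc p) (st (Suc p)) p \<noteq> 0"
      using ok[OF p(1)] p by (auto simp: local_ok_def)
    then show ?thesis
    proof
      assume "blue p \<and> count p (st p) (st (Suc p)) \<notin> \<rho>"
      then show ?thesis using path_count[OF st p(1)] cap_in by auto
    next
      assume "VW p (st p) p + VW (Suc p) (st (Suc p)) p \<noteq> 0"
      then show ?thesis using witnessed[of p "st p" ?Z "st (Suc p)"] path_VW[OF st] p \<open>red p\<close> by simp
    qed
  qed
  ultimately show ?thesis by (auto simp: sol_def)
qed

text \<open>The chosen set determines the bit and both profiles at every cut, and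
  \<open>trans\<close> admits only the least code with these data.\<close>

lemma chosen_inj: "inj_on chosen paths"
proof (rule inj_onI)
  fix st st' assume st: "st \<in> paths" "st' \<in> paths" and eq: "chosen st = chosen st'"
  show "st = st'"
  proof
    fix j
    show "st j = st' j"
    proof (cases "0 < j \<and> j \<le> n")
      case False
      then show ?thesis using st unfolding paths_def by (cases "j = 0") auto
    next
      case True
      then obtain i where i: "j = Suc i" "i < n" by (cases j) auto
      have b: "bit (st j) = bit (st' j)" using eq i unfolding chosen_def by blast
      have v: "VD j (st j) p = VD j (st' j) p" "VW j (st j) p = VW j (st' j) p" if "p < n" for p
        using path_VD[OF st(1), of j p] path_VD[OF st(2), of j p] path_VW[OF st(1), of j p]
          path_VW[OF st(2), of j p] that i eq by auto
      have t: "trans i (st i) (st j)" "trans i (st' i) (st' j)" using st i by (auto simp: paths_def)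
      have "\<not> st j < st' j" using t(2) b v i unfolding trans_def by auto
      moreover have "\<not> st' j < st j" using t(1) b v i unfolding trans_def by auto
      ultimately show ?thesis by simp
    qed
  qed
qed

text \<open>The path consists of the least codes of the true profiles of \<open>Z\<close> and its
  witnesses; all local conditions then are the recurrences of \<open>prof\<close>.\<close>

lemma sol_path:
  assumes Z: "sol Z" shows "Z \<in> chosen ` paths"
proof -
  let ?W = "witnesses Z"
  define R where "R = (\<lambda>j q. bit q = (j - 1 \<in> Z) \<and> (\<forall>p<n. VD j q p = prof blue Z j p \<and> VW j q p = prof red ?W j p))"
  define st where "st = (\<lambda>j. if j = 0 \<or> n < j then 0 else (LEAST q. R j q))"
  have Zr: "Z \<subseteq> {p. p < n \<and> red p}" using Z by (simp add: sol_def)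
  have finZ: "finite Z" by (rule finite_subset[OF Zr]) simp
  have Wb: "?W \<subseteq> {p. p < n \<and> blue p}" by (auto simp: witnesses_def)
  have ex: "\<exists>q<M. R j q" if "j \<le> n" for j
    unfolding R_def by (rule rep[OF Zr Wb that])
  have R: "R j (st j)" and sM: "st j < M" and least: "\<And>q. q < st j \<Longrightarrow> \<not> R j q" if j: "0 < j" "j \<le> n" for j
  proof -
    obtain q where q: "q < M" "R j q" using ex j by auto
    have s: "st j = (LEAST q. R j q)" using j by (simp add: st_def)
    show "R j (st j)" unfolding s by (rule LeastI) (rule q(2))
    show "st j < M" using Least_le[of "R j", OF q(2)] q(1) s by simp
    show "\<And>q. q < st j \<Longrightarrow> \<not> R j q" unfolding s by (rule not_less_Least)
  qed
  have VDW: "VD j (st j) p = prof blue Z j p \<and> VW j (st j) p = prof red ?W j p" if "j \<le> n" "p < n" for j p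
  proof (cases "j = 0")
    case True
    then show ?thesis using start[OF that(2)] prof_0 by (simp add: st_def)
  next
    case False
    then show ?thesis using R[of j] that by (simp add: R_def)
  qed
  then have VD: "\<And>j p. j \<le> n \<Longrightarrow> p < n \<Longrightarrow> VD j (st j) p = prof blue Z j p"
    and VW: "\<And>j p. j \<le> n \<Longrightarrow> p < n \<Longrightarrow> VW j (st j) p = prof red ?W j p" by auto
  have bit: "bit (st (Suc i)) \<longleftrightarrow> i \<in> Z" if "i < n" for i using R[of "Suc i"] that by (simp add: R_def)
  have count: "count i (st i) (st (Suc i)) = min dd (deg i Z)" if "i < n" "blue i" for i
    using that by (intro count_deg VD finZ) auto
  have crit: "crit i (st i) (st (Suc i)) \<longleftrightarrow> i \<in> ?W" if "i < n" for i
    using that count[OF that] bit by (auto simp: crit_def witnesses_def critical_cap)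
  have "local_ok i (st i) (st (Suc i)) p" if i: "i < n" and p: "p < n" for i p
  proof -
    have "bit (st (Suc i)) \<longrightarrow> red i" using bit[OF i] Zr by auto
    moreover have "blue i \<longrightarrow> (if bit (st (Suc i)) then count i (st i) (st (Suc i)) \<in> \<sigma>
        else count i (st i) (st (Suc i)) \<in> \<rho>)"
      using bit[OF i] count[OF i] Z i cap_in by (auto simp: sol_def)
    moreover have "bit (st (Suc i)) \<longrightarrow> blue i \<and> count i (st i) (st (Suc i)) \<notin> \<rho> \<or>
        VW i (st i) i + VW (Suc i) (st (Suc i)) i \<noteq> 0"
    proof
      assume "bit (st (Suc i))"
      then have iZ: "i \<in> Z" "red i" using bit[OF i] Zr by auto
      have "VW i (st i) i + VW (Suc i) (st (Suc i)) i \<noteq> 0 \<longleftrightarrow>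
         (\<exists>u<n. blue u \<and> adj i u \<and> critical \<sigma> \<rho> (u \<in> Z) (deg u Z))"
        using i iZ by (intro witnessed VW) auto
      moreover have "blue i \<and> deg i Z \<notin> \<rho> \<or> (\<exists>u<n. blue u \<and> adj i u \<and> critical \<sigma> \<rho> (u \<in> Z) (deg u Z))"
        using Z iZ by (auto simp: sol_def)
      ultimately show "blue i \<and> count i (st i) (st (Suc i)) \<notin> \<rho> \<or>
          VW i (st i) i + VW (Suc i) (st (Suc i)) i \<noteq> 0"
        using count[OF i] cap_in by auto
    qed
    moreover have "i < p \<longrightarrow> VD (Suc i) (st (Suc i)) p =
        min dd (VD i (st i) p + of_bool (bit (st (Suc i)) \<and> blue p \<and> adj p i)) \<and>
        VW (Suc i) (st (Suc i)) p = min dd (VW i (st i) p + of_bool (crit i (st i) (st (Suc i)) \<and> red p \<and> adj p i))"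
      using VD[of i p] VD[of "Suc i" p] VW[of i p] VW[of "Suc i" p] i p bit[OF i] crit[OF i]
        prof_up[OF finZ, of i p blue] prof_up[OF finite_witnesses, of i p red Z] by simp
    moreover have "p < i \<longrightarrow> VD i (st i) p =
        min dd (VD (Suc i) (st (Suc i)) p + of_bool (bit (st (Suc i)) \<and> blue p \<and> adj p i)) \<and>
        VW i (st i) p = min dd (VW (Suc i) (st (Suc i)) p + of_bool (crit i (st i) (st (Suc i)) \<and> red p \<and> adj p i))"
      using VD[of i p] VD[of "Suc i" p] VW[of i p] VW[of "Suc i" p] i p bit[OF i] crit[OF i]
        prof_down[OF finZ, of p i blue] prof_down[OF finite_witnesses, of p i red Z] by simp
    moreover have "Suc i = n \<longrightarrow> VD n (st (Suc i)) p = 0 \<and> VW n (st (Suc i)) p = 0"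
      using VD[of n p] VW[of n p] p prof_n[of Z p] prof_n[OF witnesses_sub, of p] Zr by auto
    ultimately show ?thesis unfolding local_ok_def by blast
  qed
  \<comment> \<open>An equivalent smaller code would satisfy \<open>R\<close> too and contradict the
    choice of the least one.\<close>
  moreover have "\<not> (bit r = bit (st (Suc i)) \<and>
      (\<forall>p<n. VD (Suc i) r p = VD (Suc i) (st (Suc i)) p \<and> VW (Suc i) r p = VW (Suc i) (st (Suc i)) p))"
    if i: "i < n" and r: "r < st (Suc i)" for i r
    using least[of "Suc i" r] R[of "Suc i"] i r by (auto simp: R_def)
  ultimately have "st \<in> paths" unfolding paths_def trans_def using sM by (auto simp: st_def)
  moreover have "chosen st = Z" using bit Zr by (auto simp: chosen_def)
  ultimately show ?thesis by blast
qed

lemma chosen_bij: "bij_betw chosen paths {Z. sol Z}"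
  unfolding bij_betw_def using chosen_inj path_sol sol_path by blast

end

section \<open>Representatives across a cut of bounded MIM-width\<close>

text \<open>In a smallest covering set every \<open>x\<close> has a private neighbour
  \<open>f x\<close>, and the pairs of \<open>x\<close> and \<open>f x\<close> behave like an
  induced matching, whose size \<open>H\<close> bounds.\<close>

lemma ex_covering_subset:
  fixes N :: "'a \<Rightarrow> 'b \<Rightarrow> bool"
  assumes "finite S"
    and H: "\<And>R f. R \<subseteq> S \<Longrightarrow> (\<And>x. x \<in> R \<Longrightarrow> f x \<in> Y) \<Longrightarrow>
       (\<And>x x'. x \<in> R \<Longrightarrow> x' \<in> R \<Longrightarrow> N (f x) x' \<longleftrightarrow> x' = x) \<Longrightarrow> card R \<le> c"
  shows "\<exists>R\<subseteq>S. card R \<le> c \<and> (\<forall>y\<in>Y. (\<exists>x\<in>S. N y x) \<longrightarrow> (\<exists>x\<in>R. N y x))"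
proof -
  let ?P = "\<lambda>R. R \<subseteq> S \<and> (\<forall>y\<in>Y. (\<exists>x\<in>S. N y x) \<longrightarrow> (\<exists>x\<in>R. N y x))"
  have "?P S" by blast
  from ex_has_least_nat[of ?P S card, OF this] obtain R where R: "?P R" "\<And>R'. ?P R' \<Longrightarrow> card R \<le> card R'" by blast
  have finR: "finite R" using R(1) assms(1) finite_subset by blast
  have "\<exists>y\<in>Y. \<forall>x'\<in>R. N y x' \<longleftrightarrow> x' = x" if x: "x \<in> R" for x
  proof -
    \<comment> \<open>Dropping \<open>x\<close> breaks the covering, and the \<open>y\<close> left
      uncovered sees nothing of \<open>R\<close> but \<open>x\<close>.\<close>
    have "card (R - {x}) < card R" using x finR by (intro psubset_card_mono) auto
    then have "\<not> ?P (R - {x})" using R(2)[of "R - {x}"] by (meson leD)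
    then obtain y where y: "y \<in> Y" "\<exists>x\<in>S. N y x" "\<And>x'. x' \<in> R - {x} \<Longrightarrow> \<not> N y x'" using R(1) by blast
    obtain x'' where "x'' \<in> R" "N y x''" using R(1) y by blast
    then show ?thesis using y x by (intro bexI[of _ y]) blast+
  qed
  then obtain f where "\<forall>x\<in>R. f x \<in> Y \<and> (\<forall>x'\<in>R. N (f x) x' \<longleftrightarrow> x' = x)" by metis
  then have "card R \<le> c" using R(1) by (intro H[of R f]) auto
  then show ?thesis using R(1) by blast
qed

text \<open>Collecting \<open>d\<close> successive covering subsets makes every capped neighbour count exact.\<close>

lemma ex_representative:
  fixes N :: "'a \<Rightarrow> 'b \<Rightarrow> bool"
  assumes "finite S"
    and H: "\<And>R f. R \<subseteq> S \<Longrightarrow> (\<And>x. x \<in> R \<Longrightarrow> f x \<in> Y) \<Longrightarrow>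
       (\<And>x x'. x \<in> R \<Longrightarrow> x' \<in> R \<Longrightarrow> N (f x) x' \<longleftrightarrow> x' = x) \<Longrightarrow> card R \<le> c"
  shows "\<exists>R\<subseteq>S. card R \<le> d * c \<and> (\<forall>y\<in>Y. min d (card {x\<in>R. N y x}) = min d (card {x\<in>S. N y x}))"
  using assms
proof (induction d arbitrary: S)
  case 0
  then show ?case by (intro exI[of _ "{}"]) auto
next
  case (Suc d)
  have "\<exists>R\<subseteq>S. card R \<le> c \<and> (\<forall>y\<in>Y. (\<exists>x\<in>S. N y x) \<longrightarrow> (\<exists>x\<in>R. N y x))"
    using Suc.prems by (rule ex_covering_subset)
  then obtain R1 where R1: "R1 \<subseteq> S" "card R1 \<le> c"
    "\<And>y. y \<in> Y \<Longrightarrow> \<exists>x\<in>S. N y x \<Longrightarrow> \<exists>x\<in>R1. N y x" by blast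
  have "\<exists>R\<subseteq>S - R1. card R \<le> d * c \<and> (\<forall>y\<in>Y. min d (card {x\<in>R. N y x}) = min d (card {x\<in>S - R1. N y x}))"
  proof (rule Suc.IH)
    show "finite (S - R1)" using Suc.prems(1) by blast
    fix R f assume "R \<subseteq> S - R1" "\<And>x. x \<in> R \<Longrightarrow> f x \<in> Y"
      "\<And>x x'. x \<in> R \<Longrightarrow> x' \<in> R \<Longrightarrow> N (f x) x' \<longleftrightarrow> x' = x"
    then show "card R \<le> c" using Suc.prems(2)[of R f] by blast
  qed
  then obtain R2 where R2: "R2 \<subseteq> S - R1" "card R2 \<le> d * c"
    "\<And>y. y \<in> Y \<Longrightarrow> min d (card {x\<in>R2. N y x}) = min d (card {x\<in>S - R1. N y x})" by blast
  have fin: "finite R1" "finite R2" "finite S" using R1(1) R2(1) Suc.prems(1) by (auto intro: finite_subset)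
  have "min (Suc d) (card {x\<in>R1 \<union> R2. N y x}) = min (Suc d) (card {x\<in>S. N y x})" if y: "y \<in> Y" for y
  proof -
    have "{x\<in>R1 \<union> R2. N y x} = {x\<in>R1. N y x} \<union> {x\<in>R2. N y x}" by blast
    then have c1: "card {x\<in>R1 \<union> R2. N y x} = card {x\<in>R1. N y x} + card {x\<in>R2. N y x}"
      using fin R2(1) card_Un_disjoint[of "{x\<in>R1. N y x}" "{x\<in>R2. N y x}"] by fastforce
    have "{x\<in>S. N y x} = {x\<in>R1. N y x} \<union> {x\<in>S - R1. N y x}" using R1(1) by blast
    then have c2: "card {x\<in>S. N y x} = card {x\<in>R1. N y x} + card {x\<in>S - R1. N y x}"
      using fin card_Un_disjoint[of "{x\<in>R1. N y x}" "{x\<in>S - R1. N y x}"] by fastforce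
    \<comment> \<open>If \<open>y\<close> has a neighbour at all, \<open>R1\<close> contributes at
      least one, so exactness up to \<open>d\<close> on the remainder gives exactness up to
      \<open>Suc d\<close>.\<close>
    show ?thesis
    proof (cases "\<exists>x\<in>S. N y x")
      case True
      then have "{x\<in>R1. N y x} \<noteq> {}" using R1(3)[OF y] by blast
      then have "card {x\<in>R1. N y x} \<noteq> 0" using fin by simp
      then show ?thesis using c1 c2 R2(3)[OF y] by linarith
    next
      case False
      then have "{x\<in>R1 \<union> R2. N y x} = {}" "{x\<in>S. N y x} = {}" using R1(1) R2(1) by blast+
      then show ?thesis by (simp only:)
    qed
  qed
  moreover have "card (R1 \<union> R2) \<le> Suc d * c" using card_Un_le[of R1 R2] R1(2) R2(2) by simp
  ultimately show ?case using R1(1) R2(1) by (intro exI[of _ "R1 \<union> R2"]) blast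
qed

lemma bip_edges_commute: "bip_edges G A B = bip_edges G B A"
proof -
  have "bip_edges G A B \<subseteq> bip_edges G B A" for A B
  proof
    fix e assume "e \<in> bip_edges G A B"
    then obtain u v where "e = {v, u}" "v \<in> B" "u \<in> A" "{v, u} \<in> edges G"
      by (auto simp: bip_edges_def insert_commute)
    then show "e \<in> bip_edges G B A" unfolding bip_edges_def by blast
  qed
  then show ?thesis by blast
qed

lemma mim_commute: "mim G A B = mim G B A"
  unfolding mim_def by (simp add: bip_edges_commute[of G A B])

text \<open>\<open>ind\<close> is the abstract form of an induced matching between
  \<open>g x\<close> and \<open>f x\<close>; here it becomes a set of edges in the bipartite graph
  between \<open>A\<close> and \<open>B\<close>.\<close>

lemma card_le_mim:
  assumes "finite (edges G)" "finite R" "A \<inter> B = {}" "\<And>x. x \<in> R \<Longrightarrow> g x \<in> A" "\<And>x. x \<in> R \<Longrightarrow> f x \<in> B"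
    and ind: "\<And>x x'. x \<in> R \<Longrightarrow> x' \<in> R \<Longrightarrow> {f x, g x'} \<in> edges G \<longleftrightarrow> x' = x"
  shows "card R \<le> mim G A B"
proof -
  let ?F = "bip_edges G A B"
  let ?e = "\<lambda>x. {g x, f x}"
  have cross: "x' = x" if "x \<in> R" "x' \<in> R" "{g x', f x} \<in> edges G" for x x'
    using ind[OF that(1,2)] that(3) by (simp add: insert_commute)
  have eF: "?e x \<in> ?F" if "x \<in> R" for x
  proof -
    have "{g x, f x} \<in> edges G" using ind[OF that that] by (simp add: insert_commute)
    then show ?thesis unfolding bip_edges_def using assms(4,5)[OF that] by blast
  qed
  \<comment> \<open>An edge meeting both pairs shares an end with both or joins one end of each, and
    \<open>ind\<close> excludes either unless \<open>x = x'\<close>. Taking for \<open>h\<close> a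
    matching edge itself also gives disjointness and injectivity.\<close>
  have meet: "x = x'" if x: "x \<in> R" "x' \<in> R" and h: "h \<in> ?F" "h \<inter> ?e x \<noteq> {}" "h \<inter> ?e x' \<noteq> {}" for x x' h
  proof -
    obtain u v where uv: "h = {u, v}" "u \<in> A" "v \<in> B" "{u, v} \<in> edges G" using h(1) by (auto simp: bip_edges_def)
    have ne: "u \<noteq> f x" "u \<noteq> f x'" "v \<noteq> g x" "v \<noteq> g x'" using uv assms(3) assms(4,5)[OF x(1)] assms(4,5)[OF x(2)] by auto
    have "(u = g x \<or> v = f x) \<and> (u = g x' \<or> v = f x')" using h(2,3) uv(1) ne by auto
    moreover have "u = g x \<and> u = g x' \<Longrightarrow> x = x'" using ind[OF x] ind[OF x(1) x(1)] by auto
    moreover have "v = f x \<and> v = f x' \<Longrightarrow> x = x'"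
      using ind[OF x(2) x(1)] ind[OF x(1) x(1)] by auto
    moreover have "u = g x \<and> v = f x' \<Longrightarrow> x = x'" using cross[OF x(2) x(1)] uv(4) by simp
    moreover have "v = f x \<and> u = g x' \<Longrightarrow> x = x'" using cross[OF x] uv(4) by simp
    ultimately show ?thesis by blast
  qed
  have "induced_matching ?F (?e ` R)"
    unfolding induced_matching_def
  proof (intro conjI ballI impI)
    show "?e ` R \<subseteq> ?F" using eF by blast
    fix e f' assume "e \<in> ?e ` R" "f' \<in> ?e ` R" "e \<noteq> f'"
    then obtain x x' where x: "x \<in> R" "x' \<in> R" "e = ?e x" "f' = ?e x'" "x \<noteq> x'" by blast
    show "\<not> (\<exists>h\<in>?F. h \<inter> e \<noteq> {} \<and> h \<inter> f' \<noteq> {})" using meet[OF x(1,2)] x by blast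
    show "e \<inter> f' = {}"
    proof (rule ccontr)
      assume "e \<inter> f' \<noteq> {}"
      then show False using meet[OF x(1,2) eF[OF x(1)]] x by blast
    qed
  qed
  moreover have "card (?e ` R) = card R"
  proof (rule card_image, rule inj_onI)
    fix x x' assume x: "x \<in> R" "x' \<in> R" and e: "?e x = ?e x'"
    show "x = x'" using meet[OF x eF[OF x(1)]] unfolding e[symmetric] by blast
  qed
  moreover have "finite {M. induced_matching ?F M}"
  proof (rule finite_subset)
    show "{M. induced_matching ?F M} \<subseteq> Pow (edges G)" unfolding induced_matching_def bip_edges_def by blast
  qed (use assms(1) in simp)
  ultimately show ?thesis unfolding mim_def by (metis (mono_tags, lifting) Max_ge finite_imageI imageI mem_Collect_eq)
qed

section \<open>Codes of states\<close>

lemma ex_code: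
  assumes "\<And>t. t < T \<Longrightarrow> g t < B"
  shows "\<exists>q<(B::nat) ^ T. \<forall>t<T. q div B ^ t mod B = g t"
  using assms
proof (induction T)
  case (Suc T)
  then obtain q where q: "q < B ^ T" "\<And>t. t < T \<Longrightarrow> q div B ^ t mod B = g t" by auto
  have gT: "g T < B" using Suc.prems by simp
  have B0: "B > 0" using gT by simp
  have "(q + g T * B ^ T) div B ^ t mod B = g t" if t: "t < Suc T" for t
  proof (cases "t = T")
    case True
    then show ?thesis using q(1) gT B0 by simp
  next
    case False
    then obtain k where k: "T = t + Suc k" using t less_imp_Suc_add[of t T] by auto
    have "g T * B ^ T = (g T * B ^ k * B) * B ^ t" unfolding k by (simp add: power_add)
    then have "(q + g T * B ^ T) div B ^ t = q div B ^ t + g T * B ^ k * B"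
      using B0 by (simp only: div_mult_self1[of "B ^ t"] power_eq_0_iff) simp
    then show ?thesis using q(2)[of t] k by simp
  qed
  moreover have "q + g T * B ^ T < B ^ Suc T"
  proof -
    have "Suc (g T) * B ^ T \<le> B * B ^ T" using gT by (intro mult_le_mono1) simp
    then show ?thesis using q(1) by simp
  qed
  ultimately show ?case by blast
qed simp

lemma ex_cutoff:
  fixes S :: "nat set"
  assumes "finite S \<or> finite (- S)"
  shows "\<exists>d. \<forall>k\<ge>d. k \<in> S \<longleftrightarrow> d \<in> S"
  using assms
proof
  assume "finite S"
  then obtain d where "\<forall>k\<in>S. k < d" using finite_nat_set_iff_bounded by blast
  then show ?thesis by (intro exI[of _ d]) (auto dest: leD)
next
  assume "finite (- S)"
  then obtain d where "\<forall>k\<in>-S. k < d" using finite_nat_set_iff_bounded by blast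
  then show ?thesis by (intro exI[of _ d]) (auto dest: leD)
qed

lemma card_filter_eq_sum: "finite R \<Longrightarrow> card {k\<in>R. P k} = (\<Sum>k\<in>R. of_bool (P k))"
  by (simp add: sum.inter_filter[symmetric] of_bool_def)

section \<open>Instances\<close>

text \<open>Membership is constant from \<open>dd - 1\<close> on rather than from \<open>dd\<close>
  on, because \<open>critical\<close> tests a capped count minus one.\<close>

locale inst =
  fixes G :: "nat cgraph" and xs :: "nat list" and es :: "(nat \<times> nat) list"
    and \<sigma> \<rho> :: "nat set" and c dd :: nat
  assumes G: "colored_graph G" and n2: "card (verts G) \<ge> 2" and V: "verts G = {0..<card (verts G)}"
    and es: "edge_listing G es" and lo: "linear_ordering G xs" and mw: "mim_width G xs \<le> c"
    and c: "c \<ge> 1" and dd: "dd > 0"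
    and cut: "\<And>k. dd - 1 \<le> k \<Longrightarrow> k \<in> \<sigma> \<longleftrightarrow> dd - 1 \<in> \<sigma>" "\<And>k. dd - 1 \<le> k \<Longrightarrow> k \<in> \<rho> \<longleftrightarrow> dd - 1 \<in> \<rho>"
begin

definition "n = length xs"
definition "adj p k \<longleftrightarrow> {xs ! p, xs ! k} \<in> edges G"
definition "red p \<longleftrightarrow> xs ! p \<in> Red G"
definition "blue p \<longleftrightarrow> xs ! p \<in> Blue G"
definition "B = n + 1"
text \<open>The size bound of \<open>ex_representative\<close>: \<open>dd\<close> covering rounds
  with at most \<open>c\<close> vertices each.\<close>

definition "r = dd * c"
text \<open>Four groups of \<open>r\<close> digits: representatives of the chosen set behind and
  ahead of the cut, then the same for the witnesses. The factor 2 makes room for the bit on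
  top.\<close>

definition "M = 2 * B ^ (4 * r)"
definition "dig t q = q div B ^ t mod B"

text \<open>Digit \<open>w + 1\<close> stands for vertex \<open>w\<close>, digit \<open>0\<close> for padding.\<close>

definition "adjd v w \<longleftrightarrow> w > 0 \<and> {v, w - 1} \<in> edges G"
definition "cnt g q p = min dd (\<Sum>t<r. of_bool (adjd (xs ! p) (dig (g * r + t) q)))"
definition "bitp q \<longleftrightarrow> q div B ^ (4 * r) \<noteq> 0"
definition "VD j q p = of_bool (blue p) * cnt (if j \<le> p then 0 else 1) q p"
definition "VW j q p = of_bool (red p) * cnt (if j \<le> p then 2 else 3) q p"

lemma distinct_xs: "distinct xs" and set_xs: "set xs = verts G"
  using lo by (auto simp: linear_ordering_def)

lemma n_card: "n = card (verts G)"
  unfolding n_def using distinct_card[OF distinct_xs] set_xs by simp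

lemma verts_n: "verts G = {0..<n}"
  using V n_card by simp

lemma n_ge2: "n \<ge> 2" using n2 n_card by simp

lemma xs_less: "p < n \<Longrightarrow> xs ! p < n"
  using verts_n set_xs nth_mem[of p xs] by (auto simp: n_def)

lemma edge_verts: "{u, v} \<in> edges G \<Longrightarrow> u < n \<and> v < n \<and> u \<noteq> v"
  using G verts_n unfolding colored_graph_def by (fastforce simp: card_insert_if split: if_splits)

lemma finite_edges: "finite (edges G)"
  by (rule finite_subset[of _ "Pow (verts G)"]) (use G in \<open>auto simp: colored_graph_def\<close>)

lemma xs_eq: "p < n \<Longrightarrow> k < n \<Longrightarrow> xs ! p = xs ! k \<longleftrightarrow> p = k"
  using nth_eq_iff_index_eq[OF distinct_xs] by (simp add: n_def)

sublocale neighbor_counts n dd adj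
proof
  show "\<not> adj p p" for p using edge_verts[of "xs ! p" "xs ! p"] unfolding adj_def by blast
qed

lemma adj_sym: "adj p k \<longleftrightarrow> adj k p"
  by (simp add: adj_def insert_commute)

section \<open>Codes for the profiles at a cut\<close>

lemma mim_cut:
  assumes "1 \<le> j" "j \<le> n - 1"
  shows "mim G (set (take j xs) \<inter> Red G) ((verts G - set (take j xs)) \<inter> Blue G) \<le> c"
    "mim G (set (take j xs) \<inter> Blue G) ((verts G - set (take j xs)) \<inter> Red G) \<le> c"
proof -
  let ?m = "\<lambda>i. let A = set (take i xs); A' = verts G - A
     in max (mim G (A \<inter> Red G) (A' \<inter> Blue G)) (mim G (A \<inter> Blue G) (A' \<inter> Red G))"
  have "?m j \<le> mim_width G xs"
    unfolding mim_width_def by (rule Max_ge) (use assms in \<open>auto simp: n_def\<close>)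
  then show "mim G (set (take j xs) \<inter> Red G) ((verts G - set (take j xs)) \<inter> Blue G) \<le> c"
    "mim G (set (take j xs) \<inter> Blue G) ((verts G - set (take j xs)) \<inter> Red G) \<le> c"
    using mw by (auto simp: Let_def)
qed

lemma side_iff:
  assumes "k < n" "j \<le> n"
  shows "xs ! k \<in> set (take j xs) \<longleftrightarrow> k < j" "xs ! k \<in> verts G"
proof -
  have "xs ! k \<in> set (take j xs) \<longleftrightarrow> (\<exists>i<j. i < n \<and> xs ! i = xs ! k)"
    using assms by (auto simp: in_set_conv_nth n_def)
  then show "xs ! k \<in> set (take j xs) \<longleftrightarrow> k < j" using xs_eq assms by auto
  show "xs ! k \<in> verts G" using assms set_xs nth_mem by (auto simp: n_def)
qed

text \<open>One statement for both assignments of colours to the sides and both directions: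
  \<open>b\<close> selects the side that is represented, \<open>S\<close> its colour and
  \<open>T\<close> the colour of the vertices that count.\<close>

lemma cut_matching:
  assumes T: "S = red \<and> T = blue \<or> S = blue \<and> T = red" and j: "j \<le> n"
    and X: "X = {k. k < n \<and> S k \<and> (k < j \<longleftrightarrow> b)}" and Y: "Y = {p. p < n \<and> T p \<and> (p < j \<longleftrightarrow> \<not> b)}"
    and R: "R \<subseteq> X" "\<And>x. x \<in> R \<Longrightarrow> f x \<in> Y" "\<And>x x'. x \<in> R \<Longrightarrow> x' \<in> R \<Longrightarrow> adj (f x) x' \<longleftrightarrow> x' = x"
  shows "card R \<le> c"
proof (cases "R = {}")
  case False
  then obtain x where x: "x \<in> R" by blast
  \<comment> \<open>A pair across the cut leaves neither side empty, so the cut is among those that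
    \<open>mim_width\<close> ranges over.\<close>
  have j1: "1 \<le> j" "j \<le> n - 1" using x R(1) R(2)[OF x] j unfolding X Y by (cases b; force)+
  have "finite R" using R(1) X by (auto intro: finite_subset[of R "{..<n}"])
  define P where "P = set (take j xs)"
  define Q where "Q = verts G - set (take j xs)"
  have side: "xs ! k \<in> (if k < j then P else Q)" if "k < n" for k
    using side_iff[OF that j] by (auto simp: P_def Q_def)
  have PQ: "P \<inter> Q = {}" by (auto simp: P_def Q_def)
  define A where "A = (if b then P else Q)"
  define A' where "A' = (if b then Q else P)"
  have AA: "A \<inter> A' = {}" using PQ by (auto simp: A_def A'_def)
  have inA: "xs ! x \<in> A \<and> S x" "xs ! f x \<in> A' \<and> T (f x)" if "x \<in> R" for x
    using side[of x] side[of "f x"] R(1) R(2)[OF that] that unfolding X Y A_def A'_def by (cases b; force)+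
  have e: "{xs ! f x, xs ! x'} \<in> edges G \<longleftrightarrow> x' = x" if "x \<in> R" "x' \<in> R" for x x'
    using R(3)[OF that] by (simp add: adj_def)
  from T show ?thesis
  proof
    assume ST: "S = red \<and> T = blue"
    have "card R \<le> mim G (A \<inter> Red G) (A' \<inter> Blue G)"
      by (rule card_le_mim[of _ _ _ _ "\<lambda>x. xs ! x" "\<lambda>x. xs ! f x", OF finite_edges \<open>finite R\<close> _ _ _ e])
        (use inA AA ST in \<open>auto simp: red_def blue_def\<close>)
    also have "\<dots> \<le> c" using mim_cut[OF j1] mim_commute[of G "Q \<inter> _" "P \<inter> _"]
      unfolding A_def A'_def P_def Q_def by (cases b) auto
    finally show ?thesis .
  next
    assume ST: "S = blue \<and> T = red"
    have "card R \<le> mim G (A \<inter> Blue G) (A' \<inter> Red G)"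
      by (rule card_le_mim[of _ _ _ _ "\<lambda>x. xs ! x" "\<lambda>x. xs ! f x", OF finite_edges \<open>finite R\<close> _ _ _ e])
        (use inA AA ST in \<open>auto simp: red_def blue_def\<close>)
    also have "\<dots> \<le> c" using mim_cut[OF j1] mim_commute[of G "Q \<inter> _" "P \<inter> _"]
      unfolding A_def A'_def P_def Q_def by (cases b) auto
    finally show ?thesis .
  qed
qed simp

lemma ex_digits:
  assumes T: "S = red \<and> T = blue \<or> S = blue \<and> T = red" and j: "j \<le> n" and Z: "Z \<subseteq> {k. k < n \<and> S k}"
  shows "\<exists>h. (\<forall>t. h t < B) \<and> (\<forall>p<n. T p \<longrightarrow> (p < j \<longleftrightarrow> \<not> b) \<longrightarrow>
    min dd (\<Sum>t<r. of_bool (adjd (xs ! p) (h t))) = min dd (card {k\<in>Z. adj p k \<and> (k < j \<longleftrightarrow> b)}))"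
proof -
  let ?S = "{k\<in>Z. k < j \<longleftrightarrow> b}"
  let ?Y = "{p. p < n \<and> T p \<and> (p < j \<longleftrightarrow> \<not> b)}"
  have finS: "finite ?S" using Z by (auto intro: finite_subset[of _ "{..<n}"])
  have "\<exists>R\<subseteq>?S. card R \<le> dd * c \<and> (\<forall>y\<in>?Y. min dd (card {x\<in>R. adj y x}) = min dd (card {x\<in>?S. adj y x}))"
  proof (rule ex_representative[OF finS])
    fix R f assume R: "R \<subseteq> ?S" "\<And>x. x \<in> R \<Longrightarrow> f x \<in> ?Y"
      "\<And>x x'. x \<in> R \<Longrightarrow> x' \<in> R \<Longrightarrow> adj (f x) x' \<longleftrightarrow> x' = x"
    have "R \<subseteq> {k. k < n \<and> S k \<and> (k < j \<longleftrightarrow> b)}" using R(1) Z by blast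
    from cut_matching[OF T j refl refl this R(2,3)] show "card R \<le> c" .
  qed
  then obtain R where R: "R \<subseteq> ?S" "card R \<le> r"
    "\<And>y. y \<in> ?Y \<Longrightarrow> min dd (card {x\<in>R. adj y x}) = min dd (card {x\<in>?S. adj y x})"
    unfolding r_def by blast
  have finR: "finite R" using R(1) finS finite_subset by blast
  obtain h where h: "bij_betw h {0..<card R} R" using ex_bij_betw_nat_finite[OF finR] by blast
  \<comment> \<open>The representatives come first; the remaining digits are padding, which is
    adjacent to nothing.\<close>
  define g where "g = (\<lambda>t. if t < card R then xs ! h t + 1 else 0)"
  have hR: "h t \<in> R" if "t < card R" for t using h that by (auto simp: bij_betw_def)
  have "g t < B" for t
  proof (cases "t < card R")
    case True
    then have "h t < n" using hR[OF True] R(1) Z by blast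
    then show ?thesis using True xs_less by (simp add: g_def B_def)
  qed (simp add: g_def B_def)
  moreover have "min dd (\<Sum>t<r. of_bool (adjd (xs ! p) (g t))) = min dd (card {k\<in>Z. adj p k \<and> (k < j \<longleftrightarrow> b)})"
    if p: "p < n" "T p" "p < j \<longleftrightarrow> \<not> b" for p
  proof -
    have "(\<Sum>t<r. of_bool (adjd (xs ! p) (g t))) = (\<Sum>t\<in>{0..<card R}. of_bool (adj p (h t)) :: nat)"
      using R(2) by (intro sum.mono_neutral_cong_right) (auto simp: g_def adjd_def adj_def)
    also have "\<dots> = (\<Sum>k\<in>R. of_bool (adj p k))" by (rule sum.reindex_bij_betw[OF h])
    also have "\<dots> = card {k\<in>R. adj p k}" using card_filter_eq_sum[OF finR] by simp
    finally have "min dd (\<Sum>t<r. of_bool (adjd (xs ! p) (g t))) = min dd (card {x\<in>?S. adj p x})"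
      using R(3)[of p] p by simp
    also have "{x\<in>?S. adj p x} = {k\<in>Z. adj p k \<and> (k < j \<longleftrightarrow> b)}" by blast
    finally show ?thesis .
  qed
  ultimately show ?thesis by blast
qed

lemma ex_state:
  assumes Z: "Z \<subseteq> {p. p < n \<and> red p}" and W: "W \<subseteq> {p. p < n \<and> blue p}" and j: "j \<le> n"
  shows "\<exists>q<M. bitp q = b \<and> (\<forall>p<n. VD j q p = prof blue Z j p \<and> VW j q p = prof red W j p)"
proof -
  obtain h0 where h0: "\<forall>t. h0 t < B" "\<forall>p<n. blue p \<longrightarrow> (p < j \<longleftrightarrow> \<not> True) \<longrightarrow>
    min dd (\<Sum>t<r. of_bool (adjd (xs ! p) (h0 t))) = min dd (card {k\<in>Z. adj p k \<and> (k < j \<longleftrightarrow> True)})"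
    using ex_digits[of red blue j Z True] j Z by blast
  obtain h1 where h1: "\<forall>t. h1 t < B" "\<forall>p<n. blue p \<longrightarrow> (p < j \<longleftrightarrow> \<not> False) \<longrightarrow>
    min dd (\<Sum>t<r. of_bool (adjd (xs ! p) (h1 t))) = min dd (card {k\<in>Z. adj p k \<and> (k < j \<longleftrightarrow> False)})"
    using ex_digits[of red blue j Z False] j Z by blast
  obtain h2 where h2: "\<forall>t. h2 t < B" "\<forall>p<n. red p \<longrightarrow> (p < j \<longleftrightarrow> \<not> True) \<longrightarrow>
    min dd (\<Sum>t<r. of_bool (adjd (xs ! p) (h2 t))) = min dd (card {k\<in>W. adj p k \<and> (k < j \<longleftrightarrow> True)})"
    using ex_digits[of blue red j W True] j W by blast
  obtain h3 where h3: "\<forall>t. h3 t < B" "\<forall>p<n. red p \<longrightarrow> (p < j \<longleftrightarrow> \<not> False) \<longrightarrow>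
    min dd (\<Sum>t<r. of_bool (adjd (xs ! p) (h3 t))) = min dd (card {k\<in>W. adj p k \<and> (k < j \<longleftrightarrow> False)})"
    using ex_digits[of blue red j W False] j W by blast
  define g where "g = (\<lambda>t. if t < r then h0 t else if t < 2 * r then h1 (t - r)
     else if t < 3 * r then h2 (t - 2 * r) else h3 (t - 3 * r))"
  have "g t < B" for t using h0(1) h1(1) h2(1) h3(1) by (simp add: g_def)
  then obtain q0 where q0: "q0 < B ^ (4 * r)" "\<And>t. t < 4 * r \<Longrightarrow> q0 div B ^ t mod B = g t"
    using ex_code[of "4 * r" g B] by auto
  define q where "q = q0 + of_bool b * B ^ (4 * r)"
  have B0: "B > 0" by (simp add: B_def)
  have "q div B ^ (4 * r) = of_bool b"
    unfolding q_def using q0(1) div_mult_self1[of "B ^ (4 * r)" q0 "of_bool b"] B0 by simp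
  then have "bitp q = b" by (simp add: bitp_def)
  have "q < M" using q0(1) by (simp add: q_def M_def)
  have d: "dig t q = g t" if t: "t < 4 * r" for t
  proof -
    obtain k where k: "4 * r = t + Suc k" using less_imp_Suc_add[OF t] by auto
    \<comment> \<open>The bit contributes a multiple of \<open>B ^ Suc t\<close> and leaves digit
      \<open>t\<close> untouched.\<close>
    have "of_bool b * B ^ (4 * r) = (of_bool b * B ^ k * B) * B ^ t" unfolding k by (simp add: power_add)
    then have "q div B ^ t = q0 div B ^ t + of_bool b * B ^ k * B"
      unfolding q_def using B0 by (simp only: div_mult_self1[of "B ^ t"] power_eq_0_iff) simp
    then show ?thesis using q0(2)[OF t] by (simp add: dig_def)
  qed
  have c0: "cnt 0 q p = min dd (\<Sum>t<r. of_bool (adjd (xs ! p) (h0 t)))" for p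
    unfolding cnt_def by (intro arg_cong[where f = "min dd"] sum.cong) (auto simp: d g_def)
  have c1: "cnt 1 q p = min dd (\<Sum>t<r. of_bool (adjd (xs ! p) (h1 t)))" for p
    unfolding cnt_def by (intro arg_cong[where f = "min dd"] sum.cong) (auto simp: d g_def)
  have c2: "cnt 2 q p = min dd (\<Sum>t<r. of_bool (adjd (xs ! p) (h2 t)))" for p
    unfolding cnt_def by (intro arg_cong[where f = "min dd"] sum.cong) (auto simp: d g_def)
  have c3: "cnt 3 q p = min dd (\<Sum>t<r. of_bool (adjd (xs ! p) (h3 t)))" for p
    unfolding cnt_def by (intro arg_cong[where f = "min dd"] sum.cong) (auto simp: d g_def)
  have "VD j q p = prof blue Z j p" "VW j q p = prof red W j p" if p: "p < n" for p
    using h0(2) h1(2) h2(2) h3(2) p c0[of p] c1[of p] c2[of p] c3[of p]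
    unfolding VD_def VW_def prof_def by (cases "j \<le> p"; simp)+
  then show ?thesis using \<open>bitp q = b\<close> \<open>q < M\<close> by blast
qed

lemma cap_cut:
  assumes "S = \<sigma> \<or> S = \<rho>"
  shows "min dd k \<in> S \<longleftrightarrow> k \<in> S" "min dd k - 1 \<in> S \<longleftrightarrow> k - 1 \<in> S"
proof -
  have cS: "\<And>k. dd - 1 \<le> k \<Longrightarrow> k \<in> S \<longleftrightarrow> dd - 1 \<in> S" using assms cut by blast
  show "min dd k \<in> S \<longleftrightarrow> k \<in> S"
  proof (cases "k \<le> dd")
    case False
    then show ?thesis using cS[of dd] cS[of k] by (metis diff_le_self le_trans min.absorb1 nat_le_linear)
  qed (simp add: min_absorb2)
  show "min dd k - 1 \<in> S \<longleftrightarrow> k - 1 \<in> S"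
  proof (cases "k \<le> dd")
    case False
    then have "min dd k = dd" "dd - 1 \<le> k - 1" by auto
    then show ?thesis using cS[of "k - 1"] by metis
  qed (simp add: min_absorb2)
qed

sublocale automaton n dd adj M red blue \<sigma> \<rho> bitp VD VW
proof
  show "M > 0" "n > 0" "dd > 0" using n_ge2 dd by (auto simp: M_def B_def)
  \<comment> \<open>Code 0 consists of padding only, which represents the zero profiles before the
    first vertex.\<close>
  show "\<And>p. p < n \<Longrightarrow> VD 0 0 p = 0 \<and> VW 0 0 p = 0"
    by (simp add: VD_def VW_def cnt_def dig_def adjd_def)
qed (use cap_cut ex_state in auto)

section \<open>From positions back to vertex sets\<close>

lemma neighbors_nth:
  assumes "Z \<subseteq> {..<n}" "u < n"
  shows "card (neighbors G (xs ! u) \<inter> (!) xs ` Z) = deg u Z"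
proof -
  have "neighbors G (xs ! u) \<inter> (!) xs ` Z = (!) xs ` {k\<in>Z. adj u k}"
    by (auto simp: neighbors_def adj_def)
  moreover have "inj_on ((!) xs) {k\<in>Z. adj u k}"
    using assms xs_eq by (auto simp: inj_on_def subset_iff)
  ultimately show ?thesis by (simp add: card_image deg_def)
qed

lemma mem_nth_image: "Z \<subseteq> {..<n} \<Longrightarrow> u < n \<Longrightarrow> xs ! u \<in> (!) xs ` Z \<longleftrightarrow> u \<in> Z"
  using xs_eq by (auto simp: subset_iff)

lemma red_dominating_nth:
  assumes "Z \<subseteq> {..<n}"
  shows "red_dominating \<sigma> \<rho> G ((!) xs ` Z) \<longleftrightarrow> (\<forall>p\<in>Z. red p) \<and>
    (\<forall>u<n. blue u \<longrightarrow> (if u \<in> Z then deg u Z \<in> \<sigma> else deg u Z \<in> \<rho>))"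
proof -
  have "Blue G \<subseteq> set xs" using G set_xs by (auto simp: colored_graph_def)
  then have "Blue G = (!) xs ` {u. u < n \<and> blue u}"
    by (auto simp: blue_def n_def in_set_conv_nth image_iff subset_iff)
  then have "(\<forall>u\<in>Blue G. P u) \<longleftrightarrow> (\<forall>u<n. blue u \<longrightarrow> P (xs ! u))" for P by auto
  then show ?thesis unfolding red_dominating_def dominates_def
    using neighbors_nth[OF assms] mem_nth_image[OF assms] by (auto simp: red_def)
qed

lemma deg_minus:
  assumes "finite Z" "p \<in> Z"
  shows "deg u (Z - {p}) = deg u Z - of_bool (adj u p)"
proof -
  have "{k\<in>Z - {p}. adj u k} = {k\<in>Z. adj u k} - {p}" by blast
  then show ?thesis using assms by (simp add: deg_def card_Diff_singleton_if)
qed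

text \<open>Removing \<open>p\<close> matters in two places only: \<open>p\<close> itself passes
  from the \<sigma>-condition to the \<rho>-condition with unchanged degree, as there are no loops,
  and each neighbour of \<open>p\<close> loses one.\<close>

lemma one_minimal_nth:
  assumes Z: "Z \<subseteq> {..<n}"
  shows "one_minimal \<sigma> \<rho> G ((!) xs ` Z) \<longleftrightarrow> sol Z"
proof -
  have finZ: "finite Z" using Z finite_subset by blast
  let ?ok = "\<lambda>Z. (\<forall>p\<in>Z. red p) \<and> (\<forall>u<n. blue u \<longrightarrow> (if u \<in> Z then deg u Z \<in> \<sigma> else deg u Z \<in> \<rho>))"
  let ?w = "\<lambda>p. blue p \<and> deg p Z \<notin> \<rho> \<or> (\<exists>u<n. blue u \<and> adj p u \<and> critical \<sigma> \<rho> (u \<in> Z) (deg u Z))"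
  have minus: "(!) xs ` Z - {xs ! p} = (!) xs ` (Z - {p})" if "p \<in> Z" for p
    using Z that xs_eq by (auto simp: subset_iff)
  have w: "\<not> ?ok (Z - {p}) \<longleftrightarrow> ?w p" if ok: "?ok Z" and p: "p \<in> Z" for p
  proof -
    have pn: "p < n" using p Z by blast
    have "\<not> ?ok (Z - {p}) \<longleftrightarrow> (\<exists>u<n. blue u \<and> \<not> (if u \<in> Z - {p} then deg u (Z - {p}) \<in> \<sigma> else deg u (Z - {p}) \<in> \<rho>))"
      using ok by blast
    also have "\<dots> \<longleftrightarrow> (\<exists>u<n. blue u \<and> (u = p \<and> deg p Z \<notin> \<rho> \<or> adj p u \<and> critical \<sigma> \<rho> (u \<in> Z) (deg u Z)))"
    proof (intro ex_cong1 conj_cong refl)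
      fix u assume u: "u < n" "blue u"
      show "\<not> (if u \<in> Z - {p} then deg u (Z - {p}) \<in> \<sigma> else deg u (Z - {p}) \<in> \<rho>) \<longleftrightarrow>
         (u = p \<and> deg p Z \<notin> \<rho> \<or> adj p u \<and> critical \<sigma> \<rho> (u \<in> Z) (deg u Z))"
      proof (cases "u = p")
        case True
        then show ?thesis using deg_minus[OF finZ p, of u] adj_irrefl[of p] by simp
      next
        case False
        then show ?thesis using deg_minus[OF finZ p, of u] adj_sym[of p u] ok u p
          by (auto simp: critical_def)
      qed
    qed
    also have "\<dots> \<longleftrightarrow> ?w p" using pn by blast
    finally show ?thesis .
  qed
  have "one_minimal \<sigma> \<rho> G ((!) xs ` Z) \<longleftrightarrow> ?ok Z \<and> (\<forall>p\<in>Z. \<not> red_dominating \<sigma> \<rho> G ((!) xs ` Z - {xs ! p}))"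
    unfolding one_minimal_def red_dominating_nth[OF Z] by blast
  also have "\<dots> \<longleftrightarrow> ?ok Z \<and> (\<forall>p\<in>Z. \<not> ?ok (Z - {p}))"
  proof -
    have "red_dominating \<sigma> \<rho> G ((!) xs ` Z - {xs ! p}) \<longleftrightarrow> ?ok (Z - {p})" if "p \<in> Z" for p
      unfolding minus[OF that] using Z by (intro red_dominating_nth) blast
    then show ?thesis by blast
  qed
  also have "\<dots> \<longleftrightarrow> ?ok Z \<and> (\<forall>p\<in>Z. ?w p)" using w by blast
  also have "\<dots> \<longleftrightarrow> sol Z" unfolding sol_def using Z by auto
  finally show ?thesis .
qed

lemma solutions: "bij_betw (\<lambda>st. (!) xs ` chosen st) paths {D. one_minimal \<sigma> \<rho> G D}"
proof -
  have "bij_betw (\<lambda>Z. (!) xs ` Z) {Z. sol Z} {D. one_minimal \<sigma> \<rho> G D}"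
    unfolding bij_betw_def
  proof
    have sub: "Z \<subseteq> {..<n}" if "sol Z" for Z using that by (auto simp: sol_def)
    show "inj_on (\<lambda>Z. (!) xs ` Z) {Z. sol Z}"
    proof (rule inj_onI)
      fix Z Z' assume "Z \<in> {Z. sol Z}" "Z' \<in> {Z. sol Z}" and e: "(!) xs ` Z = (!) xs ` Z'"
      then have s: "Z \<subseteq> {..<n}" "Z' \<subseteq> {..<n}" using sub by auto
      have "u \<in> Z \<longleftrightarrow> u \<in> Z'" if "u < n" for u
        using mem_nth_image[OF s(1) that] mem_nth_image[OF s(2) that] e by simp
      then show "Z = Z'" using s by blast
    qed
    show "(\<lambda>Z. (!) xs ` Z) ` {Z. sol Z} = {D. one_minimal \<sigma> \<rho> G D}"
    proof
      show "(\<lambda>Z. (!) xs ` Z) ` {Z. sol Z} \<subseteq> {D. one_minimal \<sigma> \<rho> G D}"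
        using one_minimal_nth sub by blast
      show "{D. one_minimal \<sigma> \<rho> G D} \<subseteq> (\<lambda>Z. (!) xs ` Z) ` {Z. sol Z}"
      proof
        fix D assume "D \<in> {D. one_minimal \<sigma> \<rho> G D}"
        then have D: "one_minimal \<sigma> \<rho> G D" by simp
        then have "D \<subseteq> Red G" unfolding one_minimal_def red_dominating_def by blast
        then have "D \<subseteq> set xs" using set_xs G unfolding colored_graph_def by blast
        then have e: "D = (!) xs ` {k. k < n \<and> xs ! k \<in> D}"
          by (auto simp: n_def in_set_conv_nth image_iff subset_iff)
        have "sol {k. k < n \<and> xs ! k \<in> D}"
          using one_minimal_nth[of "{k. k < n \<and> xs ! k \<in> D}"] D e by auto
        then show "D \<in> (\<lambda>Z. (!) xs ` Z) ` {Z. sol Z}" using e by blast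
      qed
    qed
  qed
  from bij_betw_trans[OF chosen_bij this] show ?thesis by (simp add: comp_def)
qed

end

section \<open>The program\<close>

fun sumE :: "(nat \<Rightarrow> aexp) \<Rightarrow> nat \<Rightarrow> aexp" where
  "sumE f 0 = Const 0"
| "sumE f (Suc t) = Plus (sumE f t) (f t)"

lemma aval_sumE [simp]: "aval inp s (sumE f t) = (\<Sum>k<t. aval inp s (f k))"
  by (induction t) auto

fun powE :: "aexp \<Rightarrow> nat \<Rightarrow> aexp" where
  "powE e 0 = Const 1"
| "powE e (Suc t) = Times e (powE e t)"

lemma aval_powE [simp]: "aval inp s (powE e t) = aval inp s e ^ t"
  by (induction t) auto

abbreviation iteE :: "aexp \<Rightarrow> aexp \<Rightarrow> aexp \<Rightarrow> aexp" where
  "iteE b x y \<equiv> Plus (Times b x) (Times (notE b) y)"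

abbreviation orE :: "aexp \<Rightarrow> aexp \<Rightarrow> aexp" where
  "orE a b \<equiv> notE (Times (notE a) (notE b))"

abbreviation impE :: "aexp \<Rightarrow> aexp \<Rightarrow> aexp" where
  "impE a b \<equiv> notE (Times a (notE b))"

abbreviation modE :: "aexp \<Rightarrow> aexp \<Rightarrow> aexp" where
  "modE a b \<equiv> Minus a (Times b (Div a b))"

abbreviation reg :: "nat \<Rightarrow> aexp" where "reg x \<equiv> Cell x (Const 0)"
abbreviation SucE :: "aexp \<Rightarrow> aexp" where "SucE e \<equiv> Plus e (Const 1)"

definition nE :: aexp where "nE = Input (Const 0)"
definition mE :: aexp where "mE = Input (Const 1)"
definition xE :: "aexp \<Rightarrow> aexp" where "xE p = Input (Plus (Plus (Const 2) (Plus nE nE)) p)"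
definition redE :: "aexp \<Rightarrow> aexp" where "redE p = Input (Plus (Const 2) (xE p))"
definition blueE :: "aexp \<Rightarrow> aexp" where "blueE p = Input (Plus (Plus (Const 2) nE) (xE p))"
definition endE :: "nat \<Rightarrow> aexp \<Rightarrow> aexp" where
  "endE b j = Input (Plus (Plus (Const 2) (Plus (Plus nE nE) nE)) (Plus (Plus j j) (Const b)))"

text \<open>
  Array 0 holds the adjacency of vertices and digits, array 1 the table of next successors, and
  array 10 the current path; registers 11 and 12 say where the next path leaves the current one and
  with which state. The other arrays are loop counters and flags.
\<close>

definition adjdE :: "aexp \<Rightarrow> aexp \<Rightarrow> aexp" where "adjdE v w = Cell 0 (Plus (Times v (SucE nE)) w)"

definition adjC :: com where
  "adjC = For 2 mE (Seq
     (Assign 0 (Plus (Times (endE 0 (reg 2)) (SucE nE)) (SucE (endE (Suc 0) (reg 2)))) (Const 1))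
     (Assign 0 (Plus (Times (endE (Suc 0) (reg 2)) (SucE nE)) (SucE (endE 0 (reg 2)))) (Const 1)))"

text \<open>Only these fixed parameters enter the program, and it is built outside
  \<open>inst\<close> because one program has to serve all instances.\<close>

locale machine =
  fixes \<sigma> \<rho> :: "nat set" and dd r :: nat
begin

definition ME :: aexp where "ME = Times (Const 2) (powE (SucE nE) (4 * r))"
definition capE :: "aexp \<Rightarrow> aexp" where "capE e = Minus e (Minus e (Const dd))"
definition digE :: "nat \<Rightarrow> aexp \<Rightarrow> aexp" where
  "digE t q = modE (Div q (powE (SucE nE) t)) (SucE nE)"
definition bitE :: "aexp \<Rightarrow> aexp" where
  "bitE q = notE (notE (Div q (powE (SucE nE) (4 * r))))"
definition cntE :: "nat \<Rightarrow> aexp \<Rightarrow> aexp \<Rightarrow> aexp" where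
  "cntE g q p = capE (sumE (\<lambda>t. adjdE (xE p) (digE (g * r + t) q)) r)"
definition VDE :: "aexp \<Rightarrow> aexp \<Rightarrow> aexp \<Rightarrow> aexp" where
  "VDE j q p = Times (blueE p) (iteE (leE j p) (cntE 0 q p) (cntE 1 q p))"
definition VWE :: "aexp \<Rightarrow> aexp \<Rightarrow> aexp \<Rightarrow> aexp" where
  "VWE j q p = Times (redE p) (iteE (leE j p) (cntE 2 q p) (cntE 3 q p))"
text \<open>Membership in a fixed set becomes an expression of constant size, since only capped
  values are tested; \<open>k \<in> S\<close> is decided while the expression is built.\<close>

definition memE :: "nat set \<Rightarrow> aexp \<Rightarrow> aexp" where
  "memE S e = sumE (\<lambda>k. if k \<in> S then eqE e (Const k) else Const 0) (Suc dd)"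
definition countE :: "aexp \<Rightarrow> aexp \<Rightarrow> aexp \<Rightarrow> aexp" where
  "countE i q q' = capE (Plus (VDE i q i) (VDE (SucE i) q' i))"
definition critE :: "aexp \<Rightarrow> aexp \<Rightarrow> aexp \<Rightarrow> aexp" where
  "critE i q q' = (let t = Minus (countE i q q') (Const 1) in
     Times (blueE i) (notE (iteE (bitE q') (memE \<sigma> t) (memE \<rho> t))))"
definition stepE :: "aexp \<Rightarrow> aexp \<Rightarrow> aexp \<Rightarrow> aexp \<Rightarrow> aexp \<Rightarrow> aexp \<Rightarrow> aexp" where
  "stepE b col v v' i p = eqE v' (capE (Plus v (Times b (Times col (adjdE (xE p) (SucE (xE i)))))))"
definition localE :: "aexp \<Rightarrow> aexp \<Rightarrow> aexp \<Rightarrow> aexp \<Rightarrow> aexp" where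
  "localE i q q' p = (let t = countE i q q'; b = bitE q'; w = critE i q q' in
     Times (impE b (redE i)) (Times (impE (blueE i) (iteE b (memE \<sigma> t) (memE \<rho> t)))
     (Times (impE b (orE (Times (blueE i) (notE (memE \<rho> t))) (notE (notE (Plus (VWE i q i) (VWE (SucE i) q' i))))))
     (Times (impE (ltE i p) (Times (stepE b (blueE p) (VDE i q p) (VDE (SucE i) q' p) i p)
        (stepE w (redE p) (VWE i q p) (VWE (SucE i) q' p) i p)))
     (Times (impE (ltE p i) (Times (stepE b (blueE p) (VDE (SucE i) q' p) (VDE i q p) i p)
        (stepE w (redE p) (VWE (SucE i) q' p) (VWE i q p) i p)))
     (impE (eqE (SucE i) nE) (Times (notE (VDE nE q' p)) (notE (VWE nE q' p)))))))))"
definition equivE :: "aexp \<Rightarrow> aexp \<Rightarrow> aexp \<Rightarrow> aexp \<Rightarrow> aexp" where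
  "equivE j q q' p = Times (eqE (VDE j q p) (VDE j q' p)) (eqE (VWE j q p) (VWE j q' p))"
definition addrE :: "aexp \<Rightarrow> aexp \<Rightarrow> aexp \<Rightarrow> aexp" where
  "addrE i q q' = Plus (Times (Plus (Times i (SucE ME)) q) (SucE ME)) q'"

text \<open>\<open>For\<close> counts up, whereas layers and candidates are processed downwards;
  hence the reversed counters.\<close>

definition iE :: aexp where "iE = Minus (Minus nE (Const 1)) (reg 3)"
definition kE :: aexp where "kE = Minus (Minus ME (Const 1)) (reg 5)"

definition equivC :: com where
  "equivC = Seq (Assign 9 (Const 0) (eqE (bitE (reg 6)) (bitE kE)))
     (For 7 nE (Assign 9 (Const 0) (Times (reg 9) (equivE (SucE iE) (reg 6) kE (reg 7)))))"
definition leastC :: com where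
  "leastC = For 6 ME (Seq equivC
     (Assign 8 (Const 0) (Times (reg 8) (notE (Times (reg 9) (ltE (reg 6) kE))))))"
definition localC :: com where
  "localC = For 7 nE (Assign 8 (Const 0) (Times (reg 8) (localE iE (reg 4) kE (reg 7))))"
text \<open>Register 8 collects the three parts of \<open>Eg\<close>: goodness, read from the next
  layer, leastness of the code, and the local conditions. The last assignment is
  \<open>nx_rec\<close>.\<close>

definition entryC :: com where
  "entryC = Seq (Assign 8 (Const 0) (ltE (Cell 1 (addrE (SucE iE) kE (Const 0))) ME))
     (Seq leastC (Seq localC
     (Assign 1 (addrE iE (reg 4) kE) (iteE (reg 8) kE (Cell 1 (addrE iE (reg 4) (SucE kE)))))))"
definition rowC :: com where
  "rowC = Seq (Assign 1 (addrE iE (reg 4) ME) ME) (For 5 ME entryC)"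
definition tableC :: com where "tableC = For 3 nE (For 4 ME rowC)"

definition skipC :: com where "skipC = Assign 13 (Const 0) (reg 13)"
text \<open>The last round looks up layer \<open>n\<close>, whose cells are never written; they hold
  0, the value of \<open>nx\<close> there.\<close>

definition fillC :: com where
  "fillC = For 13 nE (If (leE (reg 11) (reg 13))
     (Seq (Assign 10 (SucE (reg 13)) (reg 12))
       (Assign 12 (Const 0) (Cell 1 (addrE (SucE (reg 13)) (reg 12) (Const 0))))) skipC)"
definition emitC :: com where
  "emitC = For 13 nE (If (bitE (Cell 10 (SucE (reg 13)))) (Emit (xE (reg 13))) skipC)"
text \<open>Register 12 is both result and flag: as long as it holds \<open>M\<close>, no larger
  successor has been found.\<close>

definition backC :: com where
  "backC = Seq (Assign 12 (Const 0) ME) (For 13 nE (If (leE ME (reg 12))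
     (Seq (Assign 11 (Const 0) (Minus (Minus nE (Const 1)) (reg 13)))
       (Assign 12 (Const 0) (Cell 1 (addrE (reg 11) (Cell 10 (reg 11)) (SucE (Cell 10 (SucE (reg 11)))))))) skipC))"
definition mainC :: com where
  "mainC = Seq (Seq adjC (Seq tableC (Assign 12 (Const 0) (Cell 1 (addrE (Const 0) (Const 0) (Const 0))))))
     (While (ltE (reg 12) ME) (Seq fillC (Seq emitC (Seq Finish backC))))"

end

section \<open>Values of the expressions\<close>

lemma nth_concat_pairs:
  "j < length es \<Longrightarrow> concat (map (\<lambda>(u, v). [u, v]) es) ! (2 * j) = fst (es ! j) \<and>
     concat (map (\<lambda>(u, v). [u, v]) es) ! (2 * j + 1) = snd (es ! j)"
  by (induction es arbitrary: j) (auto simp: nth_Cons split: nat.split)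

lemma length_concat_pairs: "length (concat (map (\<lambda>(u, v). [u, v]) es)) = 2 * length es"
  by (induction es) auto

context inst
begin

sublocale machine \<sigma> \<rho> dd r .

definition "inp = encode G xs es"
definition "m = length es"

lemma m_card: "card (edges G) = m"
  using es distinct_card[of "map (\<lambda>(u, v). {u, v}) es"] by (simp add: edge_listing_def m_def)

lemma inp_eq: "inp = [n, m] @ map (\<lambda>v. of_bool (v \<in> Red G)) [0..<n] @ map (\<lambda>v. of_bool (v \<in> Blue G)) [0..<n]
    @ xs @ concat (map (\<lambda>(u, v). [u, v]) es)"
  by (simp add: inp_def encode_def n_card m_card)

lemma length_inp: "length inp = 2 + n + n + n + 2 * m"
  by (simp add: inp_eq length_concat_pairs n_def m_def)

lemma aval_nE [simp]: "aval inp s nE = n" and aval_mE [simp]: "aval inp s mE = m"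
  by (auto simp: nE_def mE_def length_inp) (auto simp: inp_eq)

lemma aval_xE [simp]: "aval inp s p < n \<Longrightarrow> aval inp s (xE p) = xs ! aval inp s p"
  by (simp add: xE_def length_inp) (simp add: inp_eq nth_append n_def)

lemma aval_redE [simp]: "aval inp s p < n \<Longrightarrow> aval inp s (redE p) = of_bool (red (aval inp s p))"
  using xs_less[of "aval inp s p"] by (simp add: redE_def length_inp) (simp add: inp_eq nth_append red_def)

lemma aval_blueE [simp]: "aval inp s p < n \<Longrightarrow> aval inp s (blueE p) = of_bool (blue (aval inp s p))"
  using xs_less[of "aval inp s p"] by (simp add: blueE_def length_inp) (simp add: inp_eq nth_append blue_def)

lemma aval_endE [simp]:
  assumes "aval inp s j < m"
  shows "aval inp s (endE 0 j) = fst (es ! aval inp s j)" "aval inp s (endE (Suc 0) j) = snd (es ! aval inp s j)"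
proof -
  have *: "inp ! (2 + (n + n + n) + k) = concat (map (\<lambda>(u, v). [u, v]) es) ! k" for k
    by (simp add: inp_eq nth_append n_def)
  have "aval inp s (endE 0 j) = inp ! (2 + (n + n + n) + 2 * aval inp s j)"
    "aval inp s (endE (Suc 0) j) = inp ! (2 + (n + n + n) + (2 * aval inp s j + 1))"
    using assms by (auto simp: endE_def length_inp mult_2)
  then show "aval inp s (endE 0 j) = fst (es ! aval inp s j)" "aval inp s (endE (Suc 0) j) = snd (es ! aval inp s j)"
    using nth_concat_pairs[of "aval inp s j" es] assms unfolding * by (auto simp: m_def)
qed

lemma aval_ME [simp]: "aval inp s ME = M"
  by (simp add: ME_def M_def B_def)

lemma aval_capE [simp]: "aval inp s (capE e) = min dd (aval inp s e)"
  by (auto simp: capE_def)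

lemma aval_digE [simp]: "aval inp s (digE t q) = dig t (aval inp s q)"
  by (simp add: digE_def dig_def B_def minus_mult_div_eq_mod del: mult_Suc)

lemma aval_bitE [simp]: "aval inp s (bitE q) = of_bool (bitp (aval inp s q))"
  by (simp add: bitE_def bitp_def B_def)

lemma aval_memE [simp]:
  assumes "aval inp s e \<le> dd" shows "aval inp s (memE S e) = of_bool (aval inp s e \<in> S)"
proof -
  have "aval inp s (memE S e) = (\<Sum>k<Suc dd. if k = aval inp s e then of_bool (k \<in> S) else 0)"
    unfolding memE_def aval_sumE by (intro sum.cong) auto
  also have "\<dots> = of_bool (aval inp s e \<in> S)" using assms by (subst sum.delta) auto
  finally show ?thesis .
qed

definition adj_table :: "(nat \<Rightarrow> nat) \<Rightarrow> bool" where
  "adj_table f \<longleftrightarrow> (\<forall>v<n. \<forall>w<B. f (v * B + w) = of_bool (adjd v w))"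

lemma dig_less: "dig t q < B"
  by (simp add: dig_def B_def)

lemma adjd_Suc: "adjd (xs ! p) (Suc (xs ! k)) = adj p k"
  by (simp add: adjd_def adj_def)

context
  fixes s :: store
  assumes A: "adj_table (s 0)"
begin

lemma aval_adjdE:
  "aval inp s v < n \<Longrightarrow> aval inp s w < B \<Longrightarrow> aval inp s (adjdE v w) = of_bool (adjd (aval inp s v) (aval inp s w))"
  using A by (simp add: adjdE_def adj_table_def B_def del: mult_Suc_right)

lemma aval_cntE [simp]:
  assumes "aval inp s p < n" shows "aval inp s (cntE g q p) = cnt g (aval inp s q) (aval inp s p)"
proof -
  have "aval inp s (adjdE (xE p) (digE t q)) = of_bool (adjd (xs ! aval inp s p) (dig t (aval inp s q)))" for t
    using assms xs_less[OF assms] dig_less by (simp add: aval_adjdE)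
  then show ?thesis by (simp add: cntE_def cnt_def)
qed

lemma aval_VDE [simp]:
  "aval inp s p < n \<Longrightarrow> aval inp s (VDE j q p) = VD (aval inp s j) (aval inp s q) (aval inp s p)"
  by (simp add: VDE_def VD_def)

lemma aval_VWE [simp]:
  "aval inp s p < n \<Longrightarrow> aval inp s (VWE j q p) = VW (aval inp s j) (aval inp s q) (aval inp s p)"
  by (simp add: VWE_def VW_def)

lemma aval_countE [simp]:
  "aval inp s i < n \<Longrightarrow> aval inp s (countE i q q') = count (aval inp s i) (aval inp s q) (aval inp s q')"
  by (simp add: countE_def count_def)

lemma aval_critE [simp]:
  assumes "aval inp s i < n"
  shows "aval inp s (critE i q q') = of_bool (crit (aval inp s i) (aval inp s q) (aval inp s q'))"
proof -
  have "count (aval inp s i) (aval inp s q) (aval inp s q') - 1 \<le> dd" by (simp add: count_def)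
  then show ?thesis using assms by (auto simp: critE_def Let_def crit_def critical_def)
qed

lemma aval_stepE:
  assumes "aval inp s i < n" "aval inp s p < n" "aval inp s b = of_bool b'" "aval inp s col = of_bool col'"
  shows "aval inp s (stepE b col v v' i p) = of_bool (aval inp s v' =
    min dd (aval inp s v + of_bool (b' \<and> col' \<and> adj (aval inp s p) (aval inp s i))))"
proof -
  have "aval inp s (adjdE (xE p) (SucE (xE i))) = of_bool (adj (aval inp s p) (aval inp s i))"
    using assms(1,2) xs_less by (simp add: aval_adjdE adjd_Suc B_def)
  then show ?thesis using assms(3,4) unfolding stepE_def by (simp add: of_bool_conj)
qed

lemma aval_localE:
  assumes "aval inp s i < n" "aval inp s p < n"
  shows "aval inp s (localE i q q' p) =
    of_bool (local_ok (aval inp s i) (aval inp s q) (aval inp s q') (aval inp s p))"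
proof -
  have "count (aval inp s i) (aval inp s q) (aval inp s q') \<le> dd" by (simp add: count_def)
  then show ?thesis using assms
    unfolding localE_def Let_def local_ok_def by (simp add: aval_stepE of_bool_conj[symmetric] del: of_bool_conj) 
qed

lemma aval_equivE:
  assumes "aval inp s p < n"
  shows "aval inp s (equivE j q q' p) = of_bool
    (VD (aval inp s j) (aval inp s q) (aval inp s p) = VD (aval inp s j) (aval inp s q') (aval inp s p) \<and>
     VW (aval inp s j) (aval inp s q) (aval inp s p) = VW (aval inp s j) (aval inp s q') (aval inp s p))"
  using assms by (simp add: equivE_def of_bool_conj)

end

text \<open>The radix is \<open>M + 1\<close> because the lower bound in \<open>nx\<close> goes up
  to \<open>M\<close> inclusive.\<close>

definition "addr i q q' = (i * (M + 1) + q) * (M + 1) + q'"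

lemma aval_addrE [simp]: "aval inp s (addrE i q q') = addr (aval inp s i) (aval inp s q) (aval inp s q')"
  by (simp add: addrE_def addr_def)

lemma addr_inj [simp]:
  assumes "q \<le> M" "q' \<le> M" "u \<le> M" "u' \<le> M"
  shows "addr i q q' = addr j u u' \<longleftrightarrow> i = j \<and> q = u \<and> q' = u'"
proof -
  have d: "x = y \<and> a = b" if "x * (M + 1) + a = y * (M + 1) + b" "a \<le> M" "b \<le> M" for x y a b
  proof -
    have dm: "(x * k + a) div k = x \<and> (x * k + a) mod k = a" if "a < k" for x a k :: nat
      using that by simp
    show ?thesis using dm[of a "M + 1" x] dm[of b "M + 1" y] that by (metis Suc_eq_plus1 less_Suc_eq_le)
  qed
  show ?thesis unfolding addr_def using d[of _ q' _ u'] d[of i q j u] assms by blast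
qed

text \<open>The summands cover the addresses of the successor table, those of the adjacency array,
  and the edge counter.\<close>

definition "Bd = (n + 1) * (M + 1) * (M + 1) + (n + 1) * (n + 1) + m"

lemma addr_Bd: "i \<le> n \<Longrightarrow> q \<le> M \<Longrightarrow> q' \<le> M \<Longrightarrow> addr i q q' \<le> Bd"
proof -
  assume *: "i \<le> n" "q \<le> M" "q' \<le> M"
  have "i * (M + 1) + q \<le> n * (M + 1) + M" using * by (intro add_mono mult_le_mono) auto
  then have "(i * (M + 1) + q) * (M + 1) + q' \<le> (n * (M + 1) + M) * (M + 1) + M"
    using * by (intro add_mono mult_le_mono) auto
  also have "\<dots> \<le> (n + 1) * (M + 1) * (M + 1)" by (simp add: algebra_simps)
  finally show ?thesis by (simp add: addr_def Bd_def)
qed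

lemma Bd_simps: "n \<le> Bd" "M \<le> Bd" "m \<le> Bd" "1 \<le> Bd" "0 < Bd"
  by (auto simp: Bd_def algebra_simps)

end

section \<open>Building the tables\<close>

text \<open>Turns the initial store into a fixed parameter, so that facts about it remain available
  while the command is verified.\<close>

lemma tr_fix:
  assumes "\<And>s0. P s0 w0 \<Longrightarrow> tr inp B (\<lambda>s w. s = s0 \<and> w = w0) c T Q" "\<And>s w. P s w \<Longrightarrow> w = w0"
  shows "tr inp B P c T Q"
  unfolding tr_def
proof (intro allI impI)
  fix s w assume P: "P s w" "bnd B s"
  then have "w = w0" using assms(2) by blast
  then show "\<exists>s' w'. Q s' w' \<and> (\<forall>cs os. reach inp B T (Config (c # cs) s w os) (Config cs s' w' os))"
    using assms(1)[of s] P unfolding tr_def by blast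
qed

definition same :: "nat set \<Rightarrow> store \<Rightarrow> store \<Rightarrow> bool" where
  "same X s s0 \<longleftrightarrow> (\<forall>x. x \<notin> X \<longrightarrow> s x = s0 x)"

lemma same_refl [simp]: "same X s s"
  by (simp add: same_def)

lemma same_upd [simp]: "x \<in> X \<Longrightarrow> same X (s(x := f)) s0 = same X s s0"
  "x \<in> X \<Longrightarrow> same X (cell x v s) s0 = same X s s0"
  by (auto simp: same_def cell_def)

lemma sameD: "same X s s0 \<Longrightarrow> x \<notin> X \<Longrightarrow> s x = s0 x"
  by (simp add: same_def)

context inst
begin

section \<open>The adjacency array\<close>

lemma es_edge: "j < m \<Longrightarrow> {fst (es ! j), snd (es ! j)} \<in> edges G"
proof -
  assume "j < m"
  then have "(\<lambda>(u, v). {u, v}) (es ! j) \<in> set (map (\<lambda>(u, v). {u, v}) es)" by (simp add: m_def)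
  then show ?thesis using es by (simp add: edge_listing_def case_prod_unfold)
qed

lemma edge_es: "e \<in> edges G \<longleftrightarrow> (\<exists>j<m. e = {fst (es ! j), snd (es ! j)})"
proof
  assume "e \<in> edges G"
  then have "e \<in> set (map (\<lambda>(u, v). {u, v}) es)" using es by (simp add: edge_listing_def)
  then obtain j where "j < m" "e = (\<lambda>(u, v). {u, v}) (es ! j)"
    unfolding in_set_conv_nth m_def by auto
  then show "\<exists>j<m. e = {fst (es ! j), snd (es ! j)}" unfolding case_prod_unfold by blast
qed (use es_edge in auto)

lemma adj_addr_inj:
  assumes "w < B" "w' < B" shows "v * B + w = v' * B + w' \<longleftrightarrow> v = v' \<and> w = w'"
proof
  have *: "(v * B + w) div B = v \<and> (v * B + w) mod B = w" if "w < B" for v w using that by simp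
  assume "v * B + w = v' * B + w'"
  then show "v = v' \<and> w = w'" using *[OF assms(1)] *[OF assms(2)] by metis
qed simp

lemma adj_addr_Bd: "v < n \<Longrightarrow> w < B \<Longrightarrow> v * B + w \<le> Bd"
proof -
  assume "v < n" "w < B"
  then have "v * B + w \<le> n * (n + 1) + (n + 1)" unfolding B_def by (intro add_mono mult_le_mono) auto
  then show ?thesis by (simp add: Bd_def algebra_simps)
qed

text \<open>Each edge takes two assignments; \<open>X\<close> holds what the current round has
  already written.\<close>

definition listed :: "nat \<Rightarrow> (nat \<Rightarrow> nat) \<Rightarrow> (nat \<times> nat) set \<Rightarrow> bool" where
  "listed k f X \<longleftrightarrow> (\<forall>v<n. \<forall>w<B. f (v * B + w) =
     of_bool (w > 0 \<and> ((\<exists>j<k. {v, w - 1} = {fst (es ! j), snd (es ! j)}) \<or> (v, w) \<in> X)))"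

lemma listed_insert:
  assumes "listed k f X" "a < n" "b < n"
  shows "listed k (f(a * B + Suc b := 1)) (insert (a, Suc b) X)"
  unfolding listed_def
proof (intro allI impI)
  fix v w assume vw: "v < n" "w < B"
  have "Suc b < B" using assms(3) by (simp add: B_def)
  from adj_addr_inj[OF vw(2) this]
  show "(f(a * B + Suc b := 1)) (v * B + w) =
     of_bool (w > 0 \<and> ((\<exists>j<k. {v, w - 1} = {fst (es ! j), snd (es ! j)}) \<or> (v, w) \<in> insert (a, Suc b) X))"
    using assms(1) vw unfolding listed_def fun_upd_def by auto
qed

lemma listed_Suc:
  assumes "listed k f {(u, Suc v), (v, Suc u)}" "u = fst (es ! k)" "v = snd (es ! k)"
  shows "listed (Suc k) f {}"
proof -
  have "w > 0 \<and> ((\<exists>j<k. {x, w - 1} = {fst (es ! j), snd (es ! j)}) \<or> (x, w) \<in> {(u, Suc v), (v, Suc u)}) \<longleftrightarrow>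
     w > 0 \<and> ((\<exists>j<Suc k. {x, w - 1} = {fst (es ! j), snd (es ! j)}) \<or> (x, w) \<in> {})" for x w
  proof (cases w)
    case (Suc y)
    have "(x, w) \<in> {(u, Suc v), (v, Suc u)} \<longleftrightarrow> {x, w - 1} = {fst (es ! k), snd (es ! k)}"
      using Suc assms(2,3) by (auto simp: doubleton_eq_iff)
    then show ?thesis unfolding less_Suc_eq by blast
  qed simp
  then show ?thesis using assms(1) unfolding listed_def by (simp only:)
qed

lemma adjC_tr:
  "tr inp Bd (\<lambda>s w. s = (\<lambda>x a. 0) \<and> w = []) adjC (m * ((1 + 1 + 1) + 3) + 3)
     (\<lambda>s w. adj_table (s 0) \<and> same {0, 2} s (\<lambda>x a. 0) \<and> w = [])"
proof -
  let ?I = "\<lambda>k s w. s 2 0 = k \<and> listed k (s 0) {} \<and> same {0, 2} s (\<lambda>x a. 0) \<and> w = []"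
  let ?u = "\<lambda>k. fst (es ! k)" and ?v = "\<lambda>k. snd (es ! k)"
  have "tr inp Bd (\<lambda>s w. s = (\<lambda>x a. 0) \<and> w = []) adjC (m * ((1 + 1 + 1) + 3) + 3) (?I m)"
    unfolding adjC_def
  proof (rule tr_For[where I = ?I])
    fix k assume k: "k < m"
    have uv: "?u k < n" "?v k < n" using edge_verts[OF es_edge[OF k]] by auto
    have B': "B = Suc n" by (simp add: B_def)
    have b: "?u k * B + Suc (?v k) \<le> Bd" "?v k * B + Suc (?u k) \<le> Bd"
      using adj_addr_Bd[of "?u k" "Suc (?v k)"] adj_addr_Bd[of "?v k" "Suc (?u k)"] uv by (auto simp: B')
    show "tr inp Bd (?I k) (Seq
        (Assign 0 (Plus (Times (endE 0 (reg 2)) (SucE nE)) (SucE (endE (Suc 0) (reg 2)))) (Const 1))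
        (Assign 0 (Plus (Times (endE (Suc 0) (reg 2)) (SucE nE)) (SucE (endE 0 (reg 2)))) (Const 1)))
       (1 + 1 + 1) (\<lambda>s w. s 2 0 = k \<and> ?I (Suc k) (cell 2 (Suc k) s) w)"
    proof (rule tr_Seq[where R = "\<lambda>s w. s 2 0 = k \<and> listed k (s 0) {(?u k, Suc (?v k))} \<and> same {0, 2} s (\<lambda>x a. 0) \<and> w = []"];
        rule tr_Assign)
      fix s w assume "?I k s w"
      then show "aval inp s (Plus (Times (endE 0 (reg 2)) (SucE nE)) (SucE (endE (Suc 0) (reg 2)))) \<le> Bd \<and>
         aval inp s (Const 1) \<le> Bd \<and> (\<lambda>s w. s 2 0 = k \<and> listed k (s 0) {(?u k, Suc (?v k))} \<and> same {0, 2} s (\<lambda>x a. 0) \<and> w = [])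
         (s(0 := (s 0)(aval inp s (Plus (Times (endE 0 (reg 2)) (SucE nE)) (SucE (endE (Suc 0) (reg 2)))) := aval inp s (Const 1)))) w"
        using k b uv Bd_simps listed_insert[of k "s 0" "{}" "?u k" "?v k"] by (simp add: B' del: mult_Suc_right)
    next
      fix s w assume "s 2 0 = k \<and> listed k (s 0) {(?u k, Suc (?v k))} \<and> same {0, 2} s (\<lambda>x a. 0) \<and> w = []"
      then show "aval inp s (Plus (Times (endE (Suc 0) (reg 2)) (SucE nE)) (SucE (endE 0 (reg 2)))) \<le> Bd \<and>
         aval inp s (Const 1) \<le> Bd \<and> (\<lambda>s w. s 2 0 = k \<and> ?I (Suc k) (cell 2 (Suc k) s) w)
         (s(0 := (s 0)(aval inp s (Plus (Times (endE (Suc 0) (reg 2)) (SucE nE)) (SucE (endE 0 (reg 2)))) := aval inp s (Const 1)))) w"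
        using k b uv Bd_simps listed_insert[of k "s 0" "{(?u k, Suc (?v k))}" "?v k" "?u k"]
          listed_Suc[OF _ refl refl, of k] by (simp add: B' insert_commute fun_upd_def same_def cell_def del: mult_Suc_right)
    qed
  qed (use Bd_simps in \<open>auto simp: listed_def\<close>)
  then show ?thesis
  proof (rule tr_conseq)
    fix s w assume I: "?I m s w"
    have "adj_table (s 0)"
      using I unfolding listed_def adj_table_def adjd_def edge_es by simp
    then show "adj_table (s 0) \<and> same {0, 2} s (\<lambda>x a. 0) \<and> w = []" using I by simp
  qed auto
qed

section \<open>A single entry of the successor table\<close>

definition "T_equiv = 1 + 1 + (n * (1 + 3) + 3)"
definition "T_least = M * ((1 + T_equiv + 1) + 3) + 3"
definition "T_entry = 1 + 1 + (1 + T_least + (1 + (n * (1 + 3) + 3) + 1))"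

context
  fixes s0 :: store and i0 q k :: nat
  assumes A: "adj_table (s0 0)" and i0: "s0 3 0 = i0" "i0 < n" and q: "s0 4 0 = q" "q < M"
    and k: "s0 5 0 = k" "k < M"
begin

abbreviation "lay \<equiv> n - 1 - i0"
abbreviation "cand \<equiv> M - 1 - k"
abbreviation "frame s w \<equiv> same {6, 7, 8, 9} s s0 \<and> w = ([] :: nat list)"

lemma frameD: "frame s w \<Longrightarrow> adj_table (s 0) \<and> aval inp s iE = lay \<and> aval inp s kE = cand \<and> s 4 0 = q"
  using A i0 q k sameD[of "{6, 7, 8, 9}" s s0] by (simp add: iE_def kE_def)

lemma i_less: "lay < n" "Suc lay \<le> n" using i0(2) by auto

definition dup :: "nat \<Rightarrow> bool" where
  "dup u \<longleftrightarrow> bitp u = bitp cand \<and> (\<forall>p<n. VD (Suc lay) u p = VD (Suc lay) cand p \<and> VW (Suc lay) u p = VW (Suc lay) cand p)"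

lemma equivC_tr:
  "tr inp Bd (\<lambda>s w. frame s w \<and> s 6 0 = u \<and> s 8 0 = f) equivC T_equiv
     (\<lambda>s w. frame s w \<and> s 6 0 = u \<and> s 8 0 = f \<and> s 9 0 = of_bool (dup u))"
proof -
  let ?E = "\<lambda>p. VD (Suc lay) u p = VD (Suc lay) cand p \<and> VW (Suc lay) u p = VW (Suc lay) cand p"
  let ?I = "\<lambda>j s w. frame s w \<and> s 6 0 = u \<and> s 8 0 = f \<and> s 7 0 = j \<and> s 9 0 = of_bool (bitp u = bitp cand \<and> (\<forall>p<j. ?E p))"
  have "tr inp Bd (\<lambda>s w. frame s w \<and> s 6 0 = u \<and> s 8 0 = f) equivC T_equiv (?I n)"
    unfolding equivC_def T_equiv_def
  proof (rule tr_Seq[where R = "\<lambda>s w. frame s w \<and> s 6 0 = u \<and> s 8 0 = f \<and> s 9 0 = of_bool (bitp u = bitp cand)"])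
    show "tr inp Bd (\<lambda>s w. frame s w \<and> s 6 0 = u \<and> s 8 0 = f) (Assign 9 (Const 0) (eqE (bitE (reg 6)) (bitE kE))) 1
      (\<lambda>s w. frame s w \<and> s 6 0 = u \<and> s 8 0 = f \<and> s 9 0 = of_bool (bitp u = bitp cand))"
      by (rule tr_Assign) (use frameD Bd_simps in simp)
    show "tr inp Bd (\<lambda>s w. frame s w \<and> s 6 0 = u \<and> s 8 0 = f \<and> s 9 0 = of_bool (bitp u = bitp cand))
      (For 7 nE (Assign 9 (Const 0) (Times (reg 9) (equivE (SucE iE) (reg 6) kE (reg 7))))) (n * (1 + 3) + 3) (?I n)"
    proof (rule tr_For[where I = ?I])
      fix j assume "j < n"
      show "tr inp Bd (?I j) (Assign 9 (Const 0) (Times (reg 9) (equivE (SucE iE) (reg 6) kE (reg 7)))) 1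
         (\<lambda>s w. s 7 0 = j \<and> ?I (Suc j) (cell 7 (Suc j) s) w)"
      proof (rule tr_Assign, goal_cases)
        case (1 s w)
        then have "aval inp s (Times (reg 9) (equivE (SucE iE) (reg 6) kE (reg 7))) =
            of_bool (bitp u = bitp cand \<and> (\<forall>p<Suc j. ?E p))"
          using frameD[of s w] aval_equivE[of s "reg 7" "SucE iE" "reg 6" kE] \<open>j < n\<close>
          by (auto simp: less_Suc_eq)
        then show ?case using 1 Bd_simps by simp
      qed
    qed (use Bd_simps in auto)
  qed
  then show ?thesis by (rule tr_conseq) (auto simp: dup_def)
qed

lemma leastC_tr:
  "tr inp Bd (\<lambda>s w. frame s w \<and> s 8 0 = of_bool f) leastC T_least
     (\<lambda>s w. frame s w \<and> s 8 0 = of_bool (f \<and> (\<forall>u<cand. \<not> dup u)))"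
proof -
  let ?I = "\<lambda>j s w. frame s w \<and> s 6 0 = j \<and> s 8 0 = of_bool (f \<and> (\<forall>u<j. u < cand \<longrightarrow> \<not> dup u))"
  have "tr inp Bd (\<lambda>s w. frame s w \<and> s 8 0 = of_bool f) leastC T_least (?I M)"
    unfolding leastC_def T_least_def
  proof (rule tr_For[where I = ?I])
    fix j assume "j < M"
    show "tr inp Bd (?I j) (Seq equivC (Assign 8 (Const 0) (Times (reg 8) (notE (Times (reg 9) (ltE (reg 6) kE))))))
       (1 + T_equiv + 1) (\<lambda>s w. s 6 0 = j \<and> ?I (Suc j) (cell 6 (Suc j) s) w)"
    proof (rule tr_Seq[where R = "\<lambda>s w. frame s w \<and> s 6 0 = j \<and>
          s 8 0 = of_bool (f \<and> (\<forall>u<j. u < cand \<longrightarrow> \<not> dup u)) \<and> s 9 0 = of_bool (dup j)"])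
      show "tr inp Bd (?I j) equivC T_equiv (\<lambda>s w. frame s w \<and> s 6 0 = j \<and>
          s 8 0 = of_bool (f \<and> (\<forall>u<j. u < cand \<longrightarrow> \<not> dup u)) \<and> s 9 0 = of_bool (dup j))"
        by (rule tr_conseq[OF equivC_tr[of j "of_bool (f \<and> (\<forall>u<j. u < cand \<longrightarrow> \<not> dup u))"]])
          (simp_all only: simp_thms order_refl)
      show "tr inp Bd (\<lambda>s w. frame s w \<and> s 6 0 = j \<and> s 8 0 = of_bool (f \<and> (\<forall>u<j. u < cand \<longrightarrow> \<not> dup u)) \<and> s 9 0 = of_bool (dup j))
         (Assign 8 (Const 0) (Times (reg 8) (notE (Times (reg 9) (ltE (reg 6) kE))))) 1
         (\<lambda>s w. s 6 0 = j \<and> ?I (Suc j) (cell 6 (Suc j) s) w)"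
      proof (rule tr_Assign, goal_cases)
        case (1 s w)
        then have "aval inp s (Times (reg 8) (notE (Times (reg 9) (ltE (reg 6) kE)))) =
            of_bool (f \<and> (\<forall>u<Suc j. u < cand \<longrightarrow> \<not> dup u))"
          using frameD[of s w] by (auto simp: less_Suc_eq)
        then show ?case using 1 Bd_simps by simp
      qed
    qed
  qed (use Bd_simps in auto)
  then show ?thesis
  proof (rule tr_conseq)
    fix s w assume I: "?I M s w"
    \<comment> \<open>Since \<open>cand < M\<close>, the loop over all codes meets every smaller
      one.\<close>
    have "(\<forall>u<M. u < cand \<longrightarrow> \<not> dup u) \<longleftrightarrow> (\<forall>u<cand. \<not> dup u)" by auto
    then show "frame s w \<and> s 8 0 = of_bool (f \<and> (\<forall>u<cand. \<not> dup u))" using I by simp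
  qed auto
qed

lemma localC_tr:
  "tr inp Bd (\<lambda>s w. frame s w \<and> s 8 0 = of_bool f) localC (n * (1 + 3) + 3)
     (\<lambda>s w. frame s w \<and> s 8 0 = of_bool (f \<and> (\<forall>p<n. local_ok lay q cand p)))"
proof -
  let ?I = "\<lambda>j s w. frame s w \<and> s 7 0 = j \<and> s 8 0 = of_bool (f \<and> (\<forall>p<j. local_ok lay q cand p))"
  have "tr inp Bd (\<lambda>s w. frame s w \<and> s 8 0 = of_bool f) localC (n * (1 + 3) + 3) (?I n)"
    unfolding localC_def
  proof (rule tr_For[where I = ?I])
    fix j assume "j < n"
    show "tr inp Bd (?I j) (Assign 8 (Const 0) (Times (reg 8) (localE iE (reg 4) kE (reg 7)))) 1
         (\<lambda>s w. s 7 0 = j \<and> ?I (Suc j) (cell 7 (Suc j) s) w)"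
    proof (rule tr_Assign, goal_cases)
      case (1 s w)
      then have "aval inp s (Times (reg 8) (localE iE (reg 4) kE (reg 7))) =
          of_bool (f \<and> (\<forall>p<Suc j. local_ok lay q cand p))"
        using frameD[of s w] aval_localE[of s iE "reg 7" "reg 4" kE] \<open>j < n\<close> i_less(1)
        by (auto simp: less_Suc_eq)
      then show ?case using 1 Bd_simps by simp
    qed
  qed (use Bd_simps in auto)
  then show ?thesis by (rule tr_conseq) auto
qed

lemma Eg_iff: "Eg lay q cand \<longleftrightarrow> good (Suc lay) cand \<and> (\<forall>u<cand. \<not> dup u) \<and> (\<forall>p<n. local_ok lay q cand p)"
  using k(2) unfolding Eg_def trans_def dup_def by auto

text \<open>The two entries assumed in \<open>N\<close> are those the command reads: one decides
  goodness of the candidate, the other is the tail of the current row.\<close>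

lemma entryC_tr:
  assumes N: "s0 1 (addr (Suc lay) cand 0) = nx (Suc lay) cand 0" "s0 1 (addr lay q (Suc cand)) = nx lay q (Suc cand)"
  shows "tr inp Bd (\<lambda>s w. s = s0 \<and> w = []) entryC T_entry
     (\<lambda>s w. same {1, 6, 7, 8, 9} s s0 \<and> w = [] \<and> s 1 = (s0 1)(addr lay q cand := nx lay q cand))"
  unfolding entryC_def T_entry_def
proof (rule tr_Seq[where R = "\<lambda>s w. frame s w \<and> s 8 0 = of_bool (good (Suc lay) cand)"])
  show "tr inp Bd (\<lambda>s w. s = s0 \<and> w = []) (Assign 8 (Const 0) (ltE (Cell 1 (addrE (SucE iE) kE (Const 0))) ME)) 1
     (\<lambda>s w. frame s w \<and> s 8 0 = of_bool (good (Suc lay) cand))"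
  proof (rule tr_Assign, goal_cases)
    case (1 s w)
    then show ?case using frameD[of s w] N(1) good_nx[OF i_less(2), of cand] Bd_simps by simp
  qed
  show "tr inp Bd (\<lambda>s w. frame s w \<and> s 8 0 = of_bool (good (Suc lay) cand)) (Seq leastC (Seq localC
     (Assign 1 (addrE iE (reg 4) kE) (iteE (reg 8) kE (Cell 1 (addrE iE (reg 4) (SucE kE)))))))
     (1 + T_least + (1 + (n * (1 + 3) + 3) + 1))
     (\<lambda>s w. same {1, 6, 7, 8, 9} s s0 \<and> w = [] \<and> s 1 = (s0 1)(addr lay q cand := nx lay q cand))"
  proof (rule tr_Seq[OF leastC_tr], rule tr_Seq[OF localC_tr], rule tr_Assign, goal_cases)
    case (1 s w)
    then have fr: "frame s w" and e: "s 8 0 = of_bool (Eg lay q cand)" unfolding Eg_iff by auto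
    have s1: "s 1 = s0 1" using fr by (auto simp: same_def)
    have "aval inp s (iteE (reg 8) kE (Cell 1 (addrE iE (reg 4) (SucE kE)))) = nx lay q cand"
      using frameD[OF fr] e N(2) s1 nx_rec[of lay cand q] i_less k(2) by simp
    moreover have "aval inp s (addrE iE (reg 4) kE) = addr lay q cand" using frameD[OF fr] by simp
    moreover have "addr lay q cand \<le> Bd" using i_less q(2) by (intro addr_Bd) auto
    moreover have "nx lay q cand \<le> Bd" using nx_le[of lay q cand] Bd_simps by simp
    ultimately show ?case using fr s1 by (auto simp: same_def)
  qed
qed

end

section \<open>Rows and layers of the successor table\<close>

definition "T_row = 1 + 1 + (M * (T_entry + 3) + 3)"
definition "T_table = n * ((M * (T_row + 3) + 3) + 3) + 3"

text \<open>Rows are filled from the last layer down, each from its last entry down.\<close>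

definition filled :: "nat \<Rightarrow> nat \<Rightarrow> nat \<Rightarrow> (nat \<Rightarrow> nat) \<Rightarrow> bool" where
  "filled i0 q k f \<longleftrightarrow> (\<forall>u<M. f (addr n u 0) = 0) \<and>
     (\<forall>j u u'. j < n \<longrightarrow> u < M \<longrightarrow> u' \<le> M \<longrightarrow>
        n - 1 - j < i0 \<or> n - 1 - j = i0 \<and> (u < q \<or> u = q \<and> M - u' < k) \<longrightarrow> f (addr j u u') = nx j u u')"

lemma filled_upd:
  assumes "filled i0 q k f" "i0 < n" "q < M" "k \<le> M"
  shows "filled i0 q (Suc k) (f(addr (n - 1 - i0) q (M - k) := nx (n - 1 - i0) q (M - k)))"
  unfolding filled_def
proof (intro conjI allI impI)
  fix u assume "u < M"
  moreover have "n \<noteq> n - 1 - i0" using assms(2) by simp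
  ultimately show "(f(addr (n - 1 - i0) q (M - k) := nx (n - 1 - i0) q (M - k))) (addr n u 0) = 0"
    using assms(1,3) by (simp add: filled_def del: diff_diff_left diff_Suc_eq_diff_pred)
next
  fix j u u' assume j: "j < n" "u < M" "u' \<le> M"
    and d: "n - 1 - j < i0 \<or> n - 1 - j = i0 \<and> (u < q \<or> u = q \<and> M - u' < Suc k)"
  show "(f(addr (n - 1 - i0) q (M - k) := nx (n - 1 - i0) q (M - k))) (addr j u u') = nx j u u'"
  proof (cases "j = n - 1 - i0 \<and> u = q \<and> u' = M - k")
    case False
    have "n - 1 - j < i0 \<or> n - 1 - j = i0 \<and> (u < q \<or> u = q \<and> M - u' < k)"
      using d False j assms(2,4) by auto
    then have "f (addr j u u') = nx j u u'" using assms(1) j unfolding filled_def by blast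
    moreover have "addr j u u' \<noteq> addr (n - 1 - i0) q (M - k)" using False j assms(3) addr_inj[of u u' q "M - k"] by simp
    ultimately show ?thesis by simp
  qed simp
qed

lemma filled_mono:
  assumes "filled i0 q k f"
    and "\<And>j u u'. \<lbrakk>j < n; u < M; u' \<le> M; n - 1 - j < i1 \<or> n - 1 - j = i1 \<and> (u < q1 \<or> u = q1 \<and> M - u' < k1)\<rbrakk>
      \<Longrightarrow> n - 1 - j < i0 \<or> n - 1 - j = i0 \<and> (u < q \<or> u = q \<and> M - u' < k)"
  shows "filled i1 q1 k1 f"
  using assms unfolding filled_def by blast

lemma filled_next_row: "filled i0 q (Suc M) f \<Longrightarrow> filled i0 (Suc q) 0 f"
  by (rule filled_mono) auto

lemma filled_next_layer: "filled i0 M 0 f \<Longrightarrow> filled (Suc i0) 0 0 f"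
  by (rule filled_mono) auto

text \<open>Arrays 10 and 11 are kept at zero because the first path is announced as one that leaves
  the zero path at level 0.\<close>

abbreviation "tab i0 q k (s :: store) w \<equiv> adj_table (s 0) \<and> s 10 = (\<lambda>_. 0) \<and> s 11 = (\<lambda>_. 0) \<and> filled i0 q k (s 1) \<and>
   w = ([] :: nat list)"

lemma rowC_tr:
  assumes i0: "i0 < n" and q: "q < M"
  shows "tr inp Bd (\<lambda>s w. s 3 0 = i0 \<and> s 4 0 = q \<and> tab i0 q 0 s w) rowC T_row
     (\<lambda>s w. s 3 0 = i0 \<and> s 4 0 = q \<and> tab i0 q (Suc M) s w)"
proof -
  \<comment> \<open>Entry \<open>M\<close> is written before the loop, so \<open>k\<close> rounds
    leave \<open>Suc k\<close> entries filled.\<close>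
  let ?I = "\<lambda>k s w. s 5 0 = k \<and> s 3 0 = i0 \<and> s 4 0 = q \<and> tab i0 q (Suc k) s w"
  let ?i = "n - 1 - i0"
  have "tr inp Bd (\<lambda>s w. s 3 0 = i0 \<and> s 4 0 = q \<and> tab i0 q 0 s w) rowC T_row (?I M)"
    unfolding rowC_def T_row_def
  proof (rule tr_Seq[where R = "\<lambda>s w. s 3 0 = i0 \<and> s 4 0 = q \<and> tab i0 q (Suc 0) s w"])
    show "tr inp Bd (\<lambda>s w. s 3 0 = i0 \<and> s 4 0 = q \<and> tab i0 q 0 s w) (Assign 1 (addrE iE (reg 4) ME) ME) 1
       (\<lambda>s w. s 3 0 = i0 \<and> s 4 0 = q \<and> tab i0 q (Suc 0) s w)"
    proof (rule tr_Assign, goal_cases)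
      case (1 s w)
      then show ?case using filled_upd[of i0 q 0 "s 1"] i0 q nx_M[of ?i q] Bd_simps addr_Bd[of ?i q M]
        by (simp add: iE_def)
    qed
    show "tr inp Bd (\<lambda>s w. s 3 0 = i0 \<and> s 4 0 = q \<and> tab i0 q (Suc 0) s w) (For 5 ME entryC) (M * (T_entry + 3) + 3) (?I M)"
    proof (rule tr_For[where I = ?I])
      fix k assume k: "k < M"
      show "tr inp Bd (?I k) entryC T_entry (\<lambda>s w. s 5 0 = k \<and> ?I (Suc k) (cell 5 (Suc k) s) w)"
      proof (rule tr_fix)
        fix s0 :: store assume I: "?I k s0 []"
        have f: "filled i0 q (Suc k) (s0 1)" using I by simp
        \<comment> \<open>The next layer is either layer \<open>n\<close>, still zero as
          \<open>nx_last\<close> wants it, or was completed in an earlier round.\<close>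
        have n1: "s0 1 (addr (Suc ?i) (M - 1 - k) 0) = nx (Suc ?i) (M - 1 - k) 0"
        proof (cases "Suc ?i = n")
          case True
          then show ?thesis using f k i0 unfolding filled_def by (simp add: nx_last)
        next
          case False
          then have "Suc ?i < n" "n - 1 - Suc ?i < i0" using i0 by auto
          then show ?thesis using f k unfolding filled_def by auto
        qed
        have "Suc (M - 1 - k) = M - k" using k by simp
        then have n2: "s0 1 (addr ?i q (Suc (M - 1 - k))) = nx ?i q (Suc (M - 1 - k))"
          using f i0 q k unfolding filled_def by auto
        have "tr inp Bd (\<lambda>s w. s = s0 \<and> w = []) entryC T_entry
          (\<lambda>s w. same {1, 6, 7, 8, 9} s s0 \<and> w = [] \<and> s 1 = (s0 1)(addr ?i q (M - 1 - k) := nx ?i q (M - 1 - k)))"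
          using entryC_tr[of s0 i0 q k] I i0 q k n1 n2 by simp
        then show "tr inp Bd (\<lambda>s w. s = s0 \<and> w = []) entryC T_entry (\<lambda>s w. s 5 0 = k \<and> ?I (Suc k) (cell 5 (Suc k) s) w)"
        proof (rule tr_conseq)
          fix s :: store and w :: "nat list" assume s: "same {1, 6, 7, 8, 9} s s0 \<and> w = [] \<and> s 1 = (s0 1)(addr ?i q (M - 1 - k) := nx ?i q (M - 1 - k))"
          have eq: "s x = s0 x" if "x \<notin> {1, 6, 7, 8, 9}" for x using s that unfolding same_def by blast
          have "filled i0 q (Suc (Suc k)) (s 1)" using filled_upd[OF f i0 q] k s by simp
          moreover have "w = []" using s by simp
          ultimately show "s 5 0 = k \<and> ?I (Suc k) (cell 5 (Suc k) s) w" using I eq by simp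
        qed auto
      qed auto
    qed (use Bd_simps in auto)
  qed
  then show ?thesis by (rule tr_conseq) auto
qed

lemma tableC_tr:
  "tr inp Bd (tab 0 0 0) tableC T_table (tab n 0 0)"
proof -
  let ?I = "\<lambda>i0 s w. s 3 0 = i0 \<and> tab i0 0 0 s w"
  have "tr inp Bd (tab 0 0 0) tableC T_table (?I n)"
    unfolding tableC_def T_table_def
  proof (rule tr_For[where I = ?I])
    fix i0 assume i0: "i0 < n"
    let ?J = "\<lambda>q s w. s 4 0 = q \<and> s 3 0 = i0 \<and> tab i0 q 0 s w"
    have "tr inp Bd (?I i0) (For 4 ME rowC) (M * (T_row + 3) + 3) (?J M)"
    proof (rule tr_For[where I = ?J])
      fix q assume q: "q < M"
      show "tr inp Bd (?J q) rowC T_row (\<lambda>s w. s 4 0 = q \<and> ?J (Suc q) (cell 4 (Suc q) s) w)"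
        by (rule tr_conseq[OF rowC_tr[OF i0 q]]) (auto simp: filled_next_row)
    qed (use Bd_simps in auto)
    then show "tr inp Bd (?I i0) (For 4 ME rowC) (M * (T_row + 3) + 3)
       (\<lambda>s w. s 3 0 = i0 \<and> ?I (Suc i0) (cell 3 (Suc i0) s) w)"
      by (rule tr_conseq) (auto simp: filled_next_layer)
  qed (use Bd_simps in auto)
  then show ?thesis by (rule tr_conseq) auto
qed

end

section \<open>Enumeration of the paths\<close>

lemma trE:
  assumes "tr inp B P c T Q" "P s w" "bnd B s"
  shows "\<exists>s' w'. Q s' w' \<and> bnd B s' \<and>
     (\<forall>cs os. reach inp B T (Config (c # cs) s w os) (Config cs s' w' os))"
  using trD[OF assms] by metis

context inst
begin

lemma filledD:
  "\<lbrakk>filled n 0 0 f; j \<le> n; u < M; u' \<le> M; j = n \<longrightarrow> u' = 0\<rbrakk> \<Longrightarrow> f (addr j u u') = nx j u u'"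
  unfolding filled_def by (cases "j = n") (auto simp: nx_last)

lemma filled_0: "filled 0 0 0 (\<lambda>_. 0)"
  by (simp add: filled_def)

lemma tr_skipC: "(\<And>s w. P s w \<Longrightarrow> s 13 0 \<le> Bd) \<Longrightarrow> tr inp Bd P skipC 1 P"
  unfolding skipC_def by (rule tr_Assign) simp

context
  fixes pth :: "nat \<Rightarrow> nat"
  assumes pth: "pth \<in> paths"
begin

lemma pth_less: "i \<le> n \<Longrightarrow> pth i < M"
  using pth M by (cases i) (auto simp: paths_def)

lemma pth_beyond: "n < i \<Longrightarrow> pth i = 0"
  using pth by (auto simp: paths_def)

lemma fillC_tr:
  assumes f: "fillp st lev cd = pth" and lev: "lev < n" "cd < M" and st: "\<And>i. n < i \<Longrightarrow> st i = 0"
  shows "tr inp Bd (\<lambda>s w. filled n 0 0 (s 1) \<and> s 10 = st \<and> s 11 0 = lev \<and> s 12 0 = cd \<and> w = [])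
    fillC (n * ((1 + (1 + 1 + 1)) + 3) + 3) (\<lambda>s w. filled n 0 0 (s 1) \<and> s 10 = pth \<and> w = [])"
proof -
  \<comment> \<open>The content of register 12: the announced state until it is placed at
    \<open>lev + 1\<close>, afterwards the greedy successor of the state placed last.\<close>
  let ?cur = "\<lambda>l. if l \<le> lev then cd else nx l (pth l) 0"
  let ?I = "\<lambda>l s w. s 13 0 = l \<and> filled n 0 0 (s 1) \<and> s 10 = (\<lambda>i. if i \<le> l then pth i else st i) \<and>
     s 11 0 = lev \<and> s 12 0 = ?cur l \<and> w = ([] :: nat list)"
  have pst: "pth i = st i" if "i \<le> lev" for i using fillp_le[OF lev(1) that, of st cd] f by simp
  have pSuc: "pth (Suc l) = ?cur l" if "lev \<le> l" "l < n" for l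
    using that unfolding f[symmetric] by auto
  have "tr inp Bd (\<lambda>s w. filled n 0 0 (s 1) \<and> s 10 = st \<and> s 11 0 = lev \<and> s 12 0 = cd \<and> w = [])
    fillC (n * ((1 + (1 + 1 + 1)) + 3) + 3) (?I n)"
    unfolding fillC_def
  proof (rule tr_For[where I = ?I])
    fix l assume l: "l < n"
    let ?Q = "\<lambda>s w. s 13 0 = l \<and> ?I (Suc l) (cell 13 (Suc l) s) w"
    show "tr inp Bd (?I l) (If (leE (reg 11) (reg 13)) (Seq (Assign 10 (SucE (reg 13)) (reg 12))
       (Assign 12 (Const 0) (Cell 1 (addrE (SucE (reg 13)) (reg 12) (Const 0))))) skipC) (1 + (1 + 1 + 1)) ?Q"
    proof (rule tr_If)
      show "tr inp Bd (\<lambda>s w. ?I l s w \<and> aval inp s (leE (reg 11) (reg 13)) \<noteq> 0) (Seq (Assign 10 (SucE (reg 13)) (reg 12))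
         (Assign 12 (Const 0) (Cell 1 (addrE (SucE (reg 13)) (reg 12) (Const 0))))) (1 + 1 + 1) ?Q"
      proof ((rule tr_Seq[where R = "\<lambda>s w. s 13 0 = l \<and> filled n 0 0 (s 1) \<and>
          s 10 = (\<lambda>i. if i \<le> Suc l then pth i else st i) \<and> s 11 0 = lev \<and> s 12 0 = pth (Suc l) \<and> lev \<le> l \<and> w = []"];
          rule tr_Assign), goal_cases)
        case (1 s w)
        then have "lev \<le> l" by simp
        with 1 l pSuc[of l] pth_less[of "Suc l"] Bd_simps show ?case by (auto simp: le_Suc_eq)
      next
        case (2 s w)
        then have "s 1 (addr (Suc l) (pth (Suc l)) 0) = nx (Suc l) (pth (Suc l)) 0"
          using l pth_less[of "Suc l"] by (intro filledD) auto
        with 2 show ?case using nx_le[of "Suc l" "pth (Suc l)" 0] Bd_simps by simp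
      qed
      show "tr inp Bd (\<lambda>s w. ?I l s w \<and> aval inp s (leE (reg 11) (reg 13)) = 0) skipC 1 ?Q"
      proof (rule tr_conseq[OF tr_skipC])
        fix s :: store and w :: "nat list" assume I: "?I l s w \<and> aval inp s (leE (reg 11) (reg 13)) = 0"
        then show "s 13 0 \<le> Bd" using l Bd_simps by simp
        from I have "l < lev" by simp
        then have "(\<lambda>i. if i \<le> l then pth i else st i) = (\<lambda>i. if i \<le> Suc l then pth i else st i)"
          using pst[of "Suc l"] by (auto simp: le_Suc_eq)
        then show "?Q s w" using I \<open>l < lev\<close> by simp
      qed auto
    qed auto
  next
    fix s :: store and w :: "nat list" assume "filled n 0 0 (s 1) \<and> s 10 = st \<and> s 11 0 = lev \<and> s 12 0 = cd \<and> w = []"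
    moreover have "(\<lambda>i. if i \<le> 0 then pth i else st i) = st" using pst[of 0] by auto
    ultimately show "?I 0 (cell 13 0 s) w" by simp
  qed (use Bd_simps in auto)
  then show ?thesis
  proof (rule tr_conseq)
    fix s :: store and w :: "nat list" assume I: "?I n s w"
    have "(\<lambda>i. if i \<le> n then pth i else st i) = pth" using st pth_beyond by auto
    then show "filled n 0 0 (s 1) \<and> s 10 = pth \<and> w = []" using I by simp
  qed auto
qed

definition word :: "nat list" where
  "word = map ((!) xs) (filter (\<lambda>i. bitp (pth (Suc i))) [0..<n])"

lemma emitC_tr:
  "tr inp Bd (\<lambda>s w. filled n 0 0 (s 1) \<and> s 10 = pth \<and> w = []) emitC (n * ((1 + 1) + 3) + 3)
     (\<lambda>s w. filled n 0 0 (s 1) \<and> s 10 = pth \<and> w = word)"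
proof -
  let ?w = "\<lambda>l. map ((!) xs) (filter (\<lambda>i. bitp (pth (Suc i))) [0..<l])"
  let ?I = "\<lambda>l s w. s 13 0 = l \<and> filled n 0 0 (s 1) \<and> s 10 = pth \<and> w = ?w l"
  have "tr inp Bd (\<lambda>s w. filled n 0 0 (s 1) \<and> s 10 = pth \<and> w = []) emitC (n * ((1 + 1) + 3) + 3) (?I n)"
    unfolding emitC_def
  proof (rule tr_For[where I = ?I])
    fix l assume l: "l < n"
    show "tr inp Bd (?I l) (If (bitE (Cell 10 (SucE (reg 13)))) (Emit (xE (reg 13))) skipC) (1 + 1)
       (\<lambda>s w. s 13 0 = l \<and> ?I (Suc l) (cell 13 (Suc l) s) w)"
    proof (rule tr_If)
      show "tr inp Bd (\<lambda>s w. ?I l s w \<and> aval inp s (bitE (Cell 10 (SucE (reg 13)))) \<noteq> 0) (Emit (xE (reg 13))) 1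
         (\<lambda>s w. s 13 0 = l \<and> ?I (Suc l) (cell 13 (Suc l) s) w)"
        by (rule tr_Emit) (use l in auto)
      show "tr inp Bd (\<lambda>s w. ?I l s w \<and> aval inp s (bitE (Cell 10 (SucE (reg 13)))) = 0) skipC 1
         (\<lambda>s w. s 13 0 = l \<and> ?I (Suc l) (cell 13 (Suc l) s) w)"
        by (rule tr_conseq[OF tr_skipC]) (use l Bd_simps in auto)
    qed auto
  qed (use Bd_simps in auto)
  then show ?thesis by (rule tr_conseq) (auto simp: word_def)
qed

lemma backC_tr:
  "tr inp Bd (\<lambda>s w. filled n 0 0 (s 1) \<and> s 10 = pth \<and> w = []) backC (1 + 1 + (n * ((1 + (1 + 1 + 1)) + 3) + 3))
     (\<lambda>s w. filled n 0 0 (s 1) \<and> s 10 = pth \<and> w = [] \<and>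
       (if s 12 0 < M then s 11 0 < n \<and> s 12 0 = nx (s 11 0) (pth (s 11 0)) (Suc (pth (Suc (s 11 0)))) else s 12 0 = M) \<and>
       (\<forall>i<n. (s 12 0 < M \<longrightarrow> s 11 0 < i) \<longrightarrow> M \<le> nx i (pth i) (Suc (pth (Suc i)))))"
proof -
  let ?nx = "\<lambda>i. nx i (pth i) (Suc (pth (Suc i)))"
  \<comment> \<open>Two modes: once register 12 is below \<open>M\<close>, it is frozen together
    with the level, and no deeper level has a larger successor; before that, the last
    \<open>l\<close> layers have been searched in vain.\<close>
  let ?I = "\<lambda>l s w. s 13 0 = l \<and> filled n 0 0 (s 1) \<and> s 10 = pth \<and> w = ([] :: nat list) \<and>
      (if s 12 0 < M then s 11 0 < n \<and> s 12 0 = ?nx (s 11 0) \<and> (\<forall>i<n. s 11 0 < i \<longrightarrow> M \<le> ?nx i)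
       else s 12 0 = M \<and> (\<forall>i<n. n \<le> i + l \<longrightarrow> M \<le> ?nx i))"
  have "tr inp Bd (\<lambda>s w. filled n 0 0 (s 1) \<and> s 10 = pth \<and> w = []) backC
      (1 + 1 + (n * ((1 + (1 + 1 + 1)) + 3) + 3)) (?I n)"
    unfolding backC_def
  proof (rule tr_Seq[where R = "\<lambda>s w. filled n 0 0 (s 1) \<and> s 10 = pth \<and> w = [] \<and> s 12 0 = M"])
    show "tr inp Bd (\<lambda>s w. filled n 0 0 (s 1) \<and> s 10 = pth \<and> w = []) (Assign 12 (Const 0) ME) 1
       (\<lambda>s w. filled n 0 0 (s 1) \<and> s 10 = pth \<and> w = [] \<and> s 12 0 = M)"
      by (rule tr_Assign) (use Bd_simps in simp)
    show "tr inp Bd (\<lambda>s w. filled n 0 0 (s 1) \<and> s 10 = pth \<and> w = [] \<and> s 12 0 = M) (For 13 nE (If (leE ME (reg 12))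
     (Seq (Assign 11 (Const 0) (Minus (Minus nE (Const 1)) (reg 13)))
       (Assign 12 (Const 0) (Cell 1 (addrE (reg 11) (Cell 10 (reg 11)) (SucE (Cell 10 (SucE (reg 11)))))))) skipC))
       (n * ((1 + (1 + 1 + 1)) + 3) + 3) (?I n)"
    proof (rule tr_For[where I = ?I])
      fix l assume l: "l < n"
      let ?Q = "\<lambda>s w. s 13 0 = l \<and> ?I (Suc l) (cell 13 (Suc l) s) w"
      let ?i = "n - 1 - l"
      show "tr inp Bd (?I l) (If (leE ME (reg 12))
         (Seq (Assign 11 (Const 0) (Minus (Minus nE (Const 1)) (reg 13)))
           (Assign 12 (Const 0) (Cell 1 (addrE (reg 11) (Cell 10 (reg 11)) (SucE (Cell 10 (SucE (reg 11)))))))) skipC)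
           (1 + (1 + 1 + 1)) ?Q"
      proof (rule tr_If)
        show "tr inp Bd (\<lambda>s w. ?I l s w \<and> aval inp s (leE ME (reg 12)) \<noteq> 0)
           (Seq (Assign 11 (Const 0) (Minus (Minus nE (Const 1)) (reg 13)))
           (Assign 12 (Const 0) (Cell 1 (addrE (reg 11) (Cell 10 (reg 11)) (SucE (Cell 10 (SucE (reg 11)))))))) (1 + 1 + 1) ?Q"
        proof ((rule tr_Seq[where R = "\<lambda>s w. s 13 0 = l \<and> filled n 0 0 (s 1) \<and> s 10 = pth \<and> w = [] \<and> s 11 0 = ?i \<and>
             (\<forall>i<n. n \<le> i + l \<longrightarrow> M \<le> ?nx i)"]; rule tr_Assign), goal_cases)
          case (1 s w)
          then have "\<not> s 12 0 < M" by simp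
          with 1 show ?case using Bd_simps by simp
        next
          case (2 s w)
          have i: "?i < n" "Suc ?i \<le> n" using l by auto
          have e: "s 1 (addr ?i (pth ?i) (Suc (pth (Suc ?i)))) = ?nx ?i"
            using 2 i pth_less[of ?i] pth_less[of "Suc ?i"] by (intro filledD) auto
          have "?nx ?i \<le> M" by (rule nx_le)
          have "M \<le> ?nx j" if "j < n" "n \<le> j + Suc l" "?nx ?i = M" for j
          proof (cases "j = ?i")
            case False
            then have "n \<le> j + l" using that(1,2) l by auto
            then show ?thesis using 2 that(1) by blast
          qed (use that in simp)
          moreover have "M \<le> ?nx j" if "j < n" "?i < j" for j
          proof -
            have "n \<le> j + l" using that l by auto
            then show ?thesis using 2 that(1) by blast
          qed
          moreover have "?nx ?i \<le> Bd" using \<open>?nx ?i \<le> M\<close> Bd_simps by simp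
          moreover have v: "aval inp s (Cell 1 (addrE (reg 11) (Cell 10 (reg 11)) (SucE (Cell 10 (SucE (reg 11)))))) = ?nx ?i"
            using 2 e by simp
          moreover have "?nx ?i < M \<or> ?nx ?i = M" using \<open>?nx ?i \<le> M\<close> by auto
          moreover have "s 13 0 = l" "filled n 0 0 (s 1)" "s 10 = pth" "w = []" "s 11 0 = ?i" using 2 by auto
          ultimately show ?case using i unfolding v by (auto simp del: diff_diff_left)
        qed
        show "tr inp Bd (\<lambda>s w. ?I l s w \<and> aval inp s (leE ME (reg 12)) = 0) skipC 1 ?Q"
          by (rule tr_conseq[OF tr_skipC]) (use l Bd_simps in auto)
      qed auto
    qed (use Bd_simps in auto)
  qed
  then show ?thesis
  proof (rule tr_conseq)
    fix s :: store and w :: "nat list" assume I: "?I n s w"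
    then show "filled n 0 0 (s 1) \<and> s 10 = pth \<and> w = [] \<and>
       (if s 12 0 < M then s 11 0 < n \<and> s 12 0 = nx (s 11 0) (pth (s 11 0)) (Suc (pth (Suc (s 11 0)))) else s 12 0 = M) \<and>
       (\<forall>i<n. (s 12 0 < M \<longrightarrow> s 11 0 < i) \<longrightarrow> M \<le> nx i (pth i) (Suc (pth (Suc i))))"
      by (cases "s 12 0 < M") auto
  qed auto
qed

end

text \<open>Array 10 is compared with paths as a whole function, hence the condition on the cells
  beyond \<open>n\<close>.\<close>

definition state_ok :: "nat \<Rightarrow> store \<Rightarrow> bool" where
  "state_ok k s \<longleftrightarrow> filled n 0 0 (s 1) \<and> (\<forall>i>n. s 10 i = 0) \<and> pending_path k (s 10) (s 11 0) (s 12 0)"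

definition out :: "nat \<Rightarrow> nat list" where "out k = word (path_list ! k)"

definition "T_pre = 1 + (1 + (m * ((1 + 1 + 1) + 3) + 3) + (1 + T_table + 1))"
text \<open>Seven steps per vertex for each of the two sweeps and five for the emission; the
  constant is generous.\<close>

definition "T_iter = 19 * n + 20"

definition bodyC :: com where "bodyC = Seq fillC (Seq emitC (Seq Finish backC))"

lemma mainC_eq: "mainC = Seq (Seq adjC (Seq tableC (Assign 12 (Const 0) (Cell 1 (addrE (Const 0) (Const 0) (Const 0))))))
     (While (ltE (reg 12) ME) bodyC)"
  by (simp add: mainC_def bodyC_def)

lemma init_reach:
  "\<exists>s. state_ok 0 s \<and> reach inp Bd T_pre (Config [mainC] (\<lambda>x a. 0) [] []) (Config [While (ltE (reg 12) ME) bodyC] s [] [])"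
proof -
  let ?pre = "Seq adjC (Seq tableC (Assign 12 (Const 0) (Cell 1 (addrE (Const 0) (Const 0) (Const 0)))))"
  have "tr inp Bd (\<lambda>s w. s = (\<lambda>x a. 0) \<and> w = []) ?pre (1 + (m * ((1 + 1 + 1) + 3) + 3) + (1 + T_table + 1))
     (\<lambda>s w. state_ok 0 s \<and> w = [])"
  proof (rule tr_Seq[OF adjC_tr], rule tr_Seq[where R = "tab n 0 0"], rule tr_conseq[OF tableC_tr])
    fix s :: store and w :: "nat list" assume a: "adj_table (s 0) \<and> same {0, 2} s (\<lambda>x a. 0) \<and> w = []"
    then have "s 1 = (\<lambda>_. 0)" "s 10 = (\<lambda>_. 0)" "s 11 = (\<lambda>_. 0)" by (auto simp: same_def)
    then show "tab 0 0 0 s w" using a filled_0 by simp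
  next
    show "tr inp Bd (tab n 0 0) (Assign 12 (Const 0) (Cell 1 (addrE (Const 0) (Const 0) (Const 0)))) 1
       (\<lambda>s w. state_ok 0 s \<and> w = [])"
    proof (rule tr_Assign, goal_cases)
      case (1 s w)
      then have "s 1 (addr 0 0 0) = nx 0 0 0" using M n by (intro filledD) auto
      with 1 show ?case using nx_le[of 0 0 0] pending_path_0 n Bd_simps by (simp add: state_ok_def)
    qed
  qed auto
  moreover have "bnd Bd (\<lambda>x a. 0)" by (simp add: bnd_def)
  ultimately obtain s w where s: "state_ok 0 s \<and> w = []"
    "\<And>cs os. reach inp Bd (1 + (m * ((1 + 1 + 1) + 3) + 3) + (1 + T_table + 1)) (Config (?pre # cs) (\<lambda>x a. 0) [] os) (Config cs s w os)"
    unfolding tr_def by blast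
  have "reach inp Bd T_pre (Config [mainC] (\<lambda>x a. 0) [] []) (Config [While (ltE (reg 12) ME) bodyC] s w [])"
    by (rule reach_trans[OF reach_step s(2)]) (auto simp: mainC_eq bnd_def T_pre_def)
  then show ?thesis using s(1) by auto
qed

text \<open>The three triples are joined around \<open>Finish\<close> by single steps, because
  \<open>tr\<close> cannot express a new output.\<close>

lemma iter_reach:
  assumes k: "k < length path_list" and s: "state_ok k s" "bnd Bd s"
  shows "aval inp s (ltE (reg 12) ME) \<noteq> 0"
    and "\<exists>s'. state_ok (Suc k) s' \<and> (\<forall>cs os. reach inp Bd T_iter (Config (bodyC # cs) s [] os) (Config cs s' [] (os @ [out k])))"
proof -
  let ?pth = "path_list ! k"
  have pth: "?pth \<in> paths" using k path_list(2) nth_mem by metis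
  have c: "s 12 0 < M" "s 11 0 < n" "fillp (s 10) (s 11 0) (s 12 0) = ?pth"
    using s(1) k unfolding state_ok_def pending_path_def by (auto split: if_splits)
  show "aval inp s (ltE (reg 12) ME) \<noteq> 0" using c(1) by simp
  have z: "s 10 i = 0" if "n < i" for i using s(1) that unfolding state_ok_def by blast
  have p1: "filled n 0 0 (s 1) \<and> s 10 = s 10 \<and> s 11 0 = s 11 0 \<and> s 12 0 = s 12 0 \<and> [] = ([] :: nat list)"
    using s(1) unfolding state_ok_def by simp
  obtain s1 where s1: "filled n 0 0 (s1 1) \<and> s1 10 = ?pth \<and> [] = ([] :: nat list)" "bnd Bd s1"
    "\<And>cs os. reach inp Bd (n * ((1 + (1 + 1 + 1)) + 3) + 3) (Config (fillC # cs) s [] os) (Config cs s1 [] os)"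
    using trE[OF fillC_tr[OF pth c(3,2,1) z] p1 s(2)] by blast
  obtain s2 where s2: "filled n 0 0 (s2 1) \<and> s2 10 = ?pth \<and> [] = ([] :: nat list)" "bnd Bd s2"
    "\<And>cs os. reach inp Bd (n * ((1 + 1) + 3) + 3) (Config (emitC # cs) s1 [] os) (Config cs s2 (word ?pth) os)"
    using trE[OF emitC_tr[OF pth] s1(1,2)] by blast
  obtain s3 where s3: "filled n 0 0 (s3 1)" "s3 10 = ?pth"
      "if s3 12 0 < M then s3 11 0 < n \<and> s3 12 0 = nx (s3 11 0) (?pth (s3 11 0)) (Suc (?pth (Suc (s3 11 0)))) else s3 12 0 = M"
      "\<forall>i<n. (s3 12 0 < M \<longrightarrow> s3 11 0 < i) \<longrightarrow> M \<le> nx i (?pth i) (Suc (?pth (Suc i)))"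
    "\<And>cs os. reach inp Bd (1 + 1 + (n * ((1 + (1 + 1 + 1)) + 3) + 3)) (Config (backC # cs) s2 [] os) (Config cs s3 [] os)"
    using trE[OF backC_tr[OF pth] s2(1,2)] by blast
  have "pending_path (Suc k) (s3 10) (s3 11 0) (s3 12 0)"
    unfolding s3(2) using s3(4) by (intro pending_path_Suc[OF k refl s3(3)]) blast
  then have ok: "state_ok (Suc k) s3" using s3(1,2) pth by (auto simp: state_ok_def paths_def)
  have "reach inp Bd T_iter (Config (bodyC # cs) s [] os) (Config cs s3 [] (os @ [out k]))" for cs os
  proof -
    have 1: "reach inp Bd 1 (Config (bodyC # cs) s [] os) (Config (fillC # Seq emitC (Seq Finish backC) # cs) s [] os)"
      using s(2) by (intro reach_step) (auto simp: bodyC_def)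
    have 2: "reach inp Bd 1 (Config (Seq emitC (Seq Finish backC) # cs) s1 [] os) (Config (emitC # Seq Finish backC # cs) s1 [] os)"
      using s1(2) by (intro reach_step) auto
    have 3: "reach inp Bd 1 (Config (Seq Finish backC # cs) s2 (word ?pth) os) (Config (Finish # backC # cs) s2 (word ?pth) os)"
      using s2(2) by (intro reach_step) auto
    have 4: "reach inp Bd 1 (Config (Finish # backC # cs) s2 (word ?pth) os) (Config (backC # cs) s2 [] (os @ [out k]))"
      using s2(2) by (intro reach_step) (auto simp: out_def)
    show ?thesis
      by (rule reach_mono, rule reach_trans[OF 1 reach_trans[OF s1(3) reach_trans[OF 2 reach_trans[OF s2(3)
        reach_trans[OF 3 reach_trans[OF 4 s3(5) order_refl] order_refl] order_refl] order_refl] order_refl] order_refl])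
        (simp add: T_iter_def)
  qed
  then show "\<exists>s'. state_ok (Suc k) s' \<and> (\<forall>cs os. reach inp Bd T_iter (Config (bodyC # cs) s [] os) (Config cs s' [] (os @ [out k])))"
    using ok by blast
qed

lemma set_out: "k < length path_list \<Longrightarrow> set (out k) = (!) xs ` chosen (path_list ! k)"
proof -
  assume "k < length path_list"
  then have "path_list ! k \<in> paths" using path_list(2) nth_mem by metis
  then show ?thesis by (auto simp: out_def word_def chosen_def)
qed

lemma distinct_out: "k < length path_list \<Longrightarrow> distinct (out k)"
proof -
  assume "k < length path_list"
  then have "path_list ! k \<in> paths" using path_list(2) nth_mem by metis
  then show ?thesis using xs_eq by (auto simp: out_def word_def distinct_map inj_on_def)
qed

lemma set_outs: "set (map set (map out [0..<length path_list])) = {D. one_minimal \<sigma> \<rho> G D}"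
proof -
  have "set (map set (map out [0..<length path_list])) = (\<lambda>k. (!) xs ` chosen (path_list ! k)) ` {0..<length path_list}"
    by (auto simp: set_out)
  also have "\<dots> = (\<lambda>st. (!) xs ` chosen st) ` (!) path_list ` {0..<length path_list}" by (simp only: image_image)
  also have "(!) path_list ` {0..<length path_list} = set path_list" by (auto simp: in_set_conv_nth)
  also have "(\<lambda>st. (!) xs ` chosen st) ` set path_list = {D. one_minimal \<sigma> \<rho> G D}"
    using solutions unfolding path_list(2) bij_betw_def by simp
  finally show ?thesis .
qed

lemma distinct_outs: "distinct (map set (map out [0..<length path_list]))"
proof -
  have "map set (map out [0..<length path_list]) = map (\<lambda>st. (!) xs ` chosen st) path_list"
    by (rule nth_equalityI) (auto simp: set_out)
  then show ?thesis using solutions distinct_path_list unfolding path_list(2)[symmetric] bij_betw_def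
    by (simp add: distinct_map)
qed

lemma card_solutions: "card {D. one_minimal \<sigma> \<rho> G D} = length path_list"
  using set_outs distinct_card[OF distinct_outs] by simp

lemma enumeration:
  shows "enumerates mainC inp {D. one_minimal \<sigma> \<rho> G D}"
    and "out_time mainC inp 1 \<le> T_pre + T_iter + 1"
    and "k \<in> {1..card {D. one_minimal \<sigma> \<rho> G D}} \<Longrightarrow> out_time mainC inp (Suc k) \<le> out_time mainC inp k + (2 * T_iter + 3)"
    and "word_bounded mainC inp Bd"
proof -
  obtain s0 where s0: "state_ok 0 s0"
    "reach inp Bd T_pre (Config [mainC] (\<lambda>x a. 0) [] []) (Config [While (ltE (reg 12) ME) bodyC] s0 [] [])"
    using init_reach by blast
  have it: "aval inp s (ltE (reg 12) ME) \<noteq> 0 \<and> (\<exists>s'. state_ok (Suc k) s' \<and>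
      (\<forall>os. reach inp Bd T_iter (Config [bodyC, While (ltE (reg 12) ME) bodyC] s [] os)
        (Config [While (ltE (reg 12) ME) bodyC] s' [] (os @ [out k]))))"
    if "k < length path_list" "state_ok k s" "bnd Bd s" for k s
    using iter_reach[OF that] by blast
  have stop: "aval inp s (ltE (reg 12) ME) = 0" if "state_ok (length path_list) s" for s
    using that by (auto simp: state_ok_def pending_path_def split: if_splits)
  note loop = output_loop[where J = state_ok and K = "length path_list" and out = out, OF s0(2,1) it stop]
  obtain t where t: "halted (run mainC inp t)" "pending (run mainC inp t) = []"
    "outs (run mainC inp t) = map out [0..<length path_list]" using loop(1) by blast
  show "enumerates mainC inp {D. one_minimal \<sigma> \<rho> G D}"
    unfolding enumerates_def Let_def
  proof (intro exI conjI)
    show "halted (run mainC inp t)" "pending (run mainC inp t) = []" by fact+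
    show "\<forall>ws\<in>set (outs (run mainC inp t)). distinct ws" unfolding t(3) using distinct_out by auto
    show "distinct (map set (outs (run mainC inp t)))" unfolding t(3) by (rule distinct_outs)
    show "set ` set (outs (run mainC inp t)) = {D. one_minimal \<sigma> \<rho> G D}"
      using set_outs unfolding t(3) by (simp only: set_map)
  qed
  show "out_time mainC inp 1 \<le> T_pre + T_iter + 1" by (rule loop(2))
  show "out_time mainC inp (Suc k) \<le> out_time mainC inp k + (2 * T_iter + 3)"
    if "k \<in> {1..card {D. one_minimal \<sigma> \<rho> G D}}"
    using loop(3) that unfolding card_solutions by blast
  show "word_bounded mainC inp Bd" by (rule loop(4))
qed

end

section \<open>Polynomial bounds\<close>

text \<open>The bounds are polymorphic so that the same expression can be read as a number and as a polynomial.\<close>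

definition time_bound :: "'a::comm_semiring_1 \<Rightarrow> 'a \<Rightarrow> 'a \<Rightarrow> 'a" where
  "time_bound n m M = (let f = n * 4 + 3; e = M * (f + 7) + 3; t = e + f + 5 in
     n * (M * (M * (t + 3) + 8) + 6) + 3 + m * 6 + 20 + 19 * n + 30)"

definition word_bound :: "'a::comm_semiring_1 \<Rightarrow> 'a \<Rightarrow> 'a \<Rightarrow> 'a" where
  "word_bound n m M = (n + 1) * (M + 1) * (M + 1) + (n + 1) * (n + 1) + m"

lemma poly_time_bound: "poly (time_bound p q r) x = time_bound (poly p x) (poly q x) (poly r x)"
  and poly_word_bound: "poly (word_bound p q r) x = word_bound (poly p x) (poly q x) (poly r x)"
  by (simp_all add: time_bound_def word_bound_def Let_def)

lemma time_bound_mono: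
  fixes n :: nat
  shows "n \<le> n' \<Longrightarrow> m \<le> m' \<Longrightarrow> M \<le> M' \<Longrightarrow> time_bound n m M \<le> time_bound n' m' M'"
  unfolding time_bound_def Let_def by (intro add_mono mult_le_mono order_refl)

lemma word_bound_mono:
  fixes n :: nat
  shows "n \<le> n' \<Longrightarrow> m \<le> m' \<Longrightarrow> M \<le> M' \<Longrightarrow> word_bound n m M \<le> word_bound n' m' M'"
  unfolding word_bound_def by (intro add_mono mult_le_mono order_refl)

theorem theorem23:
  fixes \<sigma> \<rho> :: "nat set" and c :: nat
  assumes "finite \<sigma> \<or> finite (- \<sigma>)" and "finite \<rho> \<or> finite (- \<rho>)" and "c \<ge> 1"
  shows "linear_delay_poly_space
    {(G :: nat cgraph, xs, es). colored_graph G \<and> card (verts G) \<ge> 2 \<and> verts G = {0..<card (verts G)} \<and>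
       edge_listing G es \<and> linear_ordering G xs \<and> mim_width G xs \<le> c}
    (\<lambda>(G, xs, es). encode G xs es)
    (\<lambda>(G, xs, es). card (verts G) + card (edges G))
    (\<lambda>(G, xs, es). {D. one_minimal \<sigma> \<rho> G D})"
proof -
  obtain d1 where d1: "\<And>k. d1 \<le> k \<Longrightarrow> k \<in> \<sigma> \<longleftrightarrow> d1 \<in> \<sigma>" using ex_cutoff[OF assms(1)] by blast
  obtain d2 where d2: "\<And>k. d2 \<le> k \<Longrightarrow> k \<in> \<rho> \<longleftrightarrow> d2 \<in> \<rho>" using ex_cutoff[OF assms(2)] by blast
  \<comment> \<open>One more than both cutoffs, so that membership is constant from
    \<open>dd - 1\<close> on.\<close>
  define dd where "dd = Suc (max d1 d2)"
  define r where "r = dd * c"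
  define P where "P = machine.mainC \<sigma> \<rho> dd r"
  define X :: "nat poly" where "X = [:0, 1:]"
  \<comment> \<open>The exponent depends on \<sigma>, \<rho> and \<open>c\<close> only, so this is
    one polynomial for all instances; it bounds the number of codes because
    \<open>n \<le> N\<close>.\<close>
  define XM :: "nat poly" where "XM = 2 * (X + 1) ^ (4 * r)"
  have X: "poly X N = N" "poly XM N = 2 * (N + 1) ^ (4 * r)" for N by (auto simp: X_def XM_def)
  define p where "p = time_bound X X XM"
  define w where "w = word_bound X X XM"
  define q where "q = of_nat (card (arrs P)) * (w + 1)"
  \<comment> \<open>The delay bound is \<open>2 * T_iter + 3\<close> with \<open>n\<close> replaced
    by the instance size \<open>N\<close>.\<close>
  have main: "enumerates P (encode G xs es) {D. one_minimal \<sigma> \<rho> G D} \<and>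
      out_time P (encode G xs es) 1 \<le> poly p N \<and>
      (\<forall>k\<in>{1..card {D. one_minimal \<sigma> \<rho> G D}}.
         out_time P (encode G xs es) (Suc k) \<le> out_time P (encode G xs es) k + (38 * N + 43)) \<and>
      word_bounded P (encode G xs es) (poly w N) \<and> space P (encode G xs es) \<le> poly q N"
    if "colored_graph G" "card (verts G) \<ge> 2" "verts G = {0..<card (verts G)}" "edge_listing G es"
      "linear_ordering G xs" "mim_width G xs \<le> c" and N: "N = card (verts G) + card (edges G)"
    for G :: "nat cgraph" and xs es N
  proof -
    have cut: "k \<in> \<sigma> \<longleftrightarrow> dd - 1 \<in> \<sigma>" "k \<in> \<rho> \<longleftrightarrow> dd - 1 \<in> \<rho>" if "dd - 1 \<le> k" for k
      using d1[of k] d1[of "dd - 1"] d2[of k] d2[of "dd - 1"] that by (auto simp: dd_def)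
    interpret I: inst G xs es \<sigma> \<rho> c dd
    proof
      show "dd > 0" by (simp add: dd_def)
    qed (fact that assms(3) cut)+
    have P: "P = I.mainC" by (simp add: P_def r_def I.r_def)
    have le: "I.n \<le> N" "I.m \<le> N" "I.M \<le> poly XM N"
      using N I.n_card I.m_card X by (auto simp: I.M_def I.B_def I.r_def r_def power_mono)
    have "I.T_pre + I.T_iter + 1 \<le> time_bound I.n I.m I.M"
      by (simp add: I.T_pre_def I.T_iter_def I.T_table_def I.T_row_def I.T_entry_def I.T_least_def I.T_equiv_def
          time_bound_def Let_def algebra_simps)
    also have "\<dots> \<le> poly p N" unfolding p_def poly_time_bound X(1) using le by (intro time_bound_mono)
    finally have t: "out_time P (encode G xs es) 1 \<le> poly p N"
      using I.enumeration(2) unfolding P I.inp_def by simp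
    have "I.Bd = word_bound I.n I.m I.M" by (simp add: I.Bd_def word_bound_def)
    also have "\<dots> \<le> poly w N" unfolding w_def poly_word_bound X(1) using le by (intro word_bound_mono)
    finally have wb: "word_bounded P (encode G xs es) (poly w N)"
      using I.enumeration(4) unfolding P I.inp_def word_bounded_def Let_def by (meson order_trans)
    have "space P (encode G xs es) \<le> poly q N" using space_le[OF wb] by (simp add: q_def)
    moreover have "out_time P (encode G xs es) (Suc k) \<le> out_time P (encode G xs es) k + (38 * N + 43)"
      if "k \<in> {1..card {D. one_minimal \<sigma> \<rho> G D}}" for k
    proof -
      have "2 * I.T_iter + 3 \<le> 38 * N + 43" using le(1) by (simp add: I.T_iter_def)
      then show ?thesis using I.enumeration(3)[OF that] unfolding P I.inp_def
        by (meson add_left_mono order_trans)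
    qed
    ultimately show ?thesis using I.enumeration(1) t wb unfolding P I.inp_def by blast
  qed
  show ?thesis unfolding linear_delay_poly_space_def
  proof (intro exI ballI)
    fix x :: "nat cgraph \<times> nat list \<times> (nat \<times> nat) list"
    assume x: "x \<in> {(G, xs, es). colored_graph G \<and> card (verts G) \<ge> 2 \<and> verts G = {0..<card (verts G)} \<and>
       edge_listing G es \<and> linear_ordering G xs \<and> mim_width G xs \<le> c}"
    obtain G xs es where [simp]: "x = (G, xs, es)" by (cases x)
    show "enumerates P (case x of (G, xs, es) \<Rightarrow> encode G xs es) (case x of (G, xs, es) \<Rightarrow> {D. one_minimal \<sigma> \<rho> G D}) \<and>
      out_time P (case x of (G, xs, es) \<Rightarrow> encode G xs es) 1 \<le> poly p (case x of (G, xs, es) \<Rightarrow> card (verts G) + card (edges G)) \<and>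
      (\<forall>k\<in>{1..card (case x of (G, xs, es) \<Rightarrow> {D. one_minimal \<sigma> \<rho> G D})}.
         out_time P (case x of (G, xs, es) \<Rightarrow> encode G xs es) (Suc k) \<le> out_time P (case x of (G, xs, es) \<Rightarrow> encode G xs es) k +
           (38 * (case x of (G, xs, es) \<Rightarrow> card (verts G) + card (edges G)) + 43)) \<and>
      word_bounded P (case x of (G, xs, es) \<Rightarrow> encode G xs es) (poly w (case x of (G, xs, es) \<Rightarrow> card (verts G) + card (edges G))) \<and>
      space P (case x of (G, xs, es) \<Rightarrow> encode G xs es) \<le> poly q (case x of (G, xs, es) \<Rightarrow> card (verts G) + card (edges G))"
      using main[of G es xs "card (verts G) + card (edges G)"] x by simp
  qed
qed

end
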